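(* Let $\Lambda$ be a CSP (a finite collection of predicates over a finite domain $[q]$). If there is an $\alpha$ approximation algorithm for unweighted regular instances of Min-CSP $\Lambda$, then for every $\delta>0$ there is an $\alpha+\delta$ approximation algorithm for weighted instances of Min-CSP $\Lambda$ (with no regularity requirement).
   Context: A CSP over the language $\Sigma=[q]$, $q\in\mathbb{N}$, is a finite collection $\Lambda$ of predicates $P:[q]^k\to\{0,1\}$ (with $k=\mathrm{ar}(P)$ varying). An instance of $\Lambda$ consists of variables $x_1,\dots,x_n$ taking values in $\Sigma$ and constraints $C_1,\dots,C_m$, where $C_r=(P_r,S_r)$ with $P_r\in\Lambda$ and $S_r$ an ordered tuple of $\mathrm{ar}(P_r)$ distinct variables (the scope). In a weighted instance each constraint has a weight $w_r\ge 0$ with $\sum_r w_r=1$; an unweighted instance is one with $w_r=1/m$ for all $r$. The degree of a variable $x_i$ is the number of constraints whose scope contains $x_i$; an instance is regular if all variables have the same degree. For an assignment $\chi:\{x_1,\dots,x_n\}\to\Sigma$, $\mathrm{Val}_\chi(\mathcal F)=\sum_r w_r P_r(\chi(S_r))$. For Min-CSP $\Lambda$, $\mathrm{Opt}(\mathcal F)=\min_\chi \mathrm{Val}_\chi(\mathcal F)$, and an $\alpha$ approximation algorithm (for a given class of instances) is a polynomial-time algorithm that on each instance $\mathcal F$ of the class outputs an assignment $\chi$ with $\mathrm{Val}_\chi(\mathcal F)\le \alpha\cdot\mathrm{Opt}(\mathcal F)$ (by convention $\alpha>1$). *)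

theory Defs
  imports Complex_Main "HOL-Computational_Algebra.Polynomial"
begin

section \<open>Constraint satisfaction problems\<close>

text \<open>
  The alphabet $[q]$ is \<open>{..<q}\<close>. A predicate $P : [q]^k \to \{0,1\}$ is an arity together
  with a function on lists, of which only the values on \<open>k\<close>-tuples over \<open>{..<q}\<close> matter.
  A CSP is a finite enumeration of predicates, and a constraint refers to its predicate
  by position. Weights are rational, so that an instance can be given to an algorithm.
  The constraints of an instance form a list: the same predicate and scope may occur repeatedly.
\<close>

datatype predicate = Predicate (arity: nat) (holds: "nat list \<Rightarrow> bool")

type_synonym csp = "predicate list"

datatype wconstraint = Constraint (weight: rat) (pred_idx: nat) (scope: "nat list")

datatype csp_inst = Inst (nvars: nat) (constraints: "wconstraint list")

definition wf_constraint :: "csp \<Rightarrow> nat \<Rightarrow> wconstraint \<Rightarrow> bool" where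
  "wf_constraint \<Lambda> n c \<longleftrightarrow>
     pred_idx c < length \<Lambda> \<and>
     length (scope c) = arity (\<Lambda> ! pred_idx c) \<and>
     distinct (scope c) \<and> set (scope c) \<subseteq> {..<n}"

definition weighted_instances :: "csp \<Rightarrow> csp_inst set" where
  "weighted_instances \<Lambda> = {F.
     (\<forall>c \<in> set (constraints F). wf_constraint \<Lambda> (nvars F) c \<and> weight c \<ge> 0) \<and>
     (\<Sum>c \<leftarrow> constraints F. weight c) = 1}"

definition unweighted :: "csp_inst \<Rightarrow> bool" where
  "unweighted F \<longleftrightarrow>
     (\<forall>c \<in> set (constraints F). weight c = 1 / of_nat (length (constraints F)))"

definition degree_of :: "csp_inst \<Rightarrow> nat \<Rightarrow> nat" where
  "degree_of F i = length (filter (\<lambda>c. i \<in> set (scope c)) (constraints F))"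

definition regular :: "csp_inst \<Rightarrow> bool" where
  "regular F \<longleftrightarrow> (\<exists>d. \<forall>i < nvars F. degree_of F i = d)"

definition unweighted_regular_instances :: "csp \<Rightarrow> csp_inst set" where
  "unweighted_regular_instances \<Lambda> =
     {F \<in> weighted_instances \<Lambda>. unweighted F \<and> regular F}"

definition assignments :: "nat \<Rightarrow> csp_inst \<Rightarrow> nat list set" where
  "assignments q F = {\<chi>. length \<chi> = nvars F \<and> set \<chi> \<subseteq> {..<q}}"

definition Val :: "csp \<Rightarrow> csp_inst \<Rightarrow> nat list \<Rightarrow> rat" where
  "Val \<Lambda> F \<chi> =
     (\<Sum>c \<leftarrow> constraints F.
        weight c * of_bool (holds (\<Lambda> ! pred_idx c) (map (\<lambda>i. \<chi> ! i) (scope c))))"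

definition Opt :: "csp \<Rightarrow> nat \<Rightarrow> csp_inst \<Rightarrow> rat" where
  "Opt \<Lambda> q F = Min (Val \<Lambda> F ` assignments q F)"


section \<open>Programs and running time\<close>

text \<open>
  Algorithms are programs of a first-order functional language with general recursion over
  binary trees (LISP cells with a single atom), in the style of the languages F and WHILE of
  N. D. Jones, Computability and Complexity from a Programming Perspective (1997).
  A program is a list of function bodies and a main expression. A body refers to the arguments
  of its call by position, the main expression refers to the input as \<open>Var 0\<close>.

  The time is the number of expression nodes evaluated. Every step allocates at most one cell
  and inspects at most the root of a tree (there is no equality test on trees), so with
  values stored as shared pointers \<open>t\<close> steps are simulated by a Turing machine in time
  polynomial in \<open>t\<close> and the input size. In particular, for functions with outputs of polynomial
  size, such as assignments, polynomial time here is the usual polynomial time.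
\<close>

datatype tree = Leaf | Node tree tree

fun left :: "tree \<Rightarrow> tree" where
  "left Leaf = Leaf"
| "left (Node a b) = a"

fun right :: "tree \<Rightarrow> tree" where
  "right Leaf = Leaf"
| "right (Node a b) = b"

datatype expr =
    Var nat
  | LeafE
  | NodeE expr expr
  | LeftE expr
  | RightE expr
  | IfLeaf expr expr expr
  | Call nat "expr list"

inductive
  eval :: "expr list \<Rightarrow> tree list \<Rightarrow> expr \<Rightarrow> tree \<Rightarrow> nat \<Rightarrow> bool" and
  evals :: "expr list \<Rightarrow> tree list \<Rightarrow> expr list \<Rightarrow> tree list \<Rightarrow> nat \<Rightarrow> bool"
  for fs :: "expr list"
where
  eval_Var: "i < length env \<Longrightarrow> eval fs env (Var i) (env ! i) 1"
| eval_Leaf: "eval fs env LeafE Leaf 1"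
| eval_Node: "eval fs env e1 v1 t1 \<Longrightarrow> eval fs env e2 v2 t2 \<Longrightarrow>
    eval fs env (NodeE e1 e2) (Node v1 v2) (t1 + t2 + 1)"
| eval_Left: "eval fs env e v t \<Longrightarrow> eval fs env (LeftE e) (left v) (t + 1)"
| eval_Right: "eval fs env e v t \<Longrightarrow> eval fs env (RightE e) (right v) (t + 1)"
| eval_If_Leaf: "eval fs env e Leaf t \<Longrightarrow> eval fs env e1 v t1 \<Longrightarrow>
    eval fs env (IfLeaf e e1 e2) v (t + t1 + 1)"
| eval_If_Node: "eval fs env e (Node a b) t \<Longrightarrow> eval fs env e2 v t2 \<Longrightarrow>
    eval fs env (IfLeaf e e1 e2) v (t + t2 + 1)"
| eval_Call: "f < length fs \<Longrightarrow> evals fs env es vs t1 \<Longrightarrow> eval fs vs (fs ! f) v t2 \<Longrightarrow>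
    eval fs env (Call f es) v (t1 + t2 + 1)"
| evals_Nil: "evals fs env [] [] 0"
| evals_Cons: "eval fs env e v t1 \<Longrightarrow> evals fs env es vs t2 \<Longrightarrow>
    evals fs env (e # es) (v # vs) (t1 + t2)"

datatype program = Program (fundefs: "expr list") (main: expr)

definition runs :: "program \<Rightarrow> tree \<Rightarrow> tree \<Rightarrow> nat \<Rightarrow> bool" where
  "runs p x y t \<longleftrightarrow> eval (fundefs p) [x] (main p) y t"

inductive_cases eval_elims:
  "eval fs env (Var i) v t"
  "eval fs env LeafE v t"
  "eval fs env (NodeE e1 e2) v t"
  "eval fs env (LeftE e) v t"
  "eval fs env (RightE e) v t"
  "eval fs env (IfLeaf e e1 e2) v t"
  "eval fs env (Call f es) v t"
  "evals fs env [] vs t"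
  "evals fs env (e # es) vs t"

lemma eval_det:
  "eval fs env e v t \<Longrightarrow> eval fs env e v' t' \<Longrightarrow> v' = v \<and> t' = t"
  "evals fs env es vs t \<Longrightarrow> evals fs env es vs' t' \<Longrightarrow> vs' = vs \<and> t' = t"
proof (induction arbitrary: v' t' and vs' t' rule: eval_evals.inducts)
  case (eval_Var i env)
  from eval_Var.prems show ?case by cases auto
next
  case (eval_Leaf env)
  from eval_Leaf.prems show ?case by cases auto
next
  case (eval_Node env e1 v1 t1 e2 v2 t2)
  from eval_Node.prems show ?case by cases (metis eval_Node.IH)
next
  case (eval_Left env e v t)
  from eval_Left.prems show ?case by cases (metis eval_Left.IH)
next
  case (eval_Right env e v t)
  from eval_Right.prems show ?case by cases (metis eval_Right.IH)
next
  case (eval_If_Leaf env e t e1 v t1 e2)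
  from eval_If_Leaf.prems show ?case by cases (metis eval_If_Leaf.IH tree.distinct)+
next
  case (eval_If_Node env e a b t e2 v t2 e1)
  from eval_If_Node.prems show ?case by cases (metis eval_If_Node.IH tree.distinct)+
next
  case (eval_Call f env es vs t1 v t2)
  from eval_Call.prems show ?case by cases (metis eval_Call.IH)
next
  case (evals_Nil env)
  from evals_Nil.prems show ?case by cases auto
next
  case (evals_Cons env e v t1 es vs t2)
  from evals_Cons.prems show ?case by cases (metis evals_Cons.IH)
qed

lemma runs_det: "runs p x y t \<Longrightarrow> runs p x y' t' \<Longrightarrow> y' = y \<and> t' = t"
  unfolding runs_def by (rule eval_det)


section \<open>Encoding of instances and assignments\<close>

text \<open>
  The number of variables and all indices are in unary (the size of an instance is
  at least its number of variables), numerators and denominators of weights are in binary.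
\<close>

fun enc_list :: "tree list \<Rightarrow> tree" where
  "enc_list [] = Leaf"
| "enc_list (x # xs) = Node x (enc_list xs)"

definition enc_unary :: "nat \<Rightarrow> tree" where
  "enc_unary n = enc_list (replicate n Leaf)"

fun enc_binary :: "nat \<Rightarrow> tree" where
  "enc_binary n =
     (if n = 0 then Leaf else Node (enc_unary (n mod 2)) (enc_binary (n div 2)))"

declare enc_binary.simps [simp del]

definition enc_weight :: "rat \<Rightarrow> tree" where
  "enc_weight w = (case quotient_of w of (a, b) \<Rightarrow> Node (enc_binary (nat a)) (enc_binary (nat b)))"

definition enc_constraint :: "wconstraint \<Rightarrow> tree" where
  "enc_constraint c =
     Node (enc_weight (weight c))
       (Node (enc_unary (pred_idx c)) (enc_list (map enc_unary (scope c))))"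

definition enc_inst :: "csp_inst \<Rightarrow> tree" where
  "enc_inst F = Node (enc_unary (nvars F)) (enc_list (map enc_constraint (constraints F)))"

definition enc_assignment :: "nat list \<Rightarrow> tree" where
  "enc_assignment \<chi> = enc_list (map enc_unary \<chi>)"

lemma enc_list_inject [simp]: "enc_list xs = enc_list ys \<longleftrightarrow> xs = ys"
proof (induction xs arbitrary: ys)
  case Nil
  then show ?case by (cases ys) auto
next
  case (Cons x xs)
  then show ?case by (cases ys) auto
qed

lemma enc_unary_inject [simp]: "enc_unary m = enc_unary n \<longleftrightarrow> m = n"
  unfolding enc_unary_def by (metis enc_list_inject length_replicate)

lemma enc_binary_inject [simp]: "enc_binary m = enc_binary n \<longleftrightarrow> m = n"
proof (induction m arbitrary: n rule: less_induct)
  case (less m)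
  show ?case
  proof (cases "m = 0 \<or> n = 0")
    case True
    then show ?thesis by (auto simp: enc_binary.simps[of m] enc_binary.simps[of n])
  next
    case False
    then have "enc_binary m = enc_binary n \<longleftrightarrow> m mod 2 = n mod 2 \<and> m div 2 = n div 2"
      using less.IH[of "m div 2" "n div 2"]
      by (subst (1 2) enc_binary.simps) auto
    then show ?thesis by (metis div_mult_mod_eq)
  qed
qed

lemma enc_weight_inject:
  assumes "v \<ge> 0" "w \<ge> 0" "enc_weight v = enc_weight w"
  shows "v = w"
proof -
  obtain a b c d where q: "quotient_of v = (a, b)" "quotient_of w = (c, d)"
    by (metis surj_pair)
  have pos: "b > 0" "d > 0" using q quotient_of_denom_pos by blast+
  have vw: "v = of_int a / of_int b" "w = of_int c / of_int d"
    using q quotient_of_div by blast+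
  have "a \<ge> 0" "c \<ge> 0"
    using assms(1,2) vw pos by (auto simp: zero_le_divide_iff)
  moreover have "nat a = nat c" "nat b = nat d"
    using assms(3) q by (auto simp: enc_weight_def)
  ultimately show ?thesis using vw pos by (simp add: eq_nat_nat_iff)
qed

lemma enc_inst_inject:
  assumes "F \<in> weighted_instances \<Lambda>" "G \<in> weighted_instances \<Lambda>" "enc_inst F = enc_inst G"
  shows "F = G"
proof -
  have inj: "inj_on enc_constraint {c. weight c \<ge> 0}"
  proof (rule inj_onI)
    fix c d
    assume cd: "c \<in> {c. weight c \<ge> 0}" "d \<in> {c. weight c \<ge> 0}"
      "enc_constraint c = enc_constraint d"
    then have "enc_weight (weight c) = enc_weight (weight d)" "pred_idx c = pred_idx d"
      and sc: "map enc_unary (scope c) = map enc_unary (scope d)"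
      by (simp_all add: enc_constraint_def)
    moreover have "scope c = scope d"
      using sc by (rule map_injective) (simp add: inj_def)
    ultimately show "c = d"
      using cd enc_weight_inject by (simp add: wconstraint.expand)
  qed
  have "map enc_constraint (constraints F) = map enc_constraint (constraints G)"
    and n: "nvars F = nvars G"
    using assms(3) by (auto simp: enc_inst_def)
  moreover have "set (constraints F) \<union> set (constraints G) \<subseteq> {c. weight c \<ge> 0}"
    using assms(1,2) by (auto simp: weighted_instances_def)
  ultimately have "constraints F = constraints G"
    using inj by (metis inj_on_map_eq_map inj_on_subset)
  with n show ?thesis by (simp add: csp_inst.expand)
qed


section \<open>Approximation algorithms for Min-CSP\<close>

definition approx_algorithm :: "csp \<Rightarrow> nat \<Rightarrow> csp_inst set \<Rightarrow> real \<Rightarrow> program \<Rightarrow> bool" where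
  "approx_algorithm \<Lambda> q K \<alpha> p \<longleftrightarrow>
     (\<exists>b :: nat poly. \<forall>F \<in> K. \<exists>\<chi> t.
        runs p (enc_inst F) (enc_assignment \<chi>) t \<and>
        t \<le> poly b (size (enc_inst F)) \<and>
        \<chi> \<in> assignments q F \<and>
        real_of_rat (Val \<Lambda> F \<chi>) \<le> \<alpha> * real_of_rat (Opt \<Lambda> q F))"

end

theory Submission
  imports Defs "HOL-Library.More_List"
begin

text \<open>
  From weights to multiplicities: for every exponent \<open>j\<close>, replace a constraint of weight
  \<open>w > 0\<close> by \<open>min C (1 + \<lfloor>w * 2^j\<rfloor>)\<close> copies, where \<open>C = \<gamma> * m\<close> and \<open>m\<close> is the number of
  constraints, and accept the resulting assignment if it satisfies no constraint whose
  multiplicity was capped. The value of an accepted assignment is at most \<open>2^-j\<close> times the number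
  of satisfied copies, so it is within the desired ratio as soon as \<open>m * 2^-j \<le> \<epsilon> * Opt\<close>. For
  the least such \<open>j\<close> an approximate solution satisfies only \<open>O(m)\<close> copies, fewer than \<open>C\<close>, and is
  accepted. Hence the accepted assignment with the largest \<open>j\<close> is good; no two weighted values
  ever need to be compared, and all arithmetic except one division per constraint is unary.

  From multiplicities to regularity: a variable \<open>i\<close> of degree \<open>d\<close> gets \<open>d\<close> clones, every clause is
  repeated for all tuples in \<open>[B]^K\<close>, and at coordinate value \<open>t\<close> the \<open>k\<close>-th occurrence of \<open>i\<close> uses
  clone \<open>(k + t) mod d\<close>. For fixed \<open>t\<close> the occurrences hit every clone exactly once, so the new
  instance is regular; for fixed \<open>k\<close> the clone is almost uniform if \<open>B\<close> is much larger than \<open>d\<close>.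
  An assignment of the clones is therefore, up to a factor \<open>(1 + 1/R)^K\<close>, a product distribution
  on assignments of the original variables, which conditional expectations turn into a single
  assignment.
\<close>

section \<open>Combining programs\<close>

text \<open>In a minimisation problem the optimum may be exponentially smaller than the largest
  weight, so no single rounding of the weights to polynomially many copies preserves ratios: a fine
  scale makes heavy constraints too numerous, a coarse one drowns \<open>Opt\<close> in rounding
  errors. Capping heavy constraints is harmless for an assignment that satisfies none of them, and
  this can be tested. Optimum 0 allows no error at all; therefore constraints of weight 0 get no
  copy.

  The arity bound \<open>K\<close> is a constant of the CSP, so \<open>B ^ K\<close> copies of a
  clause remain polynomial. A single coordinate shared by all variables of a clause would also give
  regularity, but it would correlate the variables; separate coordinates give the product
  distribution that conditional expectations need.

  The losses multiply: \<open>\<alpha>\<close> from the given algorithm,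
  \<open>(1 + 1 / R) ^ K\<close> from cloning, and \<open>1 + \<epsilon>\<close> from rounding the
  weights. The constants \<open>R\<close> and \<open>\<epsilon>\<close> depend only on
  \<open>\<alpha>\<close>, \<open>\<delta>\<close> and \<open>K\<close>.\<close>

fun shift :: "nat \<Rightarrow> expr \<Rightarrow> expr" where
  "shift k (Var i) = Var i"
| "shift k LeafE = LeafE"
| "shift k (NodeE a b) = NodeE (shift k a) (shift k b)"
| "shift k (LeftE a) = LeftE (shift k a)"
| "shift k (RightE a) = RightE (shift k a)"
| "shift k (IfLeaf a b c) = IfLeaf (shift k a) (shift k b) (shift k c)"
| "shift k (Call f es) = Call (k + f) (map (shift k) es)"

text \<open>Calls are resolved by position in the table. Placing \<open>gs\<close> in front moves
  every entry by \<open>length gs\<close>, which is exactly what \<open>shift\<close> adds to each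
  call.\<close>

lemma eval_shift:
  "eval fs env e v t \<Longrightarrow> eval (gs @ map (shift (length gs)) fs) env (shift (length gs) e) v t"
  "evals fs env es vs t \<Longrightarrow>
     evals (gs @ map (shift (length gs)) fs) env (map (shift (length gs)) es) vs t"
proof (induction rule: eval_evals.inducts)
  case (eval_Call f env es vs t1 v t2)
  then show ?case
    using eval_evals.eval_Call[of "length gs + f" "gs @ map (shift (length gs)) fs"]
    by (simp add: nth_append)
qed (unfold shift.simps list.map, (rule eval_evals.intros; assumption)+)

lemma eval_append:
  "eval fs env e v t \<Longrightarrow> eval (fs @ gs) env e v t"
  "evals fs env es vs t \<Longrightarrow> evals (fs @ gs) env es vs t"
proof (induction rule: eval_evals.inducts)
  case (eval_Call f env es vs t1 v t2)
  then show ?case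
    using eval_evals.eval_Call[of f "fs @ gs"] by (simp add: nth_append)
qed (rule eval_evals.intros; assumption)+

text \<open>Values and times survive unchanged over the common table, so the cost of a combined
  program is the sum of the costs of its parts plus a few nodes.\<close>

lemma merge_programs:
  obtains fs e1' e2' where
    "\<And>env v t. eval fs1 env e1 v t \<Longrightarrow> eval fs env e1' v t"
    "\<And>env v t. eval fs2 env e2 v t \<Longrightarrow> eval fs env e2' v t"
proof
  show "eval fs1 env e1 v t \<Longrightarrow> eval (fs1 @ map (shift (length fs1)) fs2) env e1 v t" for env v t
    by (rule eval_append)
  show "eval fs2 env e2 v t \<Longrightarrow>
      eval (fs1 @ map (shift (length fs1)) fs2) env (shift (length fs1) e2) v t" for env v t
    by (rule eval_shift)
qed

lemma evals1: "eval fs env e v t \<Longrightarrow> evals fs env [e] [v] t"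
  using evals_Cons[OF _ evals_Nil] by simp

text \<open>Coefficients in \<open>nat\<close> make every polynomial monotone, so a bound on a size
  may be substituted into a time bound.\<close>

lemma poly_nat_mono: "x \<le> y \<Longrightarrow> poly b x \<le> poly (b :: nat poly) y"
  by (induction b) (auto intro!: add_mono mult_mono)

section \<open>Polynomial-time functions\<close>

text \<open>\<open>D\<close> acts as a promise: nothing is claimed about inputs outside of it. This
  matters for the given algorithm, which may fail to halt outside the class of unweighted regular
  instances.\<close>

definition poly_bounded :: "'a set \<Rightarrow> ('a \<Rightarrow> tree) \<Rightarrow> ('a \<Rightarrow> nat) \<Rightarrow> bool" where
  "poly_bounded D E g \<longleftrightarrow> (\<exists>b :: nat poly. \<forall>a\<in>D. g a \<le> poly b (size (E a)))"

lemma poly_bounded_mono: "poly_bounded D E h \<Longrightarrow> (\<And>a. a \<in> D \<Longrightarrow> g a \<le> h a) \<Longrightarrow> poly_bounded D E g"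
  unfolding poly_bounded_def by (meson order_trans)

lemma poly_bounded_const: "poly_bounded D E (\<lambda>a. c)"
  unfolding poly_bounded_def by (rule exI[of _ "[:c:]"]) simp

lemma poly_bounded_add: "poly_bounded D E f \<Longrightarrow> poly_bounded D E g \<Longrightarrow> poly_bounded D E (\<lambda>a. f a + g a)"
  unfolding poly_bounded_def
proof (elim exE)
  fix b c :: "nat poly"
  assume "\<forall>a\<in>D. f a \<le> poly b (size (E a))" "\<forall>a\<in>D. g a \<le> poly c (size (E a))"
  then show "\<exists>b :: nat poly. \<forall>a\<in>D. f a + g a \<le> poly b (size (E a))"
    by (intro exI[of _ "b + c"]) (auto intro!: add_mono)
qed

lemma poly_bounded_mult: "poly_bounded D E f \<Longrightarrow> poly_bounded D E g \<Longrightarrow> poly_bounded D E (\<lambda>a. f a * g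
    a)"
  unfolding poly_bounded_def
proof (elim exE)
  fix b c :: "nat poly"
  assume "\<forall>a\<in>D. f a \<le> poly b (size (E a))" "\<forall>a\<in>D. g a \<le> poly c (size (E a))"
  then show "\<exists>b :: nat poly. \<forall>a\<in>D. f a * g a \<le> poly b (size (E a))"
    by (intro exI[of _ "b * c"]) (auto intro!: mult_mono)
qed

lemma poly_bounded_Suc: "poly_bounded D E f \<Longrightarrow> poly_bounded D E (\<lambda>a. Suc (f a))"
  using poly_bounded_add[OF _ poly_bounded_const[of D E 1], of f] by simp

lemma poly_bounded_size: "poly_bounded D E (\<lambda>a. size (E a))"
  unfolding poly_bounded_def by (rule exI[of _ "[:0, 1:]"]) simp

lemma poly_bounded_poly: "poly_bounded D E f \<Longrightarrow> poly_bounded D E (\<lambda>a. poly b (f a))"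
  unfolding poly_bounded_def
proof (elim exE)
  fix c :: "nat poly"
  assume "\<forall>a\<in>D. f a \<le> poly c (size (E a))"
  then show "\<exists>c :: nat poly. \<forall>a\<in>D. poly b (f a) \<le> poly c (size (E a))"
    by (intro exI[of _ "pcompose b c"]) (auto simp: poly_pcompose intro!: poly_nat_mono)
qed

text \<open>The cost \<open>h\<close> is polynomial in the size of the intermediate value, which
  must itself be polynomial in the size of the input; polynomials are closed under
  composition.\<close>

lemma poly_bounded_comp:
  assumes "poly_bounded D' E' h" "\<And>a. a \<in> D \<Longrightarrow> m a \<in> D'" "poly_bounded D E (\<lambda>a. size (E' (m a)))"
  shows "poly_bounded D E (\<lambda>a. h (m a))"
proof -
  obtain b where b: "\<And>a. a \<in> D' \<Longrightarrow> h a \<le> poly b (size (E' a))"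
    using assms(1) unfolding poly_bounded_def by blast
  show ?thesis
    by (rule poly_bounded_mono[OF poly_bounded_poly[OF assms(3), of b]]) (use b assms(2) in auto)
qed

text \<open>
  The size of the output is bounded separately: subtrees are shared, so a program can build a
  tree of size exponential in its running time.
\<close>

definition polytime_on :: "'a set \<Rightarrow> ('a \<Rightarrow> tree) \<Rightarrow> ('b \<Rightarrow> tree) \<Rightarrow> ('a \<Rightarrow> 'b) \<Rightarrow> bool" where
  "polytime_on D E e f \<longleftrightarrow>
     (\<exists>fs ex h. poly_bounded D E h \<and> (\<forall>a\<in>D. \<exists>t\<le>h a. eval fs [E a] ex (e (f a)) t)) \<and>
     poly_bounded D E (\<lambda>a. size (e (f a)))"

lemma polytimeI:
  assumes "poly_bounded D E h" "poly_bounded D E (\<lambda>a. size (e (f a)))"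
    "\<And>a. a \<in> D \<Longrightarrow> \<exists>t\<le>h a. eval fs [E a] ex (e (f a)) t"
  shows "polytime_on D E e f"
  using assms unfolding polytime_on_def by blast

lemma polytimeE:
  assumes "polytime_on D E e f"
  obtains fs ex h where "poly_bounded D E h" "poly_bounded D E (\<lambda>a. size (e (f a)))"
    "\<And>a. a \<in> D \<Longrightarrow> \<exists>t\<le>h a. eval fs [E a] ex (e (f a)) t"
  using assms unfolding polytime_on_def by blast

lemma polytime_imp_poly_bounded: "polytime_on D E e f \<Longrightarrow> poly_bounded D E (\<lambda>a. size (e (f a)))"
  unfolding polytime_on_def by blast

text \<open>Only encoded results are compared, so a program may be reread as computing a value of
  another type, for example a number instead of a list of units.\<close>

lemma polytime_cong:
  assumes "polytime_on D E e f" "\<And>a. a \<in> D \<Longrightarrow> e (f a) = e' (g a)"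
  shows "polytime_on D E e' g"
  using assms(1)
proof (rule polytimeE)
  fix fs ex h
  assume *: "poly_bounded D E h" "poly_bounded D E (\<lambda>a. size (e (f a)))"
    "\<And>a. a \<in> D \<Longrightarrow> \<exists>t\<le>h a. eval fs [E a] ex (e (f a)) t"
  show ?thesis
  proof (rule polytimeI[OF *(1)])
    show "poly_bounded D E (\<lambda>a. size (e' (g a)))"
      by (rule poly_bounded_mono[OF *(2)]) (use assms(2) in auto)
    show "a \<in> D \<Longrightarrow> \<exists>t\<le>h a. eval fs [E a] ex (e' (g a)) t" for a
      using *(3) assms(2) by metis
  qed
qed

lemma polytime_id: "polytime_on D E E (\<lambda>a. a)"
proof (rule polytimeI[OF poly_bounded_const poly_bounded_size])
  show "\<exists>t\<le>1. eval [] [E a] (Var 0) (E a) t" for a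
    using eval_Var[of 0 "[E a]"] by auto
qed

lemma polytime_comp:
  assumes "polytime_on D E e f" "polytime_on D' e e' g" "\<And>a. a \<in> D \<Longrightarrow> f a \<in> D'"
  shows "polytime_on D E e' (\<lambda>a. g (f a))"
proof -
  obtain fs1 ex1 h1 where 1: "poly_bounded D E h1" "poly_bounded D E (\<lambda>a. size (e (f a)))"
    "\<And>a. a \<in> D \<Longrightarrow> \<exists>t\<le>h1 a. eval fs1 [E a] ex1 (e (f a)) t"
    by (rule polytimeE[OF assms(1)]) (rule that)
  obtain fs2 ex2 h2 where 2: "poly_bounded D' e h2" "poly_bounded D' e (\<lambda>a. size (e' (g a)))"
    "\<And>a. a \<in> D' \<Longrightarrow> \<exists>t\<le>h2 a. eval fs2 [e a] ex2 (e' (g a)) t"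
    by (rule polytimeE[OF assms(2)]) (rule that)
  obtain fs e1 e2 where m: "\<And>env v t. eval fs1 env ex1 v t \<Longrightarrow> eval fs env e1 v t"
    "\<And>env v t. eval fs2 env ex2 v t \<Longrightarrow> eval fs env e2 v t"
    by (rule merge_programs[of fs1 ex1 fs2 ex2]) (rule that)
  show ?thesis
  \<comment> \<open>The second program becomes a function body: the call rebinds its
    \<open>Var 0\<close> to the intermediate value, which is computed once.\<close>
  proof (rule polytimeI[where fs = "fs @ [e2]" and ex = "Call (length fs) [e1]"])
    show "poly_bounded D E (\<lambda>a. h1 a + h2 (f a) + 1)"
      by (intro poly_bounded_add poly_bounded_const 1 poly_bounded_comp[OF 2(1) assms(3) 1(2)])
    show "poly_bounded D E (\<lambda>a. size (e' (g (f a))))"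
      by (intro poly_bounded_comp[OF 2(2) assms(3) 1(2)])
    fix a assume a: "a \<in> D"
    obtain t1 t2 where t: "t1 \<le> h1 a" "eval fs1 [E a] ex1 (e (f a)) t1"
      "t2 \<le> h2 (f a)" "eval fs2 [e (f a)] ex2 (e' (g (f a))) t2"
      using 1(3)[OF a] 2(3)[OF assms(3)[OF a]] by blast
    have "eval (fs @ [e2]) [E a] (Call (length fs) [e1]) (e' (g (f a))) (t1 + t2 + 1)"
      by (rule eval_Call[OF _ evals1[OF eval_append(1)[OF m(1)[OF t(2)]]]])
        (use eval_append(1)[OF m(2)[OF t(4)]] in auto)
    then show "\<exists>t\<le>h1 a + h2 (f a) + 1. eval (fs @ [e2]) [E a] (Call (length fs) [e1]) (e' (g (f
        a))) t"
      using t by (intro exI[of _ "t1 + t2 + 1"]) auto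
  qed
qed

section \<open>Encodings of pairs, lists and truth values\<close>

definition enc_pair :: "('a \<Rightarrow> tree) \<Rightarrow> ('b \<Rightarrow> tree) \<Rightarrow> 'a \<times> 'b \<Rightarrow> tree" where
  "enc_pair A B p = Node (A (fst p)) (B (snd p))"

definition enc_list_of :: "('a \<Rightarrow> tree) \<Rightarrow> 'a list \<Rightarrow> tree" where
  "enc_list_of e xs = enc_list (map e xs)"

definition enc_bool :: "bool \<Rightarrow> tree" where
  "enc_bool b = enc_unary (of_bool b)"

lemma enc_pair_simp [simp]: "enc_pair A B (x, y) = Node (A x) (B y)"
  by (simp add: enc_pair_def)

lemma enc_list_of_simps [simp]: "enc_list_of e [] = Leaf" "enc_list_of e (x # xs) =
    Node (e x) (enc_list_of e xs)"
  by (simp_all add: enc_list_of_def)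

lemma enc_unary_simps [simp]: "enc_unary 0 = Leaf" "enc_unary (Suc n) = Node Leaf (enc_unary n)"
  by (simp_all add: enc_unary_def)

lemma enc_bool_simps [simp]: "enc_bool False = Leaf" "enc_bool True = Node Leaf Leaf"
  by (simp_all add: enc_bool_def)

lemma size_enc_unary [simp]: "size (enc_unary n) = n"
  by (induction n) auto

lemma size_enc_list_of_elem: "x \<in> set xs \<Longrightarrow> size (e x) \<le> size (enc_list_of e xs)"
  by (induction xs) auto

lemma length_le_size_enc_list_of: "length xs \<le> size (enc_list_of e xs)"
  by (induction xs) auto

lemma size_enc_list_of_le: "(\<And>x. x \<in> set xs \<Longrightarrow> size (e x) \<le> c) \<Longrightarrow> size (enc_list_of e xs) \<le>
    length xs * Suc c"
proof (induction xs)
  case (Cons x xs)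
  have "size (e x) \<le> c" "size (enc_list_of e xs) \<le> length xs * Suc c"
    using Cons by auto
  then show ?case by simp
qed simp

section \<open>Closure under tree operations, case distinction and list recursion\<close>

lemma polytime_Leaf: "(\<And>a. a \<in> D \<Longrightarrow> e (f a) = Leaf) \<Longrightarrow> polytime_on D E e f"
  by (rule polytimeI[where h = "\<lambda>_. 1" and ex = "LeafE" and fs = "[]"])
    (auto intro!: exI[of _ 1] eval_Leaf poly_bounded_const intro: poly_bounded_mono[OF
        poly_bounded_const[of _ _ 0]])

lemma polytime_Node:
  assumes "polytime_on D E A f" "polytime_on D E B g" "\<And>a. a \<in> D \<Longrightarrow> e (h a) =
      Node (A (f a)) (B (g a))"
  shows "polytime_on D E e h"
proof -
  obtain fs1 ex1 h1 where 1: "poly_bounded D E h1" "poly_bounded D E (\<lambda>a. size (A (f a)))"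
    "\<And>a. a \<in> D \<Longrightarrow> \<exists>t\<le>h1 a. eval fs1 [E a] ex1 (A (f a)) t"
    by (rule polytimeE[OF assms(1)]) (rule that)
  obtain fs2 ex2 h2 where 2: "poly_bounded D E h2" "poly_bounded D E (\<lambda>a. size (B (g a)))"
    "\<And>a. a \<in> D \<Longrightarrow> \<exists>t\<le>h2 a. eval fs2 [E a] ex2 (B (g a)) t"
    by (rule polytimeE[OF assms(2)]) (rule that)
  obtain fs e1 e2 where m: "\<And>env v t. eval fs1 env ex1 v t \<Longrightarrow> eval fs env e1 v t"
    "\<And>env v t. eval fs2 env ex2 v t \<Longrightarrow> eval fs env e2 v t"
    by (rule merge_programs[of fs1 ex1 fs2 ex2]) (rule that)
  show ?thesis
  proof (rule polytimeI[where fs = fs and ex = "NodeE e1 e2"])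
    show "poly_bounded D E (\<lambda>a. h1 a + h2 a + 1)"
      by (intro poly_bounded_add poly_bounded_const 1 2)
    show "poly_bounded D E (\<lambda>a. size (e (h a)))"
      by (rule poly_bounded_mono[OF poly_bounded_Suc[OF poly_bounded_add[OF 1(2) 2(2)]]]) (simp
          add: assms(3))
    fix a assume a: "a \<in> D"
    obtain t1 t2 where t: "t1 \<le> h1 a" "eval fs1 [E a] ex1 (A (f a)) t1"
      "t2 \<le> h2 a" "eval fs2 [E a] ex2 (B (g a)) t2"
      using 1(3)[OF a] 2(3)[OF a] by blast
    have "eval fs [E a] (NodeE e1 e2) (e (h a)) (t1 + t2 + 1)"
      unfolding assms(3)[OF a] using t m by (intro eval_Node) auto
    then show "\<exists>t\<le>h1 a + h2 a + 1. eval fs [E a] (NodeE e1 e2) (e (h a)) t"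
      using t by (intro exI[of _ "t1 + t2 + 1"]) auto
  qed
qed

lemma size_left_right: "size (left t) \<le> size t" "size (right t) \<le> size t"
  by (cases t; simp)+

lemma polytime_left:
  assumes "polytime_on D E A f" "\<And>a. a \<in> D \<Longrightarrow> e (g a) = left (A (f a))"
  shows "polytime_on D E e g"
proof -
  obtain fs ex h where 1: "poly_bounded D E h" "poly_bounded D E (\<lambda>a. size (A (f a)))"
    "\<And>a. a \<in> D \<Longrightarrow> \<exists>t\<le>h a. eval fs [E a] ex (A (f a)) t"
    by (rule polytimeE[OF assms(1)]) (rule that)
  show ?thesis
  proof (rule polytimeI[where fs = fs and ex = "LeftE ex"])
    show "poly_bounded D E (\<lambda>a. h a + 1)"
      by (intro poly_bounded_add poly_bounded_const 1)
    show "poly_bounded D E (\<lambda>a. size (e (g a)))"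
      by (rule poly_bounded_mono[OF 1(2)]) (simp add: assms(2) size_left_right)
    show "\<exists>t\<le>h a + 1. eval fs [E a] (LeftE ex) (e (g a)) t" if a: "a \<in> D" for a
      using 1(3)[OF a] eval_Left unfolding assms(2)[OF a] by (meson add_le_mono1)
  qed
qed

lemma polytime_right:
  assumes "polytime_on D E A f" "\<And>a. a \<in> D \<Longrightarrow> e (g a) = right (A (f a))"
  shows "polytime_on D E e g"
proof -
  obtain fs ex h where 1: "poly_bounded D E h" "poly_bounded D E (\<lambda>a. size (A (f a)))"
    "\<And>a. a \<in> D \<Longrightarrow> \<exists>t\<le>h a. eval fs [E a] ex (A (f a)) t"
    by (rule polytimeE[OF assms(1)]) (rule that)
  show ?thesis
  proof (rule polytimeI[where fs = fs and ex = "RightE ex"])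
    show "poly_bounded D E (\<lambda>a. h a + 1)"
      by (intro poly_bounded_add poly_bounded_const 1)
    show "poly_bounded D E (\<lambda>a. size (e (g a)))"
      by (rule poly_bounded_mono[OF 1(2)]) (simp add: assms(2) size_left_right)
    show "\<exists>t\<le>h a + 1. eval fs [E a] (RightE ex) (e (g a)) t" if a: "a \<in> D" for a
      using 1(3)[OF a] eval_Right unfolding assms(2)[OF a] by (meson add_le_mono1)
  qed
qed

lemma polytime_IfLeaf:
  assumes "polytime_on D E A c" "polytime_on D E e f" "polytime_on D E e g"
    "\<And>a. a \<in> D \<Longrightarrow> h a = (if A (c a) = Leaf then f a else g a)"
  shows "polytime_on D E e h"
proof -
  obtain fs0 ex0 h0 where 0: "poly_bounded D E h0" "poly_bounded D E (\<lambda>a. size (A (c a)))"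
    "\<And>a. a \<in> D \<Longrightarrow> \<exists>t\<le>h0 a. eval fs0 [E a] ex0 (A (c a)) t"
    by (rule polytimeE[OF assms(1)]) (rule that)
  obtain fs1 ex1 h1 where 1: "poly_bounded D E h1" "poly_bounded D E (\<lambda>a. size (e (f a)))"
    "\<And>a. a \<in> D \<Longrightarrow> \<exists>t\<le>h1 a. eval fs1 [E a] ex1 (e (f a)) t"
    by (rule polytimeE[OF assms(2)]) (rule that)
  obtain fs2 ex2 h2 where 2: "poly_bounded D E h2" "poly_bounded D E (\<lambda>a. size (e (g a)))"
    "\<And>a. a \<in> D \<Longrightarrow> \<exists>t\<le>h2 a. eval fs2 [E a] ex2 (e (g a)) t"
    by (rule polytimeE[OF assms(3)]) (rule that)
  obtain fs3 e1 e2 where m: "\<And>env v t. eval fs1 env ex1 v t \<Longrightarrow> eval fs3 env e1 v t"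
    "\<And>env v t. eval fs2 env ex2 v t \<Longrightarrow> eval fs3 env e2 v t"
    by (rule merge_programs[of fs1 ex1 fs2 ex2]) (rule that)
  define fs where "fs = fs0 @ map (shift (length fs0)) fs3"
  define ex where "ex = IfLeaf ex0 (shift (length fs0) e1) (shift (length fs0) e2)"
  show ?thesis
  proof (rule polytimeI[where fs = fs and ex = ex])
    show "poly_bounded D E (\<lambda>a. h0 a + (h1 a + h2 a) + 1)"
      by (intro poly_bounded_add poly_bounded_const 0 1 2)
    show "poly_bounded D E (\<lambda>a. size (e (h a)))"
      by (rule poly_bounded_mono[OF poly_bounded_add[OF 1(2) 2(2)]]) (simp add: assms(4))
    fix a assume a: "a \<in> D"
    obtain t0 t1 t2 where t: "t1 \<le> h1 a" "eval fs1 [E a] ex1 (e (f a)) t1"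
      "t2 \<le> h2 a" "eval fs2 [E a] ex2 (e (g a)) t2" "t0 \<le> h0 a" "eval fs0 [E a] ex0 (A (c a)) t0"
      using 0(3)[OF a] 1(3)[OF a] 2(3)[OF a] by blast
    show "\<exists>t\<le>h0 a + (h1 a + h2 a) + 1. eval fs [E a] ex (e (h a)) t"
    proof (cases "A (c a)")
      case Leaf
      have "eval fs [E a] ex (e (f a)) (t0 + t1 + 1)"
        unfolding ex_def fs_def using t m Leaf by (intro eval_If_Leaf eval_append(1)
            eval_shift(1)) auto
      then show ?thesis
        using t Leaf assms(4)[OF a] by (intro exI[of _ "t0 + t1 + 1"]) auto
    next
      case (Node u w)
      have "eval fs [E a] ex (e (g a)) (t0 + t2 + 1)"
        unfolding ex_def fs_def using t m Node
        by (intro eval_If_Node[of _ _ _ u w] eval_append(1) eval_shift(1)) auto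
      then show ?thesis
        using t Node assms(4)[OF a] by (intro exI[of _ "t0 + t2 + 1"]) auto
    qed
  qed
qed

text \<open>All loops derive from this scheme. A polynomial step alone would not do, because the
  state could grow exponentially over the rounds; hence \<open>bnd\<close> for the state after every
  suffix of the list. The set \<open>D'\<close> lets the step rely on invariants of the states that
  do occur.\<close>

lemma polytime_foldr:
  assumes xs: "polytime_on D E (enc_list_of ex) xs" and z: "polytime_on D E es z"
    and f: "polytime_on D' (enc_pair E (enc_pair ex es)) es (\<lambda>p. f (fst p) (fst (snd p)) (snd (snd
        p)))"
    and dom: "\<And>a ps x us. a \<in> D \<Longrightarrow> xs a = ps @ x # us \<Longrightarrow> (a, x, foldr (f a) us (z a)) \<in> D'"
    and bnd: "poly_bounded D E bnd"
      "\<And>a ps us. a \<in> D \<Longrightarrow> xs a = ps @ us \<Longrightarrow> size (es (foldr (f a) us (z a))) \<le> bnd a"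
  shows "polytime_on D E es (\<lambda>a. foldr (f a) (xs a) (z a))"
proof -
  obtain fs1 ex1 h1 where 1: "poly_bounded D E h1" "poly_bounded D E (\<lambda>a. size (enc_list_of ex (xs
      a)))"
    "\<And>a. a \<in> D \<Longrightarrow> \<exists>t\<le>h1 a. eval fs1 [E a] ex1 (enc_list_of ex (xs a)) t"
    by (rule polytimeE[OF xs]) (rule that)
  obtain fs2 ex2 h2 where 2: "poly_bounded D E h2" "poly_bounded D E (\<lambda>a. size (es (z a)))"
    "\<And>a. a \<in> D \<Longrightarrow> \<exists>t\<le>h2 a. eval fs2 [E a] ex2 (es (z a)) t"
    by (rule polytimeE[OF z]) (rule that)
  obtain fs3 ex3 h3 where
    3: "poly_bounded D' (enc_pair E (enc_pair ex es)) h3"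
    "\<And>a x s. (a, x, s) \<in> D' \<Longrightarrow>
       \<exists>t\<le>h3 (a, x, s). eval fs3 [Node (E a) (Node (ex x) (es s))] ex3 (es (f a x s)) t"
    by (rule polytimeE[OF f]) force
  obtain b where b: "\<And>a x s. (a, x, s) \<in> D' \<Longrightarrow>
       h3 (a, x, s) \<le> poly b (size (E a) + size (ex x) + size (es s) + 2)"
    using 3(1) unfolding poly_bounded_def by (force simp: add.assoc)
  obtain fs12 e1' e2' where m12: "\<And>env v t. eval fs1 env ex1 v t \<Longrightarrow> eval fs12 env e1' v t"
    "\<And>env v t. eval fs2 env ex2 v t \<Longrightarrow> eval fs12 env e2' v t"
    by (rule merge_programs[of fs1 ex1 fs2 ex2]) (rule that)
  define gs where "gs = fs3 @ map (shift (length fs3)) fs12"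
  define k where "k = length gs"
  \<comment> \<open>Entry \<open>k\<close> of the table is the loop itself, called with input,
    remaining list and start value; entry \<open>Suc k\<close> is the step, called with a single
    nested pair.\<close>
  define body where "body = IfLeaf (Var 1) (Var 2)
     (Call (Suc k) [NodeE (Var 0) (NodeE (LeftE (Var 1)) (Call k [Var 0, RightE (Var 1), Var 2]))])"
  define fs where "fs = gs @ [body, ex3]"
  define e1 where "e1 = shift (length fs3) e1'"
  define e2 where "e2 = shift (length fs3) e2'"
  have m1: "eval fs env e1 v t" if "eval fs1 env ex1 v t" for env v t
    unfolding fs_def e1_def gs_def using that by (intro eval_append(1) eval_shift(1) m12)
  have m2: "eval fs env e2 v t" if "eval fs2 env ex2 v t" for env v t
    unfolding fs_def e2_def gs_def using that by (intro eval_append(1) eval_shift(1) m12)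
  have m3: "eval fs env ex3 v t" if "eval fs3 env ex3 v t" for env v t
    unfolding fs_def gs_def append_assoc using that by (intro eval_append(1))
  have k: "k < length fs" "Suc k < length fs" "fs ! k = body" "fs ! Suc k = ex3"
    by (simp_all add: fs_def k_def nth_append)
  define Q where "Q a = poly b (size (E a) + size (enc_list_of ex (xs a)) + bnd a + 2)" for a
  \<comment> \<open>\<open>Q a\<close> pays for one step on any state that occurs, 20 covers the 13
    further nodes of a round, and 3 is the cost of the test on the empty list.\<close>
  have loop: "\<exists>t\<le>length ys * (Q a + 20) + 3.
         eval fs [E a, enc_list_of ex ys, es (z a)] body (es (foldr (f a) ys (z a))) t"
    if a: "a \<in> D" and "xs a = ps @ ys" for a ps ys
    using that(2)
  proof (induction ys arbitrary: ps)
    case Nil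
    have "eval fs [E a, Leaf, es (z a)] body (es (z a)) (1 + 1 + 1)"
      unfolding body_def using eval_Var[of 1 "[E a, Leaf, es (z a)]" fs]
        eval_Var[of 2 "[E a, Leaf, es (z a)]" fs]
      by (intro eval_If_Leaf) auto
    then show ?case by (auto intro!: exI[of _ 3] simp: numeral_3_eq_3)
  next
    case (Cons y ys)
    define s where "s = foldr (f a) ys (z a)"
    let ?env = "[E a, Node (ex y) (enc_list_of ex ys), es (z a)]"
    obtain t where t: "t \<le> length ys * (Q a + 20) + 3"
      "eval fs [E a, enc_list_of ex ys, es (z a)] body (es s) t"
      using Cons.IH[of "ps @ [y]"] Cons.prems by (auto simp: s_def)
    have y: "y \<in> set (xs a)" using Cons.prems by simp
    have D': "(a, y, s) \<in> D'" using dom[OF a Cons.prems] by (simp add: s_def)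
    have bs: "size (es s) \<le> bnd a"
      using bnd(2)[OF a, of "ps @ [y]" ys] Cons.prems by (simp add: s_def)
    obtain t3 where t3: "t3 \<le> h3 (a, y, s)"
      "eval fs3 [Node (E a) (Node (ex y) (es s))] ex3 (es (f a y s)) t3"
      using 3(2)[OF D'] by blast
    have v: "eval fs ?env (Var 0) (E a) 1" "eval fs ?env (Var 1) (Node (ex y) (enc_list_of ex ys))
        1"
      "eval fs ?env (Var 2) (es (z a)) 1"
      using eval_Var[of 0 ?env fs] eval_Var[of 1 ?env fs] eval_Var[of 2 ?env fs] by auto
    have l: "eval fs ?env (LeftE (Var 1)) (ex y) (1 + 1)"
      "eval fs ?env (RightE (Var 1)) (enc_list_of ex ys) (1 + 1)"
      using eval_Left[OF v(2)] eval_Right[OF v(2)] by simp_all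
    have c: "eval fs ?env (Call k [Var 0, RightE (Var 1), Var 2]) (es s) (1 + (1 + 1 + (1 + 0)) +
        t + 1)"
      by (rule eval_Call[OF k(1) evals_Cons[OF v(1) evals_Cons[OF l(2) evals_Cons[OF v(3)
          evals_Nil]]]])
        (simp add: k t)
    have "eval fs ?env body (es (f a y s))
        (1 + ((1 + ((1 + 1) + (1 + (1 + 1 + (1 + 0)) + t + 1) + 1) + 1) + t3 + 1) + 1)"
      unfolding body_def
      by (rule eval_If_Node[OF v(2)], rule eval_Call[OF k(2)],
          rule evals1, rule eval_Node[OF v(1)], rule eval_Node[OF l(1) c])
        (simp add: k m3 t3)
    moreover have "h3 (a, y, s) \<le> Q a"
      unfolding Q_def using size_enc_list_of_elem[OF y, of ex] bs
      by (intro order_trans[OF b[OF D'] poly_nat_mono]) auto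
    ultimately show ?case
      using t(1) t3(1)
      by (intro exI[of _ "1 + ((1 + ((1 + 1) + (1 + (1 + 1 + (1 + 0)) + t + 1) + 1) + 1) + t3 + 1)
          + 1"])
        (auto simp: s_def)
  qed
  show ?thesis
  proof (rule polytimeI[where fs = fs and ex = "Call k [Var 0, e1, e2]"])
    show "poly_bounded D E (\<lambda>a. (1 + h1 a + h2 a) + (size (enc_list_of ex (xs a)) * (Q a + 20) +
        3) + 1)"
      unfolding Q_def by (intro poly_bounded_add poly_bounded_mult poly_bounded_const
          poly_bounded_poly poly_bounded_size 1 2 bnd)
    show "poly_bounded D E (\<lambda>a. size (es (foldr (f a) (xs a) (z a))))"
      by (rule poly_bounded_mono[OF bnd(1)]) (use bnd(2)[of _ "[]"] in simp)
    fix a assume a: "a \<in> D"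
    obtain t1 t2 where t: "t1 \<le> h1 a" "eval fs1 [E a] ex1 (enc_list_of ex (xs a)) t1"
      "t2 \<le> h2 a" "eval fs2 [E a] ex2 (es (z a)) t2"
      using 1(3)[OF a] 2(3)[OF a] by blast
    obtain t3 where t3: "t3 \<le> length (xs a) * (Q a + 20) + 3"
      "eval fs [E a, enc_list_of ex (xs a), es (z a)] body (es (foldr (f a) (xs a) (z a))) t3"
      using loop[OF a, of "[]" "xs a"] by auto
    have "eval fs [E a] (Call k [Var 0, e1, e2]) (es (foldr (f a) (xs a) (z a)))
       (1 + (t1 + (t2 + 0)) + t3 + 1)"
      by (rule eval_Call[OF k(1) evals_Cons[OF _
              evals_Cons[OF m1[OF t(2)] evals_Cons[OF m2[OF t(4)] evals_Nil]]]])
        (use eval_Var[of 0 "[E a]"] t3 in \<open>auto simp: k\<close>)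
    moreover have "t3 \<le> size (enc_list_of ex (xs a)) * (Q a + 20) + 3"
      using t3(1) length_le_size_enc_list_of[of "xs a" ex] by (meson add_le_mono1 mult_le_mono1
          order_trans)
    ultimately show "\<exists>t\<le>(1 + h1 a + h2 a) + (size (enc_list_of ex (xs a)) * (Q a + 20) + 3) + 1.
        eval fs [E a] (Call k [Var 0, e1, e2]) (es (foldr (f a) (xs a) (z a))) t"
      using t by (intro exI conjI[rotated]) auto
  qed
qed

section \<open>Lists and unary arithmetic\<close>

text \<open>Closure properties in a form that follows the syntax of an explicit formula; the running
  time of most functions below needs little else.\<close>

named_theorems polytime_rules

lemmas [polytime_rules] = polytime_id

lemma polytime_fst [polytime_rules]: "polytime_on D E (enc_pair A B) f \<Longrightarrow>
    polytime_on D E A (\<lambda>a. fst (f a))"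
  by (rule polytime_left[of D E "enc_pair A B" f]) (auto simp: enc_pair_def)

lemma polytime_snd [polytime_rules]: "polytime_on D E (enc_pair A B) f \<Longrightarrow>
    polytime_on D E B (\<lambda>a. snd (f a))"
  by (rule polytime_right[of D E "enc_pair A B" f]) (auto simp: enc_pair_def)

lemma polytime_Pair [polytime_rules]:
  "polytime_on D E A f \<Longrightarrow> polytime_on D E B g \<Longrightarrow> polytime_on D E (enc_pair A B) (\<lambda>a. (f a, g a))"
  by (rule polytime_Node[of D E A f B g]) (auto simp: enc_pair_def)

lemma polytime_const [polytime_rules]: "polytime_on D E e (\<lambda>a. c)"
proof -
  have "polytime_on D E (\<lambda>t. t) (\<lambda>a. T)" for T
  proof (induction T)
    case Leaf
    show ?case by (rule polytime_Leaf) simp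
  next
    case (Node T1 T2)
    then show ?case by (rule polytime_Node) simp
  qed
  from this[of "e c"] show ?thesis by (rule polytime_cong) simp
qed

text \<open>Inside a map or a filter the input is paired with a list element, and hypotheses about
  \<open>f\<close> and \<open>g\<close> over \<open>D\<close> no longer fit. Analysing the operation
  once, with its arguments as input, turns them into projections.\<close>

lemma polytime_binop:
  assumes "polytime_on UNIV (enc_pair A B) C (\<lambda>p. h (fst p) (snd p))" "polytime_on D E A f"
      "polytime_on D E B g"
  shows "polytime_on D E C (\<lambda>a. h (f a) (g a))"
  using polytime_comp[OF polytime_Pair[OF assms(2,3)] assms(1)] by simp

lemma polytime_Cons [polytime_rules]:
  "polytime_on D E e f \<Longrightarrow> polytime_on D E (enc_list_of e) g \<Longrightarrow> polytime_on D E (enc_list_of e) (\<lambda>a.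
      f a # g a)"
  by (rule polytime_Node[of D E e f "enc_list_of e" g]) auto

lemma polytime_tl [polytime_rules]: "polytime_on D E (enc_list_of e) f \<Longrightarrow>
    polytime_on D E (enc_list_of e) (\<lambda>a. tl (f a))"
proof (rule polytime_right[of D E "enc_list_of e" f])
  show "enc_list_of e (tl (f a)) = right (enc_list_of e (f a))" for a by (cases "f a") auto
qed

lemma polytime_Suc [polytime_rules]: "polytime_on D E enc_unary f \<Longrightarrow> polytime_on D E enc_unary (\<lambda>a.
    Suc (f a))"
  by (rule polytime_Node[OF polytime_const[of D E "\<lambda>_. Leaf" "()"], of enc_unary f]) auto

lemma polytime_if [polytime_rules]:
  "polytime_on D E enc_bool c \<Longrightarrow> polytime_on D E e f \<Longrightarrow> polytime_on D E e g \<Longrightarrow> polytime_on D E e (\<lambda>a.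
      if c a then f a else g a)"
  by (rule polytime_IfLeaf[of D E enc_bool c e g f]) (auto simp: enc_bool_def)

lemma polytime_eq_0 [polytime_rules]: "polytime_on D E enc_unary f \<Longrightarrow> polytime_on D E enc_bool (\<lambda>a.
    f a = 0)"
proof (rule polytime_IfLeaf[of D E enc_unary f, OF _ polytime_const[of _ _ _ True]
    polytime_const[of _ _ _ False]])
  show "(f a = 0) = (if enc_unary (f a) = Leaf then True else False)" for a
    by (cases "f a") auto
qed

lemma polytime_eq_Nil [polytime_rules]: "polytime_on D E (enc_list_of e) f \<Longrightarrow>
    polytime_on D E enc_bool (\<lambda>a. f a = [])"
proof (rule polytime_IfLeaf[of D E "enc_list_of e" f, OF _ polytime_const[of _ _ _ True]
    polytime_const[of _ _ _ False]])
  show "(f a = []) = (if enc_list_of e (f a) = Leaf then True else False)" for a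
    by (cases "f a") auto
qed

lemma polytime_not [polytime_rules]:
  assumes "polytime_on D E enc_bool f"
  shows "polytime_on D E enc_bool (\<lambda>a. \<not> f a)"
  using polytime_if[OF assms polytime_const[of D E enc_bool False] polytime_const[of D E enc_bool
      True]]
  by (rule polytime_cong) auto

lemma polytime_conj [polytime_rules]:
  assumes "polytime_on D E enc_bool f" "polytime_on D E enc_bool g"
  shows "polytime_on D E enc_bool (\<lambda>a. f a \<and> g a)"
  using polytime_if[OF assms polytime_const[of D E enc_bool False]] by (rule polytime_cong) auto

lemma polytime_disj [polytime_rules]:
  assumes "polytime_on D E enc_bool f" "polytime_on D E enc_bool g"
  shows "polytime_on D E enc_bool (\<lambda>a. f a \<or> g a)"
  using polytime_if[OF assms(1) polytime_const[of D E enc_bool True] assms(2)]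
      by (rule polytime_cong) auto

lemma polytime_imp [polytime_rules]:
  assumes "polytime_on D E enc_bool f" "polytime_on D E enc_bool g"
  shows "polytime_on D E enc_bool (\<lambda>a. f a \<longrightarrow> g a)"
  using polytime_if[OF assms polytime_const[of D E enc_bool True]] by (rule polytime_cong) auto

lemma polytime_eq_bool [polytime_rules]:
  assumes "polytime_on D E enc_bool f" "polytime_on D E enc_bool g"
  shows "polytime_on D E enc_bool (\<lambda>a. f a = g a)"
  using polytime_if[OF assms polytime_not[OF assms(2)]] by (rule polytime_cong) auto

lemma size_enc_list_of_append [simp]: "size (enc_list_of e (xs @ ys)) = size (enc_list_of e xs) +
    size (enc_list_of e ys)"
  by (induction xs) auto

lemma size_enc_list_of_rev [simp]: "size (enc_list_of e (rev xs)) = size (enc_list_of e xs)"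
  by (induction xs) auto

lemma polytime_append [polytime_rules]:
  assumes "polytime_on D E (enc_list_of e) f" "polytime_on D E (enc_list_of e) g"
  shows "polytime_on D E (enc_list_of e) (\<lambda>a. f a @ g a)"
proof -
  have r: "foldr (\<lambda>x s. x # s) xs ys = xs @ ys" for xs ys :: "'x list" by (induction xs) auto
  have "polytime_on D E (enc_list_of e) (\<lambda>a. foldr (\<lambda>x s. x # s) (f a) (g a))"
  proof (rule polytime_foldr[where D' = UNIV and f = "\<lambda>_ x s. x # s"])
    show "poly_bounded D E (\<lambda>a. size (enc_list_of e (f a)) + size (enc_list_of e (g a)))"
      by (intro poly_bounded_add polytime_imp_poly_bounded assms)
    show "size (enc_list_of e (foldr (\<lambda>x s. x # s) us (g a))) \<le> size (enc_list_of e (f a)) + size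
        (enc_list_of e (g a))"
      if "f a = ps @ us" for a us ps
      unfolding r that by simp
  qed (rule assms polytime_rules UNIV_I)+
  then show ?thesis unfolding r .
qed

lemma polytime_rev [polytime_rules]:
  assumes "polytime_on D E (enc_list_of e) f"
  shows "polytime_on D E (enc_list_of e) (\<lambda>a. rev (f a))"
proof -
  have r: "foldr (\<lambda>x s. s @ [x]) xs [] = rev xs" for xs :: "'x list" by (induction xs) auto
  have "polytime_on D E (enc_list_of e) (\<lambda>a. foldr (\<lambda>x s. s @ [x]) (f a) [])"
  proof (rule polytime_foldr[where D' = UNIV and f = "\<lambda>_ x s. s @ [x]"])
    show "poly_bounded D E (\<lambda>a. size (enc_list_of e (f a)))"
      by (intro poly_bounded_add polytime_imp_poly_bounded assms)
    show "size (enc_list_of e (foldr (\<lambda>x s. s @ [x]) us [])) \<le> size (enc_list_of e (f a))"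
      if "f a = ps @ us" for a us ps
      unfolding r that by simp
  qed (rule assms polytime_rules UNIV_I)+
  then show ?thesis unfolding r .
qed

lemma polytime_length [polytime_rules]:
  assumes "polytime_on D E (enc_list_of e) f"
  shows "polytime_on D E enc_unary (\<lambda>a. length (f a))"
proof -
  have r: "foldr (\<lambda>x s. Suc s) xs 0 = length xs" for xs :: "'x list" by (induction xs) auto
  have "polytime_on D E enc_unary (\<lambda>a. foldr (\<lambda>x s. Suc s) (f a) 0)"
  proof (rule polytime_foldr[where D' = UNIV and f = "\<lambda>_ x s. Suc s"])
    show "poly_bounded D E (\<lambda>a. size (enc_list_of e (f a)))"
      by (intro poly_bounded_add polytime_imp_poly_bounded assms)
    show "size (enc_unary (foldr (\<lambda>x s. Suc s) us 0)) \<le> size (enc_list_of e (f a))"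
      if "f a = ps @ us" for a us ps
      unfolding r that by (simp add: length_le_size_enc_list_of trans_le_add2)
  qed (rule assms polytime_rules UNIV_I)+
  then show ?thesis unfolding r .
qed

text \<open>Maps, filters and bounded quantifiers are special cases. The size bound holds because
  each block is polynomial in the sizes of \<open>a\<close> and of one element, and there are at
  most as many blocks as the size of the list.\<close>

lemma polytime_concat_map [polytime_rules]:
  assumes xs: "polytime_on D E (enc_list_of ex) xs"
    and f: "polytime_on {(a, x). a \<in> D \<and> x \<in> set (xs a)} (enc_pair E ex) (enc_list_of ey) (\<lambda>p. f
        (fst p) (snd p))"
  shows "polytime_on D E (enc_list_of ey) (\<lambda>a. concat (map (f a) (xs a)))"
proof -
  have r: "foldr (\<lambda>x s. g x @ s) xs [] = concat (map g xs)" for xs :: "'x list" and g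
    by (induction xs) auto
  obtain b where b: "\<And>a x. a \<in> D \<Longrightarrow> x \<in> set (xs a) \<Longrightarrow>
      size (enc_list_of ey (f a x)) \<le> poly b (Suc (size (E a) + size (ex x)))"
    using polytime_imp_poly_bounded[OF f] unfolding poly_bounded_def by force
  define Q where "Q a = poly b (Suc (size (E a) + size (enc_list_of ex (xs a))))" for a
  have Q: "size (enc_list_of ey (f a x)) \<le> Q a" if "a \<in> D" "x \<in> set (xs a)" for a x
    unfolding Q_def using size_enc_list_of_elem[OF that(2), of ex]
    by (intro order_trans[OF b[OF that] poly_nat_mono]) auto
  have "polytime_on D E (enc_list_of ey) (\<lambda>a. foldr (\<lambda>x s. f a x @ s) (xs a) [])"
  proof (rule polytime_foldr[where D' = "{(a, x, s). a \<in> D \<and> x \<in> set (xs a)}" and f =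
      "\<lambda>a x s. f a x @ s"])
    show "polytime_on {(a, x, s). a \<in> D \<and> x \<in> set (xs a)} (enc_pair E (enc_pair ex
        (enc_list_of ey))) (enc_list_of ey)
        (\<lambda>p. f (fst p) (fst (snd p)) @ snd (snd p))"
    proof (rule polytime_append)
      have "polytime_on {(a, x, s). a \<in> D \<and> x \<in> set (xs a)} (enc_pair E (enc_pair ex
          (enc_list_of ey))) (enc_list_of ey)
          (\<lambda>p. (\<lambda>p. f (fst p) (snd p)) (fst p, fst (snd p)))"
        by (rule polytime_comp[where D' = "{(a, x). a \<in> D \<and> x \<in> set (xs a)}"])
          ((rule f polytime_rules)+, auto)
      then show "polytime_on {(a, x, s). a \<in> D \<and> x \<in> set (xs a)} (enc_pair E (enc_pair ex
          (enc_list_of ey))) (enc_list_of ey)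
          (\<lambda>p. f (fst p) (fst (snd p)))" by simp
    qed (rule polytime_rules)+
    show "poly_bounded D E (\<lambda>a. size (enc_list_of ex (xs a)) * Q a)"
      unfolding Q_def by (intro poly_bounded_mult poly_bounded_poly poly_bounded_Suc
          poly_bounded_add poly_bounded_size polytime_imp_poly_bounded[OF xs])
    show "size (enc_list_of ey (foldr (\<lambda>x s. f a x @ s) us [])) \<le> size (enc_list_of ex (xs a)) * Q
        a"
      if a: "a \<in> D" and us: "xs a = ps @ us" for a us ps
    proof -
      have "set us \<subseteq> set (xs a)" using us by simp
      then have "size (enc_list_of ey (concat (map (f a) us))) \<le> length us * Q a"
        by (induction us) (use Q[OF a] in \<open>auto intro!: add_mono\<close>)
      also have "\<dots> \<le> size (enc_list_of ex (xs a)) * Q a"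
        using length_le_size_enc_list_of[of "xs a" ex] us by (intro mult_right_mono) auto
      finally show ?thesis unfolding r .
    qed
  qed (use xs in \<open>auto intro: polytime_const\<close>)
  then show ?thesis unfolding r .
qed

lemma polytime_map [polytime_rules]:
  assumes "polytime_on D E (enc_list_of ex) xs"
    and "polytime_on {(a, x). a \<in> D \<and> x \<in> set (xs a)} (enc_pair E ex) ey (\<lambda>p. f (fst p) (snd p))"
  shows "polytime_on D E (enc_list_of ey) (\<lambda>a. map (f a) (xs a))"
proof -
  have "polytime_on D E (enc_list_of ey) (\<lambda>a. concat (map (\<lambda>x. [f a x]) (xs a)))"
    by (rule assms polytime_rules)+
  then show ?thesis by simp
qed

lemma polytime_filter [polytime_rules]:
  assumes "polytime_on D E (enc_list_of ex) xs"
    and "polytime_on {(a, x). a \<in> D \<and> x \<in> set (xs a)} (enc_pair E ex) enc_bool (\<lambda>p. f (fst p) (snd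
        p))"
  shows "polytime_on D E (enc_list_of ex) (\<lambda>a. filter (f a) (xs a))"
proof -
  have r: "concat (map (\<lambda>x. if g x then [x] else []) ys) = filter g ys" for g and ys :: "'x list"
    by (induction ys) auto
  have "polytime_on D E (enc_list_of ex) (\<lambda>a. concat (map (\<lambda>x. if f a x then [x] else []) (xs a)))"
    by (rule assms polytime_rules)+
  then show ?thesis unfolding r .
qed

lemma polytime_ball [polytime_rules]:
  assumes "polytime_on D E (enc_list_of ex) xs"
    and "polytime_on {(a, x). a \<in> D \<and> x \<in> set (xs a)} (enc_pair E ex) enc_bool (\<lambda>p. f (fst p) (snd
        p))"
  shows "polytime_on D E enc_bool (\<lambda>a. \<forall>x\<in>set (xs a). f a x)"
proof -
  have "polytime_on D E enc_bool (\<lambda>a. filter (\<lambda>x. \<not> f a x) (xs a) = [])"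
    by (rule assms polytime_rules)+
  then show ?thesis by (simp add: filter_empty_conv)
qed

section \<open>Arithmetic on unary numbers\<close>

abbreviation enc_unit :: "unit \<Rightarrow> tree" where
  "enc_unit \<equiv> \<lambda>_. Leaf"

lemma enc_list_of_replicate_unit: "enc_list_of enc_unit (replicate n ()) = enc_unary n"
  by (induction n) auto

text \<open>A unary number is literally the encoding of a list of units: appending such lists is
  addition, and concatenation is summation.\<close>

lemma polytime_units: "polytime_on D E enc_unary f \<longleftrightarrow> polytime_on D E (enc_list_of enc_unit) (\<lambda>a.
    replicate (f a) ())"
proof
  assume "polytime_on D E enc_unary f"
  then show "polytime_on D E (enc_list_of enc_unit) (\<lambda>a. replicate (f a) ())"
    by (rule polytime_cong) (simp add: enc_list_of_replicate_unit)
next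
  assume "polytime_on D E (enc_list_of enc_unit) (\<lambda>a. replicate (f a) ())"
  then show "polytime_on D E enc_unary f"
    by (rule polytime_cong) (simp add: enc_list_of_replicate_unit)
qed

lemma polytime_replicate [polytime_rules]:
  assumes "polytime_on D E enc_unary n" "polytime_on D E e f"
  shows "polytime_on D E (enc_list_of e) (\<lambda>a. replicate (n a) (f a))"
proof -
  have "polytime_on D E (enc_list_of e) (\<lambda>a. map (\<lambda>_. f a) (replicate (n a) ()))"
  proof (rule polytime_map)
    have "polytime_on {(a, x :: unit). a \<in> D \<and> x \<in> set (replicate (n a) ())} (enc_pair E enc_unit)
        e (\<lambda>p. f (fst p))"
      by (rule polytime_comp[OF polytime_fst[OF polytime_id] assms(2)]) auto
    then show "polytime_on {(a, x). a \<in> D \<and> x \<in> set (replicate (n a) ())} (enc_pair E enc_unit) e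
        (\<lambda>p. f (fst p))" .
  qed (use assms in \<open>simp add: polytime_units\<close>)
  then show ?thesis by simp
qed

lemma polytime_plus [polytime_rules]:
  "polytime_on D E enc_unary f \<Longrightarrow> polytime_on D E enc_unary g \<Longrightarrow> polytime_on D E enc_unary (\<lambda>a. f a
      + g a)"
  unfolding polytime_units replicate_add by (rule polytime_append)

lemma polytime_sum_list [polytime_rules]:
  assumes "polytime_on D E (enc_list_of enc_unary) f"
  shows "polytime_on D E enc_unary (\<lambda>a. sum_list (f a))"
proof -
  have "concat (map (\<lambda>n. replicate n ()) ns) = replicate (sum_list ns) ()" for ns
    by (induction ns) (auto simp: replicate_add)
  moreover have "polytime_on D E (enc_list_of enc_unit) (\<lambda>a. concat (map (\<lambda>n. replicate n ()) (f
      a)))"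
    by (rule assms polytime_rules)+
  ultimately show ?thesis unfolding polytime_units by simp
qed

lemma polytime_weaken: "polytime_on D E e f \<Longrightarrow> polytime_on {(a, x). a \<in> D \<and>
    P a x} (enc_pair E ex) e (\<lambda>p. f (fst p))"
  by (rule polytime_comp[OF polytime_fst[OF polytime_id]]) auto

lemma polytime_times [polytime_rules]:
  assumes "polytime_on D E enc_unary f" "polytime_on D E enc_unary g"
  shows "polytime_on D E enc_unary (\<lambda>a. f a * g a)"
proof -
  have "polytime_on D E enc_unary (\<lambda>a. sum_list (map (\<lambda>_. g a) (replicate (f a) ())))"
    by (rule assms polytime_weaken polytime_rules)+
  then show ?thesis by (simp add: sum_list_replicate)
qed

lemma funpow_foldr: "foldr (\<lambda>_. f) (replicate n ()) z = (f ^^ n) z"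
  by (induction n) auto

text \<open>Iteration is a fold over \<open>n a\<close> units, so the counter is unary and the
  growth of all intermediate states has to be bounded as for folds.\<close>

lemma polytime_funpow:
  assumes n: "polytime_on D E enc_unary n" and z: "polytime_on D E es z"
    and f: "polytime_on D' (enc_pair E es) es (\<lambda>p. f (fst p) (snd p))"
    and dom: "\<And>a k. a \<in> D \<Longrightarrow> k < n a \<Longrightarrow> (a, (f a ^^ k) (z a)) \<in> D'"
    and bnd: "poly_bounded D E bnd" "\<And>a k. a \<in> D \<Longrightarrow> k \<le> n a \<Longrightarrow> size (es ((f a ^^ k) (z a))) \<le> bnd a"
  shows "polytime_on D E es (\<lambda>a. (f a ^^ n a) (z a))"
proof -
  have repl: "us = replicate (length us) ()" for us :: "unit list"
    by (simp add: list_eq_iff_nth_eq)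
  have "polytime_on D E es (\<lambda>a. foldr (\<lambda>_ s. f a s) (replicate (n a) ()) (z a))"
  proof (rule polytime_foldr[where ex = enc_unit and f = "\<lambda>a _ s. f a s" and D' = "{(a, x, s). (a,
      s) \<in> D'}"])
    have "polytime_on {(a, x :: unit, s). (a, s) \<in> D'} (enc_pair E (enc_pair enc_unit es)) es
        (\<lambda>p. (\<lambda>p. f (fst p) (snd p)) (fst p, snd (snd p)))"
      by (rule polytime_comp[where D' = D']) ((rule f polytime_rules)+, auto)
    then show "polytime_on {(a, x :: unit, s). (a, s) \<in> D'} (enc_pair E (enc_pair enc_unit es)) es
        (\<lambda>p. f (fst p) (snd (snd p)))" by simp
    show "(a, x, foldr (\<lambda>_. f a) us (z a)) \<in> {(a, x, s). (a, s) \<in> D'}"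
      if a: "a \<in> D" and us: "replicate (n a) () = ps @ x # us" for a ps x us
    proof -
      have "n a = length ps + Suc (length us)" using arg_cong[OF us, of length] by simp
      then show ?thesis using dom[OF a, of "length us"] by (subst repl[of us]) (simp add:
          funpow_foldr)
    qed
    show "size (es (foldr (\<lambda>_. f a) us (z a))) \<le> bnd a"
      if a: "a \<in> D" and us: "replicate (n a) () = ps @ us" for a ps us
    proof -
      have "n a = length ps + length us" using arg_cong[OF us, of length] by simp
      then show ?thesis using bnd(2)[OF a, of "length us"] by (subst repl[of us]) (simp add:
          funpow_foldr)
    qed
  qed (use n z bnd in \<open>simp_all add: polytime_units\<close>)
  then show ?thesis unfolding funpow_foldr .
qed

lemma polytime_minus [polytime_rules]:
  assumes "polytime_on D E enc_unary f" "polytime_on D E enc_unary g"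
  shows "polytime_on D E enc_unary (\<lambda>a. f a - g a)"
proof -
  have r: "((\<lambda>n. n - 1) ^^ k) n = n - k" for k n :: nat by (induction k) auto
  have "polytime_on D E enc_unary (\<lambda>a. ((\<lambda>n. n - 1) ^^ g a) (f a))"
  proof (rule polytime_funpow[where D' = UNIV and f = "\<lambda>_ n. n - 1"])
    show "polytime_on UNIV (enc_pair E enc_unary) enc_unary (\<lambda>p. snd p - 1)"
    \<comment> \<open>Truncation at 0 agrees with \<open>right Leaf = Leaf\<close>.\<close>
    proof (rule polytime_right[OF polytime_snd[OF polytime_id]])
      show "enc_unary (snd a - 1) = right (enc_unary (snd a))" for a :: "'a \<times> nat"
        by (cases "snd a") auto
    qed
    show "poly_bounded D E f" using polytime_imp_poly_bounded[OF assms(1)] by simp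
  qed (use assms r in auto)
  then show ?thesis unfolding r .
qed

lemma polytime_le [polytime_rules]:
  assumes "polytime_on D E enc_unary f" "polytime_on D E enc_unary g"
  shows "polytime_on D E enc_bool (\<lambda>a. f a \<le> g a)"
  using polytime_eq_0[OF polytime_minus[OF assms]] by (rule polytime_cong) auto

lemma polytime_less [polytime_rules]:
  assumes "polytime_on D E enc_unary f" "polytime_on D E enc_unary g"
  shows "polytime_on D E enc_bool (\<lambda>a. f a < g a)"
  unfolding less_eq_Suc_le by (rule assms polytime_rules)+

lemma polytime_eq_nat [polytime_rules]:
  assumes "polytime_on D E enc_unary f" "polytime_on D E enc_unary g"
  shows "polytime_on D E enc_bool (\<lambda>a. f a = g a)"
  unfolding eq_iff by (rule assms polytime_rules)+

lemma polytime_min [polytime_rules]: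
  assumes "polytime_on D E enc_unary f" "polytime_on D E enc_unary g"
  shows "polytime_on D E enc_unary (\<lambda>a. min (f a) (g a))"
  unfolding min_def by (rule assms polytime_rules)+

lemma polytime_drop [polytime_rules]:
  assumes "polytime_on D E enc_unary n" "polytime_on D E (enc_list_of e) f"
  shows "polytime_on D E (enc_list_of e) (\<lambda>a. drop (n a) (f a))"
proof -
  have r: "(tl ^^ k) xs = drop k xs" for k and xs :: "'x list"
    by (induction k) (auto simp: drop_Suc tl_drop)
  have "polytime_on D E (enc_list_of e) (\<lambda>a. (tl ^^ n a) (f a))"
  proof (rule polytime_funpow[where D' = UNIV and f = "\<lambda>_. tl"])
    show "poly_bounded D E (\<lambda>a. size (enc_list_of e (f a)))" by (rule polytime_imp_poly_bounded[OF
        assms(2)])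
    show "size (enc_list_of e ((tl ^^ k) (f a))) \<le> size (enc_list_of e (f a))" for a k
      unfolding r by (metis append_take_drop_id le_add2 size_enc_list_of_append)
  qed (rule assms polytime_rules UNIV_I)+
  then show ?thesis unfolding r .
qed

lemma polytime_take [polytime_rules]:
  assumes "polytime_on D E enc_unary n" "polytime_on D E (enc_list_of e) f"
  shows "polytime_on D E (enc_list_of e) (\<lambda>a. take (n a) (f a))"
proof -
  have r: "rev (drop (length xs - k) (rev xs)) = take k xs" for xs :: "'x list" and k
    by (cases "k \<le> length xs") (auto simp: rev_drop)
  have "polytime_on D E (enc_list_of e) (\<lambda>a. rev (drop (length (f a) - n a) (rev (f a))))"
    by (rule assms polytime_rules)+
  then show ?thesis unfolding r .
qed

lemma polytime_upt [polytime_rules]: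
  assumes "polytime_on D E enc_unary n"
  shows "polytime_on D E (enc_list_of enc_unary) (\<lambda>a. [0..<n a])"
proof -
  have r: "((\<lambda>s. s @ [length s]) ^^ k) [] = [0..<k]" for k
    by (induction k) auto
  have "polytime_on D E (enc_list_of enc_unary) (\<lambda>a. ((\<lambda>s. s @ [length s]) ^^ n a) [])"
  proof (rule polytime_funpow[where D' = UNIV and f = "\<lambda>_ s. s @ [length s]"])
    show "poly_bounded D E (\<lambda>a. n a * Suc (n a))"
      using polytime_imp_poly_bounded[OF assms] by (intro poly_bounded_mult poly_bounded_Suc)
          simp_all
    show "size (enc_list_of enc_unary (((\<lambda>s. s @ [length s]) ^^ k) [])) \<le> n a * Suc (n a)"
      if "k \<le> n a" for a k
    proof -
      have "size (enc_list_of enc_unary [0..<k]) \<le> length [0..<k] * Suc k"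
        by (rule size_enc_list_of_le) auto
      also have "\<dots> \<le> n a * Suc (n a)" using that by (intro mult_mono) auto
      finally show ?thesis unfolding r .
    qed
  qed (rule assms polytime_rules UNIV_I)+
  then show ?thesis unfolding r .
qed

text \<open>
  The default value has to be encoded by \<open>Leaf\<close>, which is what \<open>left\<close> returns past the end.
\<close>

lemma polytime_nth_default [polytime_rules]:
  assumes "polytime_on D E (enc_list_of e) f" "polytime_on D E enc_unary n" "e d = Leaf"
  shows "polytime_on D E e (\<lambda>a. nth_default d (f a) (n a))"
proof -
  have "left (enc_list_of e (drop k xs)) = e (nth_default d xs k)" for xs k
    using assms(3)
    by (cases "k < length xs") (auto simp: nth_default_def Cons_nth_drop_Suc[symmetric])
  then show ?thesis
    by (intro polytime_left[OF polytime_drop[OF assms(2,1)]]) auto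
qed

lemma polytime_nth_unary [polytime_rules]:
  "polytime_on D E (enc_list_of enc_unary) f \<Longrightarrow> polytime_on D E enc_unary n \<Longrightarrow>
     polytime_on D E enc_unary (\<lambda>a. nth_default 0 (f a) (n a))"
  by (rule polytime_nth_default) auto

lemma polytime_div [polytime_rules]:
  assumes "polytime_on D E enc_unary f" "polytime_on D E enc_unary g"
  shows "polytime_on D E enc_unary (\<lambda>a. f a div g a)"
proof -
  \<comment> \<open>For positive \<open>n\<close> the quotient counts the \<open>i\<close> with
    \<open>(i + 1) * n \<le> m\<close>, all of which lie below \<open>m\<close>; the case
    \<open>n = 0\<close> follows the convention \<open>m div 0 = 0\<close>.\<close>
  have r: "(if n = 0 then 0 else length (filter (\<lambda>i. Suc i * n \<le> m) [0..<m])) = m div n"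
      for m n :: nat
  proof (cases "n = 0")
    case False
    have "filter (\<lambda>i. Suc i * n \<le> m) [0..<m] = [0..<m div n]"
    proof -
      have "(Suc i * n \<le> m) = (i < m div n)" for i
        using False by (simp add: less_eq_div_iff_mult_less_eq Suc_le_eq[symmetric] del: mult_Suc)
      moreover have "filter (\<lambda>i. i < k) [0..<l] = [0..<k]" if "k \<le> l" for k l :: nat
        using that by (induction l) (auto simp: le_Suc_eq)
      ultimately show ?thesis by (simp del: mult_Suc)
    qed
    then show ?thesis using False by simp
  qed simp
  have "polytime_on UNIV (enc_pair enc_unary enc_unary) enc_unary (\<lambda>p. if snd p = 0 then 0 else
       length (filter (\<lambda>i. Suc i * snd p \<le> fst p) [0..<fst p]))"
    by (rule polytime_rules)+
  then show ?thesis unfolding r by (rule polytime_binop) (rule assms)+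
qed

lemma polytime_mod [polytime_rules]:
  assumes "polytime_on D E enc_unary f" "polytime_on D E enc_unary g"
  shows "polytime_on D E enc_unary (\<lambda>a. f a mod g a)"
  unfolding minus_mult_div_eq_mod[symmetric] by (rule assms polytime_rules)+

lemma polytime_odd [polytime_rules]: "polytime_on D E enc_unary f \<Longrightarrow> polytime_on D E enc_bool (\<lambda>a.
    odd (f a))"
  unfolding odd_iff_mod_2_eq_one by (rule polytime_rules | assumption)+

lemma polytime_member [polytime_rules]:
  assumes "polytime_on D E enc_unary f" "polytime_on D E (enc_list_of enc_unary) g"
  shows "polytime_on D E enc_bool (\<lambda>a. f a \<in> set (g a))"
proof -
  have r: "(filter (\<lambda>y. y = x) ys \<noteq> []) = (x \<in> set ys)" for x :: nat and ys
    by (auto simp: filter_empty_conv)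
  have "polytime_on UNIV (enc_pair enc_unary (enc_list_of enc_unary)) enc_bool
      (\<lambda>p. filter (\<lambda>y. y = fst p) (snd p) \<noteq> [])"
    by (rule polytime_rules)+
  then show ?thesis unfolding r by (rule polytime_binop) (rule assms)+
qed

text \<open>There is no equality test on trees, but comparison with a constant tree unfolds into a
  fixed number of tests of roots, so a finite set can be built into the program.\<close>

lemma polytime_mem_finite:
  assumes "finite S" "inj e" "polytime_on D E e f"
  shows "polytime_on D E enc_bool (\<lambda>a. f a \<in> S)"
proof -
  have tree: "polytime_on D E enc_bool (\<lambda>a. g a = T)" if "polytime_on D E (\<lambda>t. t) g" for g T
    using that
  proof (induction T arbitrary: g)
    case Leaf
    then show ?case
      by (rule polytime_IfLeaf[OF _ polytime_const[of _ _ _ True] polytime_const[of _ _ _ False]])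
          auto
  next
    case (Node T1 T2)
    have l: "polytime_on D E (\<lambda>t. t) (\<lambda>a. left (g a))" "polytime_on D E (\<lambda>t. t) (\<lambda>a. right (g a))"
      using polytime_left[OF Node.prems, of "\<lambda>t. t"] polytime_right[OF Node.prems, of "\<lambda>t. t"]
          by auto
    have c: "polytime_on D E enc_bool (\<lambda>a. left (g a) = T1 \<and> right (g a) = T2)"
      by (intro polytime_conj Node.IH l)
    show ?case
    proof (rule polytime_IfLeaf[OF Node.prems polytime_const[of _ _ _ False] c])
      show "(g a = Node T1 T2) = (if g a = Leaf then False else left (g a) = T1 \<and> right (g a) =
          T2)" for a
        by (cases "g a") auto
    qed
  qed
  have "polytime_on D E (\<lambda>t. t) (\<lambda>a. e (f a))"
    using assms(3) by (rule polytime_cong) simp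
  note e = tree[OF this]
  show ?thesis
    using assms(1)
  proof (induction S)
    case empty
    show ?case using polytime_const[of D E enc_bool False] by simp
  next
    case (insert x S)
    have "polytime_on D E enc_bool (\<lambda>a. e (f a) = e x \<or> f a \<in> S)"
      by (intro polytime_disj e insert)
    then show ?case by (simp add: inj_eq[OF assms(2)])
  qed
qed

text \<open>\<open>K\<close> is a constant and not an input: the induction yields a separate
  program, with its own polynomial, for every \<open>K\<close>.\<close>

lemma polytime_n_lists [polytime_rules]:
  assumes "polytime_on D E (enc_list_of e) f"
  shows "polytime_on D E (enc_list_of (enc_list_of e)) (\<lambda>a. List.n_lists K (f a))"
proof -
  have "polytime_on UNIV (enc_list_of e) (enc_list_of (enc_list_of e)) (\<lambda>xs. List.n_lists K xs)"
  proof (induction K)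
    case 0
    show ?case by (simp add: polytime_const)
  next
    case (Suc K)
    show ?case unfolding List.n_lists.simps
      by (rule polytime_rules Suc)+
  qed
  from polytime_comp[OF assms this] show ?thesis by simp
qed

lemma polytime_zip:
  assumes "polytime_on D E (enc_list_of e1) f" "polytime_on D E (enc_list_of e2) g" "e1 d1 = Leaf"
      "e2 d2 = Leaf"
  shows "polytime_on D E (enc_list_of (enc_pair e1 e2)) (\<lambda>a. zip (f a) (g a))"
proof -
  have r: "map (\<lambda>j. (nth_default d1 xs j, nth_default d2 ys j)) [0..<min (length xs) (length ys)]
      = zip xs ys"
    for xs ys
    by (rule nth_equalityI) (auto simp: nth_default_def)
  have "polytime_on UNIV (enc_pair (enc_list_of e1) (enc_list_of e2)) (enc_list_of (enc_pair e1
      e2)) (\<lambda>p. 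
     map (\<lambda>j. (nth_default d1 (fst p) j, nth_default d2 (snd p) j)) [0..<min (length (fst p))
         (length (snd p))])"
    by (rule polytime_rules polytime_nth_default assms)+
  then show ?thesis unfolding r by (rule polytime_binop) (rule assms)+
qed

lemma polytime_zip_nat [polytime_rules]:
  "polytime_on D E (enc_list_of enc_unary) f \<Longrightarrow> polytime_on D E (enc_list_of enc_unary) g \<Longrightarrow>
     polytime_on D E (enc_list_of (enc_pair enc_unary enc_unary)) (\<lambda>a. zip (f a) (g a))"
  by (rule polytime_zip[of _ _ _ _ _ _ 0 0]) auto

lemma polytime_zip_bool [polytime_rules]:
  "polytime_on D E (enc_list_of enc_bool) f \<Longrightarrow> polytime_on D E (enc_list_of enc_bool) g \<Longrightarrow>
     polytime_on D E (enc_list_of (enc_pair enc_bool enc_bool)) (\<lambda>a. zip (f a) (g a))"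
  by (rule polytime_zip[of _ _ _ _ _ _ False False]) auto

section \<open>Conversion to binary digits\<close>

fun bits :: "nat \<Rightarrow> bool list" where
  "bits n = (if n = 0 then [] else odd n # bits (n div 2))"

declare bits.simps [simp del]

lemma enc_binary_bits: "enc_binary n = enc_list_of enc_bool (bits n)"
proof (induction n rule: less_induct)
  case (less n)
  have "enc_unary (n mod 2) = enc_bool (odd n)" by (simp add: enc_bool_def mod_2_eq_odd)
  then show ?case
    using less by (subst enc_binary.simps, subst bits.simps) auto
qed

text \<open>The recursion along halving does not fit the loop rules, a map over a range does. The
  exponents with nonzero quotient form an initial segment, and any \<open>N \<ge> n\<close> covers
  it.\<close>

lemma bits_conv_filter:
  "n \<le> N \<Longrightarrow> bits n = map (\<lambda>i. odd (n div 2 ^ i)) (filter (\<lambda>i. n div 2 ^ i \<noteq> 0) [0..<N])"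
proof (induction n arbitrary: N rule: less_induct)
  case (less n)
  show ?case
  proof (cases "n = 0")
    case True
    then show ?thesis by (simp add: bits.simps)
  next
    case False
    with less.prems obtain N' where N: "N = Suc N'" by (cases N) auto
    have e: "n div 2 ^ Suc i = n div 2 div 2 ^ i" for i
      by (simp add: div_mult2_eq)
    have "bits (n div 2) = map (\<lambda>i. odd (n div 2 div 2 ^ i)) (filter (\<lambda>i. n div 2 div 2 ^ i \<noteq> 0)
        [0..<N'])"
      by (rule less.IH) (use less.prems False N in auto)
    then have "odd n # bits (n div 2) = 
      map (\<lambda>i. odd (n div 2 ^ i)) (filter (\<lambda>i. n div 2 ^ i \<noteq> 0) (0 # map Suc [0..<N']))"
      using False by (simp add: filter_map comp_def e del: power_Suc)
    then show ?thesis
      using False unfolding N upt_conv_Cons[OF zero_less_Suc] map_Suc_upt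
          by (simp add: bits.simps[of n])
  qed
qed

lemma polytime_bits [polytime_rules]:
  assumes "polytime_on D E enc_unary f"
  shows "polytime_on D E (enc_list_of enc_bool) (\<lambda>a. bits (f a))"
proof -
  have r: "((\<lambda>x. x div 2) ^^ i) n = n div 2 ^ i" for i n :: nat
    by (induction i) (auto simp: div_mult2_eq[symmetric] mult.commute)
  have "polytime_on UNIV (enc_pair enc_unary enc_unary) enc_unary (\<lambda>p. ((\<lambda>x. x div 2) ^^ snd p)
      (fst p))"
  proof (rule polytime_funpow[where D' = UNIV and f = "\<lambda>_ x. x div 2"])
    show "poly_bounded UNIV (enc_pair enc_unary enc_unary) (\<lambda>p. size (enc_pair enc_unary enc_unary
        p))"
      by (rule poly_bounded_size)
    show "size (enc_unary (((\<lambda>x. x div 2) ^^ k) (fst a))) \<le> size (enc_pair enc_unary enc_unary a)"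
      for k and a :: "nat \<times> nat"
      unfolding r by (simp add: enc_pair_def) (meson div_le_dividend le_SucI le_add1 order_trans)
  qed (rule polytime_rules UNIV_I)+
  note h = polytime_binop[OF this[unfolded r]]
  have "polytime_on UNIV enc_unary (enc_list_of enc_bool) (\<lambda>n. 
      map (\<lambda>i. odd (n div 2 ^ i)) (filter (\<lambda>i. n div 2 ^ i \<noteq> 0) [0..<n]))"
    by (rule h polytime_rules)+
  from polytime_comp[OF assms this] show ?thesis
    unfolding bits_conv_filter[OF order_refl] by simp
qed

section \<open>Sums over tuples\<close>

abbreviation tuples :: "nat \<Rightarrow> nat \<Rightarrow> nat list list" where
  "tuples K B \<equiv> List.n_lists K [0..<B]"

lemma length_tuples: "length (tuples K B) = B ^ K"
  by (simp add: length_n_lists)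

lemma sum_tuples_Suc:
  "(\<Sum>\<tau>\<leftarrow>tuples (Suc K) B. h \<tau>) = (\<Sum>\<tau>\<leftarrow>tuples K B. \<Sum>t<B. h (t # \<tau>) :: nat)"
proof -
  have "(\<Sum>\<tau>\<leftarrow>concat (map (\<lambda>ys. map (\<lambda>y. y # ys) [0..<B]) xss). h \<tau>) = (\<Sum>\<tau>\<leftarrow>xss. \<Sum>t<B. h (t # \<tau>))"
    for xss
    by (induction xss) (auto simp: comp_def interv_sum_list_conv_sum_set_nat atLeast0LessThan)
  then show ?thesis by simp
qed

lemma sum_tuples_swap:
  "(\<Sum>\<tau>\<leftarrow>xs. \<Sum>t<B. h t \<tau> :: nat) = (\<Sum>t<(B::nat). \<Sum>\<tau>\<leftarrow>xs. h t \<tau>)"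
  by (induction xs) (auto simp: sum.distrib)

text \<open>Hybrid argument: the coordinates are exchanged one at a time, each at the cost of a
  factor \<open>R' / R\<close>. The one-dimensional hypothesis quantifies over all \<open>g\<close>,
  because the function seen at one coordinate depends on the values at the others.\<close>

lemma sum_tuples_compare:
  fixes h :: "nat list \<Rightarrow> nat"
  assumes "\<And>i g. i \<in> set S \<Longrightarrow> R * (\<Sum>t<B. g (u i t)) \<le> R' * (\<Sum>t<B. g (v i t) :: nat)" "R \<le> R'"
  shows "R ^ K * (\<Sum>\<tau>\<leftarrow>tuples K B. h (map (\<lambda>(i, t). u i t) (zip S \<tau>)))
       \<le> R' ^ K * (\<Sum>\<tau>\<leftarrow>tuples K B. h (map (\<lambda>(i, t). v i t) (zip S \<tau>)))"
  using assms(1)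
proof (induction K arbitrary: S h)
  case 0
  then show ?case by simp
next
  case (Suc K)
  show ?case
  proof (cases S)
    case Nil
    \<comment> \<open>Coordinates beyond the length of \<open>S\<close> do not enter
      \<open>h\<close>; \<open>R \<le> R'\<close> pays for their factors.\<close>
    then show ?thesis using assms(2) by (auto intro!: mult_right_mono power_mono simp del:
        List.n_lists.simps power_Suc)
  next
    case (Cons i S')
    let ?u = "\<lambda>\<tau>. map (\<lambda>(i, t). u i t) (zip S' \<tau>)" and ?v = "\<lambda>\<tau>. map (\<lambda>(i, t). v i t) (zip S' \<tau>)"
    have "R ^ Suc K * (\<Sum>\<tau>\<leftarrow>tuples (Suc K) B. h (map (\<lambda>(i, t). u i t) (zip S \<tau>)))
      = R ^ K * (\<Sum>\<tau>\<leftarrow>tuples K B. R * (\<Sum>t<B. h (u i t # ?u \<tau>)))"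
      unfolding sum_tuples_Suc by (simp add: Cons sum_list_const_mult mult_ac)
    \<comment> \<open>The first coordinate is exchanged while all others are still of the form
      \<open>u\<close>.\<close>
    also have "\<dots> \<le> R ^ K * (\<Sum>\<tau>\<leftarrow>tuples K B. R' * (\<Sum>t<B. h (v i t # ?u \<tau>)))"
      by (intro mult_left_mono sum_list_mono Suc.prems) (auto simp: Cons)
    also have "\<dots> = R' * (\<Sum>t<B. R ^ K * (\<Sum>\<tau>\<leftarrow>tuples K B. h (v i t # ?u \<tau>)))"
      unfolding sum_list_const_mult sum_tuples_swap by (simp add: sum_distrib_left mult_ac)
    also have "\<dots> \<le> R' * (\<Sum>t<B. R' ^ K * (\<Sum>\<tau>\<leftarrow>tuples K B. h (v i t # ?v \<tau>)))"
      by (intro mult_left_mono sum_mono Suc.IH Suc.prems) (auto simp: Cons)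
    also have "\<dots> = R' ^ Suc K * (\<Sum>\<tau>\<leftarrow>tuples (Suc K) B. h (map (\<lambda>(i, t). v i t) (zip S \<tau>)))"
      unfolding sum_tuples_Suc sum_tuples_swap by (simp add: Cons sum_distrib_left mult_ac)
    finally show ?thesis .
  qed
qed

text \<open>Law of total expectation: drawing the value of \<open>i\<close> in advance or in its own
  coordinate gives the same distribution, since \<open>distinct S\<close> leaves at most one
  coordinate to \<open>i\<close>. The factor \<open>B\<close> counts the choices of
  \<open>t0\<close>.\<close>

lemma sum_tuples_fix_coordinate:
  fixes h :: "nat list \<Rightarrow> nat"
  assumes "distinct S"
  shows "(\<Sum>t0<B. \<Sum>\<tau>\<leftarrow>tuples K B. h (map (\<lambda>(j, t). if j = i then u t0 else v j t) (zip S \<tau>)))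
       = B * (\<Sum>\<tau>\<leftarrow>tuples K B. h (map (\<lambda>(j, t). if j = i then u t else v j t) (zip S \<tau>)))"
  using assms
proof (induction K arbitrary: S h)
  case 0
  then show ?case by simp
next
  case (Suc K)
  show ?case
  proof (cases S)
    case Nil
    then show ?thesis by simp
  next
    case (Cons j S')
    let ?w = "\<lambda>t0 \<tau>. map (\<lambda>(j, t). if j = i then u t0 else v j t) (zip S' \<tau>)"
    let ?w' = "\<lambda>\<tau>. map (\<lambda>(j, t). if j = i then u t else v j t) (zip S' \<tau>)"
    show ?thesis
    proof (cases "j = i")
      case True
      have "i \<notin> set S'" using Suc.prems Cons True by simp
      then have w: "?w t0 \<tau> = map (\<lambda>(j, t). v j t) (zip S' \<tau>)"
        and w': "?w' \<tau> = map (\<lambda>(j, t). v j t) (zip S' \<tau>)" for t0 \<tau>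
        by (auto dest: set_zip_leftD)
      show ?thesis
        unfolding sum_tuples_Suc sum_tuples_swap Cons
        by (simp add: True sum_distrib_left sum_list_const_mult w w')
    next
      case False
      have "(\<Sum>t0<B. \<Sum>\<tau>\<leftarrow>tuples (Suc K) B. h (map (\<lambda>(j, t). if j = i then u t0 else v j t) (zip S \<tau>)))
        = (\<Sum>t0<B. \<Sum>t<B. \<Sum>\<tau>\<leftarrow>tuples K B. h (v j t # ?w t0 \<tau>))"
        unfolding sum_tuples_Suc sum_tuples_swap Cons by (simp add: False)
      also have "\<dots> = (\<Sum>t<B. \<Sum>t0<B. \<Sum>\<tau>\<leftarrow>tuples K B. h (v j t # ?w t0 \<tau>))"
        by (rule sum.swap)
      also have "\<dots> = (\<Sum>t<B. B * (\<Sum>\<tau>\<leftarrow>tuples K B. h (v j t # ?w' \<tau>)))"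
        by (intro sum.cong Suc.IH refl) (use Suc.prems Cons in auto)
      also have "\<dots> = B * (\<Sum>\<tau>\<leftarrow>tuples (Suc K) B. h (map (\<lambda>(j, t). if j = i then u t else v j t) (zip
          S \<tau>)))"
        unfolding sum_tuples_Suc sum_tuples_swap Cons by (simp add: False sum_distrib_left)
      finally show ?thesis .
    qed
  qed
qed

text \<open>Only the coordinate belonging to \<open>i\<close> matters, and each of its values occurs
  in \<open>B ^ (K - 1)\<close> tuples; multiplying by \<open>B\<close> avoids the difference in the
  exponent. With \<open>length S \<le> K\<close> the coordinate of \<open>i\<close> is not cut off
  by \<open>zip\<close>.\<close>

lemma count_tuples_coordinate:
  assumes "distinct S" "i \<in> set S" "length S \<le> K"
  shows "B * (\<Sum>\<tau>\<leftarrow>tuples K B. of_bool (\<exists>(j, t)\<in>set (zip S \<tau>). j = i \<and> Q t))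
       = B ^ K * (\<Sum>t<B. of_bool (Q t) :: nat)"
  using assms
proof (induction K arbitrary: S)
  case 0
  then show ?case by simp
next
  case (Suc K)
  then obtain j S' where S: "S = j # S'" by (cases S) auto
  show ?case
  proof (cases "j = i")
    case True
    have "i \<notin> set S'" using Suc.prems S True by simp
    then have "(\<exists>(j, t)\<in>set (zip S (t # \<tau>)). j = i \<and> Q t) = Q t" for t \<tau>
      by (auto simp: S True dest: set_zip_leftD)
    then show ?thesis
      unfolding sum_tuples_Suc by (simp add: sum_list_triv length_tuples)
  next
    case False
    have "B * (\<Sum>\<tau>\<leftarrow>tuples (Suc K) B. of_bool (\<exists>(j, t)\<in>set (zip S \<tau>). j = i \<and> Q t))
      = B * (B * (\<Sum>\<tau>\<leftarrow>tuples K B. of_bool (\<exists>(j, t)\<in>set (zip S' \<tau>). j = i \<and> Q t)))"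
      unfolding sum_tuples_Suc by (simp add: S False sum_list_const_mult)
    also have "\<dots> = B * (B ^ K * (\<Sum>t<B. of_bool (Q t)))"
      by (subst Suc.IH) (use Suc.prems S False in auto)
    finally show ?thesis by (simp only: power_Suc mult.assoc)
  qed
qed

section \<open>Sums over cyclic shifts\<close>

lemma sum_rotate:
  fixes g :: "nat \<Rightarrow> nat"
  shows "(\<Sum>t<d. g ((o' + t) mod d)) = (\<Sum>l<d. g l)"
proof (induction o')
  case 0
  show ?case by (intro sum.cong) auto
next
  case (Suc o')
  show ?case
  proof (cases d)
    case (Suc d')
    have "(\<Sum>t<d. g ((Suc o' + t) mod d)) + g (o' mod d) = (\<Sum>t<Suc d. g ((o' + t) mod d))"
      unfolding sum.lessThan_Suc_shift by (simp add: add.commute)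
    also have "\<dots> = (\<Sum>t<d. g ((o' + t) mod d)) + g (o' mod d)" by simp
    finally show ?thesis using Suc.IH by simp
  qed simp
qed

lemma sum_periods:
  fixes g :: "nat \<Rightarrow> nat"
  shows "(\<Sum>t<k * d. g ((o' + t) mod d)) = k * (\<Sum>l<d. g l)"
proof (induction k)
  case (Suc k)
  have split: "(\<Sum>t<a + b. f t) = (\<Sum>t<a. f t) + (\<Sum>t<b. f (a + t))" for f :: "nat \<Rightarrow> nat" and a b
    by (induction b) auto
  have "(\<Sum>t<Suc k * d. g ((o' + t) mod d)) =
      (\<Sum>t<k * d. g ((o' + t) mod d)) + (\<Sum>t<d. g ((o' + k * d + t) mod d))"
    using split[of "\<lambda>t. g ((o' + t) mod d)" "k * d" d] by (simp add: add.commute[of d] add.assoc)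
  then show ?case using Suc sum_rotate by simp
qed simp

text \<open>With \<open>k = B div d\<close>, the range contains \<open>k\<close> full periods and is
  contained in \<open>k + 1\<close> of them. Both sums thus lie between \<open>k\<close> and
  \<open>k + 1\<close> times the sum over one period, wherever they start, and
  \<open>R * (k + 1) \<le> (R + 1) * k\<close> as \<open>R \<le> k\<close>.\<close>

lemma sum_mod_compare:
  fixes g :: "nat \<Rightarrow> nat"
  assumes "R * d \<le> B" "d > 0"
  shows "R * (\<Sum>t<B. g (t mod d)) \<le> Suc R * (\<Sum>t<B. g ((o' + t) mod d))"
proof -
  define k where "k = B div d"
  define X where "X = (\<Sum>l<d. g l)"
  have R: "R \<le> k" using assms unfolding k_def by (simp add: less_eq_div_iff_mult_less_eq)
  have k: "k * d \<le> B" "B \<le> Suc k * d"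
    unfolding k_def using assms(2) dividend_less_times_div[of d B] by (auto simp: mult.commute)
  have "(\<Sum>t<B. g (t mod d)) \<le> (\<Sum>t<Suc k * d. g ((0 + t) mod d))"
    using k by (auto intro!: sum_mono2)
  also have "\<dots> = Suc k * X" unfolding sum_periods X_def ..
  finally have 1: "(\<Sum>t<B. g (t mod d)) \<le> Suc k * X" .
  have "k * X = (\<Sum>t<k * d. g ((o' + t) mod d))" unfolding sum_periods X_def ..
  also have "\<dots> \<le> (\<Sum>t<B. g ((o' + t) mod d))"
    using k by (auto intro!: sum_mono2)
  finally have 2: "k * X \<le> (\<Sum>t<B. g ((o' + t) mod d))" .
  have "R * (\<Sum>t<B. g (t mod d)) \<le> R * (Suc k * X)" using 1 by (rule mult_left_mono) simp
  also have "\<dots> \<le> Suc R * (k * X)" using R by (simp add: algebra_simps)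
  also have "\<dots> \<le> Suc R * (\<Sum>t<B. g ((o' + t) mod d))" using 2 by (rule mult_left_mono) simp
  finally show ?thesis .
qed

section \<open>Regular instances by cloning variables\<close>

text \<open>A predicate index with a tuple. The tuple is a scope in instances, but a list of values
  when the pair is tested against \<open>table\<close>.\<close>

type_synonym clause = "nat \<times> nat list"

definition deg :: "clause list \<Rightarrow> nat \<Rightarrow> nat" where
  "deg cs i = length (filter (\<lambda>c. i \<in> set (snd c)) cs)"

definition offset :: "clause list \<Rightarrow> nat \<Rightarrow> nat" where
  "offset cs i = sum_list (map (deg cs) [0..<i])"

text \<open>
  The clones of variable \<open>i\<close> are numbered from \<open>offset cs i\<close>; \<open>deg (take e cs) i\<close> counts the
  occurrences of \<open>i\<close> before the \<open>e\<close>-th clause.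
\<close>

definition clone :: "clause list \<Rightarrow> nat \<Rightarrow> nat \<Rightarrow> nat \<Rightarrow> nat" where
  "clone cs e i t = offset cs i + (deg (take e cs) i + t) mod deg cs i"

text \<open>Clauses with fewer than \<open>K\<close> variables are also repeated
  \<open>B ^ K\<close> times; otherwise their relative weight would change. Surplus coordinates of
  \<open>\<tau>\<close> are cut off by \<open>zip\<close>.\<close>

definition clone_clauses :: "nat \<Rightarrow> nat \<Rightarrow> clause list \<Rightarrow> clause list" where
  "clone_clauses K B cs = concat (map (\<lambda>e. map (\<lambda>\<tau>.
       (nth_default 0 (map fst cs) e,
        map (\<lambda>(i, t). clone cs e i t) (zip (nth_default [] (map snd cs) e) \<tau>)))
     (tuples K B)) [0..<length cs])"

text \<open>The variables are exactly the clones, so a variable occurring in no clause disappears;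
  kept, it would have degree 0 and spoil regularity.\<close>

definition reg_inst :: "nat \<Rightarrow> nat \<Rightarrow> nat \<Rightarrow> clause list \<Rightarrow> csp_inst" where
  "reg_inst K B n cs = Inst (offset cs n)
     (map (\<lambda>c. Constraint (1 / of_nat (length (clone_clauses K B cs))) (fst c) (snd c))
        (clone_clauses K B cs))"

definition nsat :: "(clause \<Rightarrow> bool) \<Rightarrow> clause list \<Rightarrow> nat list \<Rightarrow> nat" where
  "nsat sat cs \<chi> = length (filter (\<lambda>c. sat (fst c, map (\<lambda>i. \<chi> ! i) (snd c))) cs)"

lemma offset_Suc: "offset cs (Suc i) = offset cs i + deg cs i"
  by (simp add: offset_def)

lemma offset_mono: "i \<le> j \<Longrightarrow> offset cs i \<le> offset cs j"
  by (rule lift_Suc_mono_le) (auto simp: offset_Suc)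

lemma offset_less: "i < n \<Longrightarrow> l < deg cs i \<Longrightarrow> offset cs i + l < offset cs n"
  using offset_mono[of "Suc i" n cs] by (simp add: offset_Suc)

lemma offset_inject:
  assumes "offset cs i + l = offset cs j + l'" "l < deg cs i" "l' < deg cs j"
  shows "i = j \<and> l = l'"
proof (cases i j rule: linorder_cases)
  case less
  then show ?thesis using offset_less[OF less assms(2)] assms(1) by simp
next
  case greater
  then show ?thesis using offset_less[OF greater assms(3)] assms(1) by simp
qed (use assms in auto)

lemma offset_exhaust:
  assumes "p < offset cs n"
  obtains i l where "i < n" "l < deg cs i" "p = offset cs i + l"
  using assms
proof (induction n)
  case 0
  then show ?case by (simp add: offset_def)
next
  case (Suc n)
  show ?case
  proof (cases "p < offset cs n")
    case True
    show ?thesis by (rule Suc.IH[OF Suc.prems(1) True]) auto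
  next
    case False
    then show ?thesis using Suc.prems(1)[of n "p - offset cs n"] Suc.prems(2)
        by (simp add: offset_Suc)
  qed
qed

lemma deg_pos: "e < length cs \<Longrightarrow> i \<in> set (snd (cs ! e)) \<Longrightarrow> deg cs i > 0"
  by (auto simp: deg_def filter_empty_conv dest: nth_mem)

text \<open>Along the clauses containing \<open>i\<close>, the counter
  \<open>deg (take e cs) i\<close> runs upwards from 0 without gaps or repetitions.\<close>

lemma sum_occurrences:
  "(\<Sum>e<length cs. if i \<in> set (snd (cs ! e)) then h (deg (take e cs) i) else 0) =
      (\<Sum>k<deg cs i. h k :: nat)"
proof (induction cs rule: rev_induct)
  case (snoc c cs)
  have "(\<Sum>e<length cs. if i \<in> set (snd ((cs @ [c]) ! e)) then h (deg (take e (cs @ [c])) i) else 0)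
    = (\<Sum>e<length cs. if i \<in> set (snd (cs ! e)) then h (deg (take e cs) i) else 0)"
    by (intro sum.cong) (auto simp: nth_append)
  then show ?case using snoc by (simp add: deg_def)
qed (simp add: deg_def)

lemma clone_clauses_eq:
  "clone_clauses K B cs = concat (map (\<lambda>e. map (\<lambda>\<tau>.
     (fst (cs ! e), map (\<lambda>(i, t). clone cs e i t) (zip (snd (cs ! e)) \<tau>))) (tuples K B))
         [0..<length cs])"
  unfolding clone_clauses_def by (intro arg_cong[where f = concat] map_cong refl) (auto simp:
      nth_default_def)

lemma length_filter_conv_sum: "length (filter P xs) = (\<Sum>x\<leftarrow>xs. of_bool (P x))"
  by (induction xs) auto

lemma count_clone_clauses:
  "length (filter P (clone_clauses K B cs)) = (\<Sum>e<length cs. \<Sum>\<tau>\<leftarrow>tuples K B.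
     of_bool (P (fst (cs ! e), map (\<lambda>(i, t). clone cs e i t) (zip (snd (cs ! e)) \<tau>))))"
  unfolding clone_clauses_eq filter_concat length_concat
  by (simp add: comp_def filter_map length_filter_conv_sum interv_sum_list_conv_sum_set_nat
      atLeast0LessThan)

lemma length_clone_clauses: "length (clone_clauses K B cs) = length cs * B ^ K"
  using count_clone_clauses[of "\<lambda>_. True" K B cs] by (simp add: sum_list_triv length_tuples)

locale clauses =
  fixes n K B :: nat and cs :: "clause list"
  assumes B_pos: "B > 0"
    and wf_distinct: "\<And>c. c \<in> set cs \<Longrightarrow> distinct (snd c)"
    and wf_vars: "\<And>c. c \<in> set cs \<Longrightarrow> set (snd c) \<subseteq> {..<n}"
    and wf_arity: "\<And>c. c \<in> set cs \<Longrightarrow> length (snd c) \<le> K"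
begin

lemma clone_less: "e < length cs \<Longrightarrow> i \<in> set (snd (cs ! e)) \<Longrightarrow> clone cs e i t < offset cs n"
  unfolding clone_def using wf_vars[of "cs ! e"] deg_pos[of e cs i]
  by (intro offset_less) auto

lemma clone_eq_iff:
  assumes "e < length cs" "j \<in> set (snd (cs ! e))" "l < deg cs i"
  shows "clone cs e j t = offset cs i + l \<longleftrightarrow> j = i \<and> (deg (take e cs) i + t) mod deg cs i = l"
  unfolding clone_def
  using offset_inject[of cs j "(deg (take e cs) j + t) mod deg cs j" i l] deg_pos[OF assms(1,2)]
      assms(3)
  by auto

lemma degree_clone_clauses:
  assumes "p < offset cs n"
  shows "length (filter (\<lambda>c. p \<in> set (snd c)) (clone_clauses K B cs)) = B ^ K"
proof -
  obtain i l where il: "i < n" "l < deg cs i" "p = offset cs i + l"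
    using offset_exhaust[OF assms] .
  let ?d = "deg cs i" and ?D = "length (filter (\<lambda>c. p \<in> set (snd c)) (clone_clauses K B cs))"
  define N where "N k = (\<Sum>t<B. of_bool ((k + t) mod ?d = l) :: nat)" for k
  \<comment> \<open>The factor \<open>B\<close>, cancelled at the end, is there to match
    \<open>count_tuples_coordinate\<close>.\<close>
  have "B * ?D = (\<Sum>e<length cs. B * (\<Sum>\<tau>\<leftarrow>tuples K B.
      of_bool (p \<in> set (map (\<lambda>(i, t). clone cs e i t) (zip (snd (cs ! e)) \<tau>)))))"
    unfolding count_clone_clauses by (simp add: sum_distrib_left)
  also have "\<dots> = (\<Sum>e<length cs. B ^ K * (if i \<in> set (snd (cs ! e)) then N (deg (take e cs) i) else
      0))"
  proof (rule sum.cong[OF refl])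
    fix e assume "e \<in> {..<length cs}"
    then have e: "e < length cs" by simp
    let ?S = "snd (cs ! e)"
    have "p \<in> set (map (\<lambda>(i, t). clone cs e i t) (zip ?S \<tau>)) \<longleftrightarrow>
        (\<exists>(j, t)\<in>set (zip ?S \<tau>). j = i \<and> (deg (take e cs) i + t) mod ?d = l)" for \<tau>
    proof -
      have "(p = clone cs e j t) = (j = i \<and> (deg (take e cs) i + t) mod ?d = l)"
        if "(j, t) \<in> set (zip ?S \<tau>)" for j t
        unfolding il(3) clone_eq_iff[OF e set_zip_leftD[OF that] il(2), of t, symmetric]
            by (rule eq_commute)
      then have "(\<exists>x\<in>set (zip ?S \<tau>). p = (case x of (j, t) \<Rightarrow> clone cs e j t)) \<longleftrightarrow>
          (\<exists>(j, t)\<in>set (zip ?S \<tau>). j = i \<and> (deg (take e cs) i + t) mod ?d = l)"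
        by (intro bex_cong) auto
      then show ?thesis by (simp only: set_map image_iff)
    qed
    note * = this
    show "B * (\<Sum>\<tau>\<leftarrow>tuples K B. of_bool (p \<in> set (map (\<lambda>(i, t). clone cs e i t) (zip ?S \<tau>))))
        = B ^ K * (if i \<in> set ?S then N (deg (take e cs) i) else 0)"
    proof (cases "i \<in> set ?S")
      case True
      show ?thesis unfolding *
        using count_tuples_coordinate[OF _ True] wf_distinct[of "cs ! e"] wf_arity[of
            "cs ! e"] e True
        by (simp add: N_def)
    next
      case False
      then have "\<not> (\<exists>(j, t)\<in>set (zip ?S \<tau>). j = i \<and> (deg (take e cs) i + t) mod ?d = l)" for \<tau>
        by (auto dest: set_zip_leftD)
      then show ?thesis unfolding * using False by (simp add: sum_list_triv)
    qed
  qed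
  also have "\<dots> = B ^ K * (\<Sum>k<?d. N k)"
    unfolding sum_distrib_left[symmetric] sum_occurrences ..
  \<comment> \<open>After the exchange of sums \<open>t\<close> is fixed, and exactly one occurrence
    \<open>k\<close> is rotated onto the clone \<open>l\<close>.\<close>
  also have "(\<Sum>k<?d. N k) = (\<Sum>t<B. \<Sum>k<?d. of_bool ((t + k) mod ?d = l))"
    unfolding N_def by (subst sum.swap) (simp add: add.commute)
  also have "\<dots> = B"
    unfolding sum_rotate[of "\<lambda>x. of_bool (x = l)"] using il(2) by (simp add: sum.delta' of_bool_def)
  finally show ?thesis using B_pos by (simp add: mult.commute)
qed

end

section \<open>Rounding assignments of the clones\<close>

text \<open>
  The finite part of the predicates that matters, so that a program can look it up.
\<close>

definition table :: "csp \<Rightarrow> nat \<Rightarrow> clause set" where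
  "table \<Lambda> q = {(p, vs). p < length \<Lambda> \<and> length vs = arity (\<Lambda> ! p) \<and> set vs \<subseteq> {..<q} \<and>
      holds (\<Lambda> ! p) vs}"

definition wf_clause :: "csp \<Rightarrow> nat \<Rightarrow> clause \<Rightarrow> bool" where
  "wf_clause \<Lambda> n c \<longleftrightarrow> fst c < length \<Lambda> \<and> length (snd c) = arity (\<Lambda> ! fst c) \<and>
     distinct (snd c) \<and> set (snd c) \<subseteq> {..<n}"

lemma finite_table: "finite (table \<Lambda> q)"
proof (rule finite_subset)
  show "table \<Lambda> q \<subseteq> (\<Union>p<length \<Lambda>. Pair p ` {vs. set vs \<subseteq> {..<q} \<and> length vs = arity (\<Lambda> ! p)})"
    by (auto simp: table_def)
  show "finite (\<Union>p<length \<Lambda>. Pair p ` {vs. set vs \<subseteq> {..<q} \<and> length vs = arity (\<Lambda> ! p)})"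
    by (intro finite_UN_I finite_imageI finite_lists_length_eq) auto
qed

lemma table_iff_holds:
  assumes "wf_clause \<Lambda> n c" "length \<chi> = n" "set \<chi> \<subseteq> {..<q}"
  shows "(fst c, map (\<lambda>i. \<chi> ! i) (snd c)) \<in> table \<Lambda> q \<longleftrightarrow> holds (\<Lambda> ! fst c) (map (\<lambda>i. \<chi> ! i) (snd c))"
proof -
  have "\<chi> ! i \<in> set \<chi>" if "i \<in> set (snd c)" for i
    using that assms(1,2) by (auto simp: wf_clause_def)
  then have "\<chi> ! i < q" if "i \<in> set (snd c)" for i
    using that assms(3) by auto
  then show ?thesis
    using assms(1) by (auto simp: table_def wf_clause_def)
qed

lemma Val_unweighted:
  assumes "\<And>c. c \<in> set cs \<Longrightarrow> wf_clause \<Lambda> n c" "length \<chi> = n" "set \<chi> \<subseteq> {..<q}"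
  shows "Val \<Lambda> (Inst n (map (\<lambda>c. Constraint w (fst c) (snd c)) cs)) \<chi> =
    w * of_nat (nsat (\<lambda>c. c \<in> table \<Lambda> q) cs \<chi>)"
proof -
  have "Val \<Lambda> (Inst n (map (\<lambda>c. Constraint w (fst c) (snd c)) cs)) \<chi> =
    (\<Sum>c\<leftarrow>cs. w * of_bool ((fst c, map (\<lambda>i. \<chi> ! i) (snd c)) \<in> table \<Lambda> q))"
    unfolding Val_def using table_iff_holds[OF assms(1) assms(2,3)]
    by (simp add: comp_def cong: map_cong)
  also have "\<dots> = w * of_nat (nsat (\<lambda>c. c \<in> table \<Lambda> q) cs \<chi>)"
    unfolding nsat_def by (induction cs) (auto simp: algebra_simps)
  finally show ?thesis .
qed

definition lift_assignment :: "clause list \<Rightarrow> nat \<Rightarrow> nat list \<Rightarrow> nat list" where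
  "lift_assignment cs n \<chi> = concat (map (\<lambda>i. replicate (deg cs i) (\<chi> ! i)) [0..<n])"

lemma length_lift_assignment: "length (lift_assignment cs n \<chi>) = offset cs n"
  by (simp add: lift_assignment_def offset_def length_concat comp_def)

lemma nth_lift_assignment:
  "i < n \<Longrightarrow> l < deg cs i \<Longrightarrow> lift_assignment cs n \<chi> ! (offset cs i + l) = \<chi> ! i"
proof (induction n)
  case (Suc n)
  have *: "lift_assignment cs (Suc n) \<chi> = lift_assignment cs n \<chi> @ replicate (deg cs n) (\<chi> ! n)"
    by (simp add: lift_assignment_def)
  show ?case
  proof (cases "i < n")
    case True
    then show ?thesis using Suc offset_less[OF True Suc.prems(2)]
      by (simp add: * nth_append length_lift_assignment)
  next
    case False
    then have "i = n" using Suc.prems by simp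
    then show ?thesis using Suc.prems by (simp add: * nth_append length_lift_assignment)
  qed
qed simp

text \<open>
  The variables below \<open>length s\<close> have been fixed by \<open>s\<close>, the others are still distributed like
  the values of their clones under \<open>\<psi>\<close>.
\<close>

definition entry :: "clause list \<Rightarrow> nat list \<Rightarrow> nat list \<Rightarrow> nat \<Rightarrow> nat \<Rightarrow> nat" where
  "entry cs \<psi> s i t =
     (if i < length s then nth_default 0 s i else nth_default 0 \<psi> (offset cs i + t mod deg cs i))"

text \<open>\<open>B ^ K\<close> times the expected number of satisfied clauses when the variables
  not fixed by \<open>s\<close> are drawn independently. The plain sum over all tuples is computable
  because \<open>K\<close> is constant.\<close>

definition potential :: "(clause \<Rightarrow> bool) \<Rightarrow> nat \<Rightarrow> nat \<Rightarrow> clause list \<Rightarrow> nat list \<Rightarrow> nat list \<Rightarrow>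
    nat" where
  "potential sat K B cs \<psi> s = (\<Sum>c\<leftarrow>cs. \<Sum>\<tau>\<leftarrow>tuples K B.
     of_bool (sat (fst c, map (\<lambda>(i, t). entry cs \<psi> s i t) (zip (snd c) \<tau>))))"

definition best_value :: "(clause \<Rightarrow> bool) \<Rightarrow> nat \<Rightarrow> nat \<Rightarrow> nat \<Rightarrow> clause list \<Rightarrow> nat list \<Rightarrow> nat list \<Rightarrow>
    nat" where
  "best_value sat q K B cs \<psi> s = foldr (\<lambda>v b.
     if potential sat K B cs \<psi> (s @ [v]) < potential sat K B cs \<psi> (s @ [b]) then v else b) [0..<q]
         0"

definition round_assignment :: "(clause \<Rightarrow> bool) \<Rightarrow> nat \<Rightarrow> nat \<Rightarrow> nat \<Rightarrow> nat \<Rightarrow> clause list \<Rightarrow> nat list \<Rightarrow>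
    nat list" where
  "round_assignment sat q K B n cs \<psi> = ((\<lambda>s. s @ [best_value sat q K B cs \<psi> s]) ^^ n) []"

lemma best_value_le: "v < q \<Longrightarrow>
  potential sat K B cs \<psi> (s @ [best_value sat q K B cs \<psi> s]) \<le> potential sat K B cs \<psi> (s @ [v])"
proof -
  let ?f = "\<lambda>v. potential sat K B cs \<psi> (s @ [v])"
  have "v \<in> set xs \<Longrightarrow> ?f (foldr (\<lambda>v b. if ?f v < ?f b then v else b) xs z) \<le> ?f v" for v xs z
    by (induction xs) auto
  from this[of v "[0..<q]"] show "v < q \<Longrightarrow> ?thesis" by (simp add: best_value_def)
qed

lemma foldr_choice_mem: "foldr (\<lambda>v b. if P v b then v else b) xs z \<in> insert z (set xs)"
  by (induction xs) auto

lemma best_value_less: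
  assumes "q > 0"
  shows "best_value sat q K B cs \<psi> s < q"
proof -
  have "best_value sat q K B cs \<psi> s \<in> insert 0 (set [0..<q])"
    unfolding best_value_def by (rule foldr_choice_mem)
  with assms show ?thesis by auto
qed

lemma length_round_iter: "length (((\<lambda>s. s @ [f s]) ^^ k) []) = k"
  by (induction k) auto

lemma set_round_iter: "(\<And>s. f s < q) \<Longrightarrow> set (((\<lambda>s. s @ [f s]) ^^ k) []) \<subseteq> {..<q}"
  by (induction k) auto

context clauses
begin

text \<open>All clones of a variable carry the same value, so every copy of a clause behaves like
  the original. This bounds the optimum of the cloned instance from above.\<close>

lemma nsat_lift_assignment:
  assumes "length \<chi> = n"
  shows "nsat sat (clone_clauses K B cs) (lift_assignment cs n \<chi>) = B ^ K * nsat sat cs \<chi>"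
proof -
  have "nsat sat (clone_clauses K B cs) (lift_assignment cs n \<chi>) =
    (\<Sum>e<length cs. \<Sum>\<tau>\<leftarrow>tuples K B. of_bool (sat (fst (cs ! e), map (\<lambda>i. \<chi> ! i) (snd (cs ! e)))))"
    unfolding nsat_def count_clone_clauses
  proof (intro sum.cong refl arg_cong[where f = sum_list] map_cong)
    fix e \<tau> assume "e \<in> {..<length cs}" and \<tau>: "\<tau> \<in> set (tuples K B)"
    then have e: "e < length cs" by simp
    have "length (snd (cs ! e)) \<le> length \<tau>"
      using wf_arity[OF nth_mem[OF e]] \<tau> by (auto simp: set_n_lists)
    moreover have "lift_assignment cs n \<chi> ! clone cs e i t = \<chi> ! i" if "i \<in> set (snd (cs ! e))"
        for i t
      unfolding clone_def using wf_vars[OF nth_mem[OF e]] deg_pos[OF e that] that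
      by (intro nth_lift_assignment) auto
    ultimately have "map (\<lambda>i. lift_assignment cs n \<chi> ! i)
        (map (\<lambda>(i, t). clone cs e i t) (zip (snd (cs ! e)) \<tau>)) = map (\<lambda>i. \<chi> ! i) (snd (cs ! e))"
      by (intro nth_equalityI) auto
    then show "(of_bool (sat (fst (fst (cs ! e), map (\<lambda>(i, t). clone cs e i t) (zip (snd (cs ! e))
        \<tau>)),
         map (\<lambda>i. lift_assignment cs n \<chi> ! i)
           (snd (fst (cs ! e), map (\<lambda>(i, t). clone cs e i t) (zip (snd (cs ! e)) \<tau>))))) :: nat) =
       of_bool (sat (fst (cs ! e), map (\<lambda>i. \<chi> ! i) (snd (cs ! e))))"
      by (simp only: fst_conv snd_conv)
  qed
  also have "\<dots> = B ^ K * nsat sat cs \<chi>"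
    by (simp add: nsat_def sum_list_triv length_tuples length_filter_conv_sum
        sum_distrib_left[symmetric]
        sum_list_sum_nth atLeast0LessThan)
  finally show ?thesis .
qed

text \<open>\<open>clone\<close> shifts the coordinate by the number of the occurrence,
  \<open>entry\<close> does not: conditional expectations need one distribution per variable, common
  to all clauses. As \<open>B\<close> covers \<open>R\<close> periods of every
  \<open>deg cs i\<close>, removing the shift costs a factor \<open>(R + 1) / R\<close> per
  coordinate.\<close>

lemma potential_Nil_le:
  assumes "R * offset cs n \<le> B" "length \<psi> = offset cs n"
  shows "R ^ K * potential sat K B cs \<psi> [] \<le> Suc R ^ K * nsat sat (clone_clauses K B cs) \<psi>"
proof -
  have "R ^ K * (\<Sum>\<tau>\<leftarrow>tuples K B. of_bool (sat (fst (cs ! e),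
          map (\<lambda>(i, t). entry cs \<psi> [] i t) (zip (snd (cs ! e)) \<tau>))))
    \<le> Suc R ^ K * (\<Sum>\<tau>\<leftarrow>tuples K B. of_bool (sat (fst (cs ! e),
          map (\<lambda>(i, t). \<psi> ! clone cs e i t) (zip (snd (cs ! e)) \<tau>))))" if e: "e < length cs" for e
  proof (rule sum_tuples_compare)
    fix i and g :: "nat \<Rightarrow> nat" assume i: "i \<in> set (snd (cs ! e))"
    have d: "deg cs i > 0" by (rule deg_pos[OF e i])
    have n: "i < n" using wf_vars[OF nth_mem[OF e]] i by auto
    have "offset cs i + deg cs i \<le> offset cs n"
      using offset_mono[of "Suc i" n cs] n by (simp add: offset_Suc)
    then have R: "R * deg cs i \<le> B"
      using assms(1) by (meson add_leD2 le_trans mult_le_mono2)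
    have "entry cs \<psi> [] i t = \<psi> ! (offset cs i + t mod deg cs i)" for t
      using offset_less[OF n, of "t mod deg cs i"] d assms(2)
          by (simp add: entry_def nth_default_def)
    then show "R * (\<Sum>t<B. g (entry cs \<psi> [] i t)) \<le> Suc R * (\<Sum>t<B. g (\<psi> ! clone cs e i t))"
      unfolding clone_def
      using sum_mod_compare[OF R d, of "\<lambda>x. g (\<psi> ! (offset cs i + x))"] by simp
  qed simp
  then have "R ^ K * (\<Sum>e<length cs. \<Sum>\<tau>\<leftarrow>tuples K B. of_bool (sat (fst (cs ! e),
          map (\<lambda>(i, t). entry cs \<psi> [] i t) (zip (snd (cs ! e)) \<tau>))))
    \<le> Suc R ^ K * (\<Sum>e<length cs. \<Sum>\<tau>\<leftarrow>tuples K B. of_bool (sat (fst (cs ! e),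
          map (\<lambda>(i, t). \<psi> ! clone cs e i t) (zip (snd (cs ! e)) \<tau>))))"
    unfolding sum_distrib_left by (intro sum_mono) auto
  then show ?thesis
    unfolding potential_def nsat_def count_clone_clauses
    by (simp add: sum_list_sum_nth atLeast0LessThan comp_def case_prod_unfold)
qed

text \<open>Averaged over \<open>t0 < B\<close>, fixing the next variable to the value of a random
  clone reproduces the present potential; hence some value does not exceed the average.\<close>

lemma potential_snoc:
  assumes "q > 0" "set \<psi> \<subseteq> {..<q}"
  obtains v where "v < q" "potential sat K B cs \<psi> (s @ [v]) \<le> potential sat K B cs \<psi> s"
proof -
  let ?i = "length s"
  define u where "u t = entry cs \<psi> s ?i t" for t
  have u: "u t < q" for t
    using assms by (auto simp: u_def entry_def nth_default_def dest!: nth_mem)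
  have "(\<Sum>t0<B. potential sat K B cs \<psi> (s @ [u t0])) =
      (\<Sum>c\<leftarrow>cs. \<Sum>t0<B. \<Sum>\<tau>\<leftarrow>tuples K B.
         of_bool (sat (fst c, map (\<lambda>(i, t). entry cs \<psi> (s @ [u t0]) i t) (zip (snd c) \<tau>))))"
    unfolding potential_def by (rule sum_tuples_swap[symmetric])
  also have "\<dots> = (\<Sum>c\<leftarrow>cs. B * (\<Sum>\<tau>\<leftarrow>tuples K B.
         of_bool (sat (fst c, map (\<lambda>(i, t). entry cs \<psi> s i t) (zip (snd c) \<tau>)))))"
  proof (intro arg_cong[where f = sum_list] map_cong refl)
    fix c assume "c \<in> set cs"
    have 1: "entry cs \<psi> (s @ [u t0]) i t = (if i = ?i then u t0 else entry cs \<psi> s i t)" for i t t0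
      by (auto simp: entry_def nth_default_def nth_append)
    \<comment> \<open>The trivial case distinction gives the right hand side the shape required by
      \<open>sum_tuples_fix_coordinate\<close>.\<close>
    have 2: "entry cs \<psi> s i t = (if i = ?i then u t else entry cs \<psi> s i t)" for i t
      by (simp add: u_def)
    show "(\<Sum>t0<B. \<Sum>\<tau>\<leftarrow>tuples K B. of_bool (sat (fst c, map (\<lambda>(i, t). entry cs \<psi> (s @
        [u t0]) i t) (zip (snd c) \<tau>))))
       = B * (\<Sum>\<tau>\<leftarrow>tuples K B. of_bool (sat (fst c, map (\<lambda>(i, t). entry cs \<psi> s i t) (zip (snd c)
           \<tau>))))"
      unfolding 1 sum_tuples_fix_coordinate[OF wf_distinct[OF \<open>c \<in> set cs\<close>], where h =
          "\<lambda>vs. of_bool (sat (fst c, vs))"]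
      by (simp flip: 2)
  qed
  also have "\<dots> = (\<Sum>t0<B. potential sat K B cs \<psi> s)"
    by (simp add: potential_def sum_list_const_mult)
  finally have "\<not> (\<forall>t0<B. potential sat K B cs \<psi> s < potential sat K B cs \<psi> (s @ [u t0]))"
    using sum_strict_mono[of "{..<B}" "\<lambda>_. potential sat K B cs \<psi> s" "\<lambda>t0. potential sat K B cs \<psi>
        (s @ [u t0])"] B_pos
    by (auto simp: lessThan_empty_iff)
  then show thesis using that u by (meson not_le)
qed

lemma potential_total:
  assumes "length s = n"
  shows "potential sat K B cs \<psi> s = B ^ K * nsat sat cs s"
proof -
  have "potential sat K B cs \<psi> s =
    (\<Sum>c\<leftarrow>cs. \<Sum>\<tau>\<leftarrow>tuples K B. of_bool (sat (fst c, map (\<lambda>i. s ! i) (snd c))))"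
    unfolding potential_def
  proof (intro arg_cong[where f = sum_list] map_cong refl)
    fix c \<tau> assume c: "c \<in> set cs" and \<tau>: "\<tau> \<in> set (tuples K B)"
    have "length (snd c) \<le> length \<tau>" using wf_arity[OF c] \<tau> by (auto simp: set_n_lists)
    moreover have "entry cs \<psi> s i t = s ! i" if "i \<in> set (snd c)" for i t
      using wf_vars[OF c] that assms by (auto simp: entry_def nth_default_def)
    ultimately have "map (\<lambda>(i, t). entry cs \<psi> s i t) (zip (snd c) \<tau>) = map (\<lambda>i. s ! i) (snd c)"
      by (intro nth_equalityI) auto
    then show "of_bool (sat (fst c, map (\<lambda>(i, t). entry cs \<psi> s i t) (zip (snd c) \<tau>))) =
       (of_bool (sat (fst c, map (\<lambda>i. s ! i) (snd c))) :: nat)" by (simp only:)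
  qed
  also have "\<dots> = B ^ K * nsat sat cs s"
    by (simp add: nsat_def sum_list_triv length_tuples length_filter_conv_sum sum_list_const_mult)
  finally show ?thesis .
qed

lemma nsat_round_assignment:
  assumes "q > 0" "set \<psi> \<subseteq> {..<q}" "R * offset cs n \<le> B" "length \<psi> = offset cs n"
  shows "R ^ K * B ^ K * nsat sat cs (round_assignment sat q K B n cs \<psi>)
    \<le> Suc R ^ K * nsat sat (clone_clauses K B cs) \<psi>"
proof -
  have "potential sat K B cs \<psi> (((\<lambda>s. s @ [best_value sat q K B cs \<psi> s]) ^^ k) [])
      \<le> potential sat K B cs \<psi> []" for k
  proof (induction k)
    case (Suc k)
    let ?s = "((\<lambda>s. s @ [best_value sat q K B cs \<psi> s]) ^^ k) []"
    obtain v where "v < q" "potential sat K B cs \<psi> (?s @ [v]) \<le> potential sat K B cs \<psi> ?s"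
      by (rule potential_snoc[OF assms(1,2)])
    then have "potential sat K B cs \<psi> (?s @ [best_value sat q K B cs \<psi> ?s]) \<le>
        potential sat K B cs \<psi> ?s"
      using best_value_le order_trans by blast
    then show ?case using Suc by simp
  qed simp
  from this[of n] have "B ^ K * nsat sat cs (round_assignment sat q K B n cs \<psi>) \<le>
      potential sat K B cs \<psi> []"
    using potential_total[OF length_round_iter] by (simp add: round_assignment_def)
  then have "R ^ K * (B ^ K * nsat sat cs (round_assignment sat q K B n cs \<psi>)) \<le>
      R ^ K * potential sat K B cs \<psi> []"
    by (rule mult_left_mono) simp
  also note potential_Nil_le[OF assms(3,4), of sat]
  finally show ?thesis by (simp only: mult.assoc)
qed

end

lemma round_assignment_mem:
  assumes "q > 0"
  shows "length (round_assignment sat q K B n cs \<psi>) = n"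
    and "set (round_assignment sat q K B n cs \<psi>) \<subseteq> {..<q}"
  unfolding round_assignment_def
  by (rule length_round_iter, rule set_round_iter) (rule best_value_less[OF assms])

lemma finite_assignments: "finite (assignments q F)"
proof -
  have "assignments q F = {\<chi>. set \<chi> \<subseteq> {..<q} \<and> length \<chi> = nvars F}"
    by (auto simp: assignments_def)
  then show ?thesis by (simp add: finite_lists_length_eq)
qed

lemma Opt_le: "\<chi> \<in> assignments q F \<Longrightarrow> Opt \<Lambda> q F \<le> Val \<Lambda> F \<chi>"
  unfolding Opt_def by (intro Min_le finite_imageI finite_assignments) auto

locale csp_clauses = clauses +
  fixes \<Lambda> :: csp
  assumes wf: "\<And>c. c \<in> set cs \<Longrightarrow> wf_clause \<Lambda> n c"
    and ne: "cs \<noteq> []"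
begin

lemma clone_clauses_pos: "length (clone_clauses K B cs) > 0"
  using ne B_pos by (simp add: length_clone_clauses)

lemma wf_clone_clauses:
  assumes "c \<in> set (clone_clauses K B cs)"
  shows "wf_clause \<Lambda> (offset cs n) c"
proof -
  obtain e \<tau> where e: "e < length cs" and \<tau>: "\<tau> \<in> set (tuples K B)"
    and c: "c = (fst (cs ! e), map (\<lambda>(i, t). clone cs e i t) (zip (snd (cs ! e)) \<tau>))"
    using assms unfolding clone_clauses_eq by auto
  let ?S = "snd (cs ! e)"
  have len: "length ?S \<le> length \<tau>"
    using wf_arity[OF nth_mem[OF e]] \<tau> by (auto simp: set_n_lists)
  have w: "wf_clause \<Lambda> n (cs ! e)" by (rule wf[OF nth_mem[OF e]])
  \<comment> \<open>Clones of different variables lie in disjoint blocks, whatever the coordinates;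
    so scopes stay free of repetitions.\<close>
  have inj: "i = j" if "clone cs e i t = clone cs e j t'" "i \<in> set ?S" "j \<in> set ?S" for i j t t'
    using that(1) clone_eq_iff[OF e that(2), of "(deg (take e cs) j + t') mod deg cs j" j t]
      deg_pos[OF e that(3)] by (simp add: clone_def)
  have "distinct (map (\<lambda>(i, t). clone cs e i t) (zip ?S \<tau>))"
  proof (unfold distinct_conv_nth, intro allI impI)
    fix a b assume ab: "a < length (map (\<lambda>(i, t). clone cs e i t) (zip ?S \<tau>))"
      "b < length (map (\<lambda>(i, t). clone cs e i t) (zip ?S \<tau>))" "a \<noteq> b"
    then have "?S ! a \<noteq> ?S ! b"
      using w by (auto simp: wf_clause_def nth_eq_iff_index_eq)
    then show "map (\<lambda>(i, t). clone cs e i t) (zip ?S \<tau>) ! a \<noteq> map (\<lambda>(i,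
        t). clone cs e i t) (zip ?S \<tau>) ! b"
      using ab inj[of "?S ! a" "\<tau> ! a" "?S ! b" "\<tau> ! b"] by auto
  qed
  moreover have "set (map (\<lambda>(i, t). clone cs e i t) (zip ?S \<tau>)) \<subseteq> {..<offset cs n}"
    using clone_less[OF e] by (auto dest: set_zip_leftD)
  ultimately show ?thesis
    using w len by (simp add: c wf_clause_def)
qed

lemma reg_inst_mem: "reg_inst K B n cs \<in> unweighted_regular_instances \<Lambda>"
proof -
  have "degree_of (reg_inst K B n cs) p = B ^ K" if "p < offset cs n" for p
    using degree_clone_clauses[OF that]
    by (simp add: degree_of_def reg_inst_def filter_map comp_def)
  moreover have "(\<Sum>c\<leftarrow>constraints (reg_inst K B n cs). weight c) = 1"
    using clone_clauses_pos by (simp add: reg_inst_def comp_def sum_list_triv)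
  ultimately show ?thesis
    using wf_clone_clauses
    by (auto simp: unweighted_regular_instances_def weighted_instances_def unweighted_def
        regular_def
        reg_inst_def wf_clause_def wf_constraint_def)
qed

lemma Val_reg_inst:
  assumes "\<psi> \<in> assignments q (reg_inst K B n cs)"
  shows "Val \<Lambda> (reg_inst K B n cs) \<psi> =
    of_nat (nsat (\<lambda>c. c \<in> table \<Lambda> q) (clone_clauses K B cs) \<psi>) / of_nat (length (clone_clauses K B
        cs))"
  using assms Val_unweighted[OF wf_clone_clauses, where \<chi> = \<psi> and q = q]
  by (simp add: reg_inst_def assignments_def)

lemma lift_assignment_mem:
  assumes "length \<chi> = n" "set \<chi> \<subseteq> {..<q}"
  shows "lift_assignment cs n \<chi> \<in> assignments q (reg_inst K B n cs)"
proof -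
  have "\<chi> ! i \<in> {..<q}" if "i < n" for i using that assms by (metis nth_mem subsetD)
  then have "set (lift_assignment cs n \<chi>) \<subseteq> {..<q}"
    by (auto simp: lift_assignment_def split: if_splits)
  then show ?thesis by (simp add: assignments_def reg_inst_def length_lift_assignment)
qed

text \<open>The factor \<open>B ^ K\<close> from lifting \<open>\<chi>\<close> cancels against the
  one in \<open>nsat_round_assignment\<close>. The competitor \<open>\<chi>\<close> is arbitrary:
  later one optimum of the weighted instance is compared with trials at all scales, and it need not
  be optimal for any of the expanded clause lists.\<close>

lemma round_assignment_approx:
  assumes q: "q > 0" and R: "R > 0" "R * offset cs n \<le> B"
    and \<psi>: "\<psi> \<in> assignments q (reg_inst K B n cs)"
    and approx: "real_of_rat (Val \<Lambda> (reg_inst K B n cs) \<psi>) \<le> \<alpha> * real_of_rat (Opt \<Lambda> q (reg_inst K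
        B n cs))"
    and \<alpha>: "\<alpha> \<ge> 0" and \<chi>: "length \<chi> = n" "set \<chi> \<subseteq> {..<q}"
  defines "sat \<equiv> \<lambda>c. c \<in> table \<Lambda> q"
  shows "real (nsat sat cs (round_assignment sat q K B n cs \<psi>)) \<le> \<alpha> * (1 + 1 / R) ^ K * nsat sat
      cs \<chi>"
proof -
  let ?G = "reg_inst K B n cs" and ?M = "length (clone_clauses K B cs)"
  let ?c = "real (nsat sat cs (round_assignment sat q K B n cs \<psi>))"
  let ?g = "real (nsat sat (clone_clauses K B cs) \<psi>)"
  have "Opt \<Lambda> q ?G \<le> Val \<Lambda> ?G (lift_assignment cs n \<chi>)"
    by (rule Opt_le[OF lift_assignment_mem[OF \<chi>]])
  also have "\<dots> = of_nat (B ^ K * nsat sat cs \<chi>) / of_nat ?M"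
    unfolding Val_reg_inst[OF lift_assignment_mem[OF \<chi>]] sat_def nsat_lift_assignment[OF \<chi>(1)] ..
  finally have "real_of_rat (Opt \<Lambda> q ?G) \<le> real_of_rat (of_nat (B ^ K * nsat sat cs \<chi>) / of_nat ?M)"
    by (simp only: of_rat_less_eq)
  also have "\<dots> = real (B ^ K * nsat sat cs \<chi>) / ?M"
    by (simp only: of_rat_divide of_rat_of_nat_eq)
  finally have "\<alpha> * real_of_rat (Opt \<Lambda> q ?G) \<le> \<alpha> * (real (B ^ K * nsat sat cs \<chi>) / ?M)"
    using \<alpha> by (rule mult_left_mono)
  with approx have "real_of_rat (Val \<Lambda> ?G \<psi>) \<le> \<alpha> * (real (B ^ K * nsat sat cs \<chi>) / ?M)"
    by (rule order_trans)
  moreover have "real_of_rat (Val \<Lambda> ?G \<psi>) = ?g / ?M"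
    unfolding Val_reg_inst[OF \<psi>] sat_def by (simp only: of_rat_divide of_rat_of_nat_eq)
  ultimately have g: "?g \<le> \<alpha> * (real B ^ K * nsat sat cs \<chi>)"
    using clone_clauses_pos by (simp add: field_simps)
  have "R ^ K * B ^ K * nsat sat cs (round_assignment sat q K B n cs \<psi>)
      \<le> Suc R ^ K * nsat sat (clone_clauses K B cs) \<psi>"
    using \<psi> by (intro nsat_round_assignment q R) (auto simp: assignments_def reg_inst_def)
  then have "real (R ^ K * B ^ K * nsat sat cs (round_assignment sat q K B n cs \<psi>))
      \<le> real (Suc R ^ K * nsat sat (clone_clauses K B cs) \<psi>)"
    by (rule of_nat_mono)
  then have "real R ^ K * real B ^ K * ?c \<le> (real R + 1) ^ K * ?g"
    by (simp add: add.commute)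
  also have "\<dots> \<le> (real R + 1) ^ K * (\<alpha> * (real B ^ K * nsat sat cs \<chi>))"
    using g by (rule mult_left_mono) simp
  finally have "real R ^ K * real B ^ K * ?c \<le> real B ^ K * ((real R + 1) ^ K * \<alpha> * nsat sat cs \<chi>)"
    by (simp add: mult_ac)
  then have "real R ^ K * ?c \<le> (real R + 1) ^ K * \<alpha> * nsat sat cs \<chi>"
    using B_pos by (simp add: mult.assoc mult.left_commute[of "real R ^ K"])
  moreover have "(real R + 1) ^ K = real R ^ K * (1 + 1 / R) ^ K"
    using R(1) by (simp add: power_mult_distrib[symmetric] field_simps)
  ultimately have "real R ^ K * ?c \<le> real R ^ K * (\<alpha> * (1 + 1 / R) ^ K * nsat sat cs \<chi>)"
    by (simp add: mult_ac)
  then show ?thesis using R(1) by (simp add: mult_le_cancel_left_pos)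
qed

end

section \<open>Scaling and rounding the weights\<close>

text \<open>
  Here the most significant bit comes first, in contrast to \<open>bits\<close>.
\<close>

fun bval :: "bool list \<Rightarrow> nat" where
  "bval [] = 0"
| "bval (b # bs) = of_bool b * 2 ^ length bs + bval bs"

text \<open>One column of schoolbook subtraction: the state is the incoming borrow with the digits
  to the right, and the nested equations express the exclusive or of both digits and the
  borrow.\<close>

definition sub_step :: "bool \<times> bool \<Rightarrow> bool \<times> bool list \<Rightarrow> bool \<times> bool list" where
  "sub_step p s =
     ((if fst p then snd p \<and> fst s else snd p \<or> fst s), (fst p = (snd p = fst s)) # snd s)"

definition bsub :: "bool list \<Rightarrow> bool list \<Rightarrow> bool \<times> bool list" where
  "bsub xs ys = foldr sub_step (zip xs ys) (False, [])"

lemma bval_append: "bval (xs @ ys) = bval xs * 2 ^ length ys + bval ys"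
  by (induction xs) (auto simp: power_add algebra_simps)

lemma bval_replicate [simp]: "bval (replicate n False) = 0"
  by (induction n) auto

lemma bval_less: "bval xs < 2 ^ length xs"
  by (induction xs) auto

lemma bval_rev_bits [simp]: "bval (rev (bits n)) = n"
proof (induction n rule: less_induct)
  case (less n)
  then show ?case
    by (subst bits.simps) (auto simp: bval_append elim!: oddE)
qed

lemma bits_eq_Nil [simp]: "bits n = [] \<longleftrightarrow> n = 0"
  by (subst bits.simps) auto

lemma length_bsub: "length xs = length ys \<Longrightarrow> length (snd (bsub xs ys)) = length xs"
  by (induction xs ys rule: list_induct2) (auto simp: bsub_def sub_step_def)

text \<open>The borrow is accounted for as a missing \<open>2 ^ length xs\<close>, so that no
  truncated subtraction enters the induction.\<close>

lemma bval_bsub: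
  assumes "length xs = length ys"
  shows "bval xs + of_bool (fst (bsub xs ys)) * 2 ^ length xs = bval ys + bval (snd (bsub xs ys))"
  using assms
proof (induction xs ys rule: list_induct2)
  case (Cons x xs y ys)
  have "length (snd (bsub xs ys)) = length xs" using Cons length_bsub by simp
  then show ?case
    using Cons by (cases x; cases y; cases "fst (bsub xs ys)") (auto simp: bsub_def sub_step_def)
qed (simp add: bsub_def)

lemma bsub_borrow:
  assumes "length xs = length ys"
  shows "fst (bsub xs ys) \<longleftrightarrow> bval xs < bval ys"
    and "\<not> fst (bsub xs ys) \<Longrightarrow> bval (snd (bsub xs ys)) = bval xs - bval ys"
  using bval_bsub[OF assms] bval_less[of ys] bval_less[of "snd (bsub xs ys)"] length_bsub[OF
      assms] assms
  by (cases "fst (bsub xs ys)"; simp)+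

definition quot_step :: "bool list \<Rightarrow> bool list \<times> nat \<Rightarrow> bool list \<times> nat" where
  "quot_step ys s =
     (if fst (bsub (fst s) ys) then s else (snd (bsub (fst s) ys), Suc (snd s)))"

text \<open>Division by repeated subtraction may take exponentially many rounds for binary operands.
  Multiplicities are capped at \<open>C\<close>, so stopping after \<open>C\<close> rounds loses
  nothing.\<close>

definition quot :: "nat \<Rightarrow> bool list \<Rightarrow> bool list \<Rightarrow> nat" where
  "quot C xs ys = snd ((quot_step ys ^^ C) (xs, 0))"

lemma quot_step_invariant:
  assumes "length xs = length ys" "bval ys > 0"
  shows "length (fst ((quot_step ys ^^ k) (xs, 0))) = length ys \<and>
    snd ((quot_step ys ^^ k) (xs, 0)) = min k (bval xs div bval ys) \<and>
    bval (fst ((quot_step ys ^^ k) (xs, 0))) = bval xs - min k (bval xs div bval ys) * bval ys"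
proof (induction k)
  case 0
  then show ?case using assms by simp
next
  case (Suc k)
  define s where "s = (quot_step ys ^^ k) (xs, 0)"
  let ?d = "bval xs div bval ys"
  have IH: "length (fst s) = length ys" "snd s = min k ?d" "bval (fst s) =
      bval xs - min k ?d * bval ys"
    using Suc by (simp_all add: s_def)
  have step: "(quot_step ys ^^ Suc k) (xs, 0) = quot_step ys s" by (simp add: s_def)
  note b = bsub_borrow[OF IH(1)]
  show ?case
  proof (cases "k < ?d")
    case True
    then have "Suc k * bval ys \<le> bval xs"
      using assms(2) by (simp add: less_eq_div_iff_mult_less_eq Suc_le_eq[symmetric] del: mult_Suc)
    then have "\<not> fst (bsub (fst s) ys)" unfolding b(1) using True IH(3) by simp
    then show ?thesis
      using True IH b(2) length_bsub[OF IH(1)] unfolding step by (simp add: quot_step_def)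
  next
    case False
    then have "bval (fst s) = bval xs mod bval ys"
      using IH(3) by (simp add: minus_div_mult_eq_mod)
    then have "fst (bsub (fst s) ys)" unfolding b(1) using assms(2) by simp
    then show ?thesis
      using False IH unfolding step by (simp add: quot_step_def)
  qed
qed

lemma quot_eq:
  "length xs = length ys \<Longrightarrow> bval ys > 0 \<Longrightarrow> quot C xs ys = min C (bval xs div bval ys)"
  using quot_step_invariant by (simp add: quot_def)

definition num_bits :: "rat \<Rightarrow> bool list" where
  "num_bits w = bits (nat (fst (quotient_of w)))"

definition den_bits :: "rat \<Rightarrow> bool list" where
  "den_bits w = bits (nat (snd (quotient_of w)))"

text \<open>For a positive weight \<open>a / b\<close> the quotient is that of
  \<open>a * 2 ^ j\<close> by \<open>b\<close>: appending \<open>j\<close> zeros multiplies by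
  \<open>2 ^ j\<close>, and leading zeros give both operands the common length that
  \<open>bsub\<close> relies on.\<close>

definition copies :: "nat \<Rightarrow> nat \<Rightarrow> rat \<Rightarrow> nat" where
  "copies C j w = (if num_bits w = [] then 0 else
     min C (Suc (quot C
       (replicate (length (den_bits w)) False @ rev (num_bits w) @ replicate j False)
       (replicate (length (num_bits w) + j) False @ rev (den_bits w)))))"

lemma rat_num_den:
  assumes "w \<ge> 0"
  obtains a b :: nat where "b > 0" "real_of_rat w = real a / real b"
    "num_bits w = bits a" "den_bits w = bits b"
proof -
  obtain a b where ab: "quotient_of w = (a, b)" by (metis surj_pair)
  have b: "b > 0" using quotient_of_denom_pos[OF ab] .
  have w: "w = of_int a / of_int b" using quotient_of_div[OF ab] .
  then have a: "a \<ge> 0" using assms b by (auto simp: zero_le_divide_iff)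
  have "real_of_rat w = real_of_int a / real_of_int b"
    unfolding w by (simp add: of_rat_divide)
  then have "real_of_rat w = real (nat a) / real (nat b)" using a b by simp
  then show thesis using that[of "nat b" "nat a"] ab b by (simp add: num_bits_def den_bits_def)
qed

text \<open>Adding 1 before capping makes the multiplicity an upper bound of the scaled weight
  unless it is capped, at the price of overshooting by at most 1.\<close>

lemma copies_bounds:
  assumes "w \<ge> 0"
  shows "w = 0 \<Longrightarrow> copies C j w = 0"
    and "copies C j w \<le> C"
    and "real (copies C j w) \<le> 1 + real_of_rat w * 2 ^ j"
    and "copies C j w < C \<Longrightarrow> real_of_rat w * 2 ^ j \<le> real (copies C j w)"
    and "w > 0 \<Longrightarrow> C > 0 \<Longrightarrow> copies C j w > 0"
proof -
  obtain a b where b: "b > 0" and w: "real_of_rat w = real a / real b"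
    and bits: "num_bits w = bits a" "den_bits w = bits b"
    using rat_num_den[OF assms] .
  have w0: "w = 0 \<longleftrightarrow> a = 0"
    using w b by (metis divide_eq_0_iff of_nat_eq_0_iff of_rat_eq_0_iff less_numeral_extra(3))
  define k where "k = a * 2 ^ j div b"
  have m: "copies C j w = (if a = 0 then 0 else min C (Suc k))"
    by (simp add: copies_def bits quot_eq bval_append b k_def min_def)
  have k: "real k \<le> real_of_rat w * 2 ^ j" "real_of_rat w * 2 ^ j \<le> real k + 1"
  proof -
    have "real (a * 2 ^ j) = real (k * b + a * 2 ^ j mod b)" unfolding k_def by simp
    then have e: "real a * 2 ^ j = real k * real b + real (a * 2 ^ j mod b)" by simp
    have "real (a * 2 ^ j mod b) \<le> real b" using b by (simp add: less_imp_le)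
    with e b show "real k \<le> real_of_rat w * 2 ^ j" "real_of_rat w * 2 ^ j \<le> real k + 1"
      unfolding w by (auto simp: field_simps)
  qed
  show "w = 0 \<Longrightarrow> copies C j w = 0" "copies C j w \<le> C" "w > 0 \<Longrightarrow> C > 0 \<Longrightarrow> copies C j w > 0"
    using m w0 by auto
  show "real (copies C j w) \<le> 1 + real_of_rat w * 2 ^ j"
    using m k(1) assms by (auto simp: min_def)
  show "copies C j w < C \<Longrightarrow> real_of_rat w * 2 ^ j \<le> real (copies C j w)"
    using m k(2) w by (auto split: if_splits)
qed

text \<open>The numerator is at least 1, and the denominator is below 2 to the number of its digits.
  That number is small enough to serve as a unary exponent.\<close>

lemma inverse_le_weight:
  assumes "w > 0"
  shows "1 \<le> real_of_rat w * 2 ^ length (den_bits w)"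
proof -
  obtain a b where b: "b > 0" and w: "real_of_rat w = real a / real b"
    and bits: "num_bits w = bits a" "den_bits w = bits b"
    by (rule rat_num_den[OF less_imp_le[OF assms]])
  have "a > 0" using w b assms by (cases a) auto
  moreover have "b < 2 ^ length (bits b)" using bval_less[of "rev (bits b)"] by simp
  then have "real b \<le> 2 ^ length (bits b)"
    by (metis less_imp_le of_nat_le_iff of_nat_numeral of_nat_power)
  ultimately have "real b * 1 \<le> 2 ^ length (bits b) * real a"
    by (intro mult_mono) auto
  then show ?thesis using b by (simp add: w bits field_simps)
qed

section \<open>Clause lists with multiplicities instead of weights\<close>

definition expand :: "nat \<Rightarrow> nat \<Rightarrow> csp_inst \<Rightarrow> clause list" where
  "expand C j F = concat (map (\<lambda>c. replicate (copies C j (weight c)) (pred_idx c,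
      scope c)) (constraints F))"

definition accept :: "(clause \<Rightarrow> bool) \<Rightarrow> nat \<Rightarrow> nat \<Rightarrow> csp_inst \<Rightarrow> nat list \<Rightarrow> bool" where
  "accept sat C j F \<chi> \<longleftrightarrow> (\<forall>c\<in>set (constraints F). C \<le> copies C j (weight c) \<longrightarrow>
     \<not> sat (pred_idx c, map (\<lambda>i. nth_default 0 \<chi> i) (scope c)))"

text \<open>
  Large enough that \<open>2 ^ max_exp c0 F\<close> times any positive weight is at least \<open>2 ^ c0\<close> times the
  number of constraints.
\<close>

definition max_exp :: "nat \<Rightarrow> csp_inst \<Rightarrow> nat" where
  "max_exp c0 F = (\<Sum>c\<leftarrow>constraints F. length (den_bits (weight c)) + c0)"

lemma wf_expand:
  assumes "F \<in> weighted_instances \<Lambda>" "c \<in> set (expand C j F)"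
  shows "wf_clause \<Lambda> (nvars F) c"
proof -
  obtain d where "d \<in> set (constraints F)" "c = (pred_idx d, scope d)"
    using assms(2) by (auto simp: expand_def split: if_splits)
  with assms(1) show ?thesis
    by (simp add: weighted_instances_def wf_constraint_def wf_clause_def)
qed

text \<open>The weights sum to 1, so one of them is positive and its constraint keeps a copy;
  without any clause the weights of the unweighted instance could not sum to 1.\<close>

lemma expand_nonempty:
  assumes "F \<in> weighted_instances \<Lambda>" "C > 0"
  shows "expand C j F \<noteq> []"
proof -
  have nn: "\<forall>c\<in>set (constraints F). weight c \<ge> 0" and s: "(\<Sum>c\<leftarrow>constraints F. weight c) = 1"
    using assms(1) by (auto simp: weighted_instances_def)
  have "\<exists>c\<in>set (constraints F). weight c \<noteq> 0"
  proof (rule ccontr)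
    assume "\<not> ?thesis"
    then have "(\<Sum>c\<leftarrow>constraints F. weight c) = (\<Sum>c\<leftarrow>constraints F. 0)"
      by (intro arg_cong[where f = sum_list] map_cong) auto
    then show False using s by simp
  qed
  then obtain c where c: "c \<in> set (constraints F)" "weight c > 0" using nn by force
  then have "copies C j (weight c) > 0" using copies_bounds(5)[of "weight c" C j] assms(2) by simp
  then show ?thesis using c by (auto simp: expand_def)
qed

definition sat_at :: "csp \<Rightarrow> nat \<Rightarrow> nat list \<Rightarrow> wconstraint \<Rightarrow> bool" where
  "sat_at \<Lambda> q \<chi> c \<longleftrightarrow> (pred_idx c, map (\<lambda>i. \<chi> ! i) (scope c)) \<in> table \<Lambda> q"

context
  fixes \<Lambda> :: csp and F :: csp_inst and q :: nat
  assumes F: "F \<in> weighted_instances \<Lambda>"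
begin

abbreviation (input) sat :: "clause \<Rightarrow> bool" where
  "sat \<equiv> \<lambda>c. c \<in> table \<Lambda> q"

lemma nonneg: "c \<in> set (constraints F) \<Longrightarrow> weight c \<ge> 0"
  using F by (auto simp: weighted_instances_def)

lemma Val_sat_at:
  assumes "\<chi> \<in> assignments q F"
  shows "real_of_rat (Val \<Lambda> F \<chi>) = (\<Sum>c\<leftarrow>constraints F. real_of_rat (weight c) * of_bool (sat_at \<Lambda> q
      \<chi> c))"
proof -
  have "Val \<Lambda> F \<chi> = (\<Sum>c\<leftarrow>constraints F. weight c * of_bool (sat_at \<Lambda> q \<chi> c))"
    unfolding Val_def
  proof (intro arg_cong[where f = sum_list] map_cong refl)
    fix c assume "c \<in> set (constraints F)"
    then have "wf_clause \<Lambda> (nvars F) (pred_idx c, scope c)"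
      using F by (auto simp: weighted_instances_def wf_constraint_def wf_clause_def)
    from table_iff_holds[OF this, of \<chi> q] assms
    show "weight c * of_bool (holds (\<Lambda> ! pred_idx c) (map (\<lambda>i. \<chi> ! i) (scope c))) =
        weight c * of_bool (sat_at \<Lambda> q \<chi> c)"
      by (simp add: sat_at_def assignments_def)
  qed
  moreover have "real_of_rat (\<Sum>c\<leftarrow>cs. weight c * of_bool (sat_at \<Lambda> q \<chi> c)) =
      (\<Sum>c\<leftarrow>cs. real_of_rat (weight c) * of_bool (sat_at \<Lambda> q \<chi> c))" for cs
    by (induction cs) (auto simp: of_rat_add of_rat_mult)
  ultimately show ?thesis by simp
qed

lemma nsat_expand:
  "nsat sat (expand C j F) \<chi> = (\<Sum>c\<leftarrow>constraints F. copies C j (weight c) * of_bool (sat_at \<Lambda> q \<chi> c))"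
proof -
  have "nsat sat (concat (map (\<lambda>c. replicate (copies C j (weight c)) (pred_idx c, scope c)) cs)) \<chi> =
      (\<Sum>c\<leftarrow>cs. copies C j (weight c) * of_bool (sat_at \<Lambda> q \<chi> c))" for cs
    by (induction cs) (auto simp: nsat_def sat_at_def filter_replicate)
  then show ?thesis by (simp add: expand_def)
qed

lemma accept_iff:
  assumes "\<chi> \<in> assignments q F"
  shows "accept sat C j F \<chi> \<longleftrightarrow> (\<forall>c\<in>set (constraints F). C \<le> copies C j (weight c) \<longrightarrow>
      \<not> sat_at \<Lambda> q \<chi> c)"
proof -
  have "map (\<lambda>i. nth_default 0 \<chi> i) (scope c) = map (\<lambda>i. \<chi> ! i) (scope c)" if
      "c \<in> set (constraints F)" for c
    using that assms F by (auto simp: assignments_def weighted_instances_def wf_constraint_def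
        nth_default_def)
  then have "(pred_idx c, map (\<lambda>i. nth_default 0 \<chi> i) (scope c)) = (pred_idx c,
      map (\<lambda>i. \<chi> ! i) (scope c))"
    if "c \<in> set (constraints F)" for c using that by metis
  then show ?thesis unfolding accept_def sat_at_def by (metis (no_types, lifting))
qed

text \<open>Rounding up adds at most one copy per constraint, which gives the additive term; capping
  only lowers the count.\<close>

lemma nsat_expand_le:
  assumes "\<chi> \<in> assignments q F"
  shows "real (nsat sat (expand C j F) \<chi>) \<le> length (constraints F) + 2 ^ j * real_of_rat (Val \<Lambda> F
      \<chi>)"
proof -
  have "real (nsat sat (expand C j F) \<chi>) =
      (\<Sum>c\<leftarrow>constraints F. real (copies C j (weight c)) * of_bool (sat_at \<Lambda> q \<chi> c))"
    unfolding nsat_expand by (simp add: sum_list_of_nat[symmetric] comp_def)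
  also have "\<dots> \<le> (\<Sum>c\<leftarrow>constraints F. 1 + 2 ^ j * (real_of_rat (weight c) * of_bool (sat_at \<Lambda> q \<chi>
      c)))"
    using copies_bounds(3)[OF nonneg] by (intro sum_list_mono) (auto simp: mult.commute)
  also have "\<dots> = length (constraints F) + 2 ^ j * real_of_rat (Val \<Lambda> F \<chi>)"
    by (simp add: Val_sat_at[OF assms] sum_list_addf sum_list_const_mult sum_list_triv)
  finally show ?thesis .
qed

text \<open>An assignment of value 0 satisfies only constraints of weight 0, and these have no
  copies. A positive count would ruin the multiplicative guarantee at optimum 0.\<close>

lemma nsat_expand_eq_0:
  assumes "\<chi> \<in> assignments q F" "real_of_rat (Val \<Lambda> F \<chi>) = 0"
  shows "nsat sat (expand C j F) \<chi> = 0"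
proof -
  have "\<forall>x\<in>set (map (\<lambda>c. real_of_rat (weight c) * of_bool (sat_at \<Lambda> q \<chi> c)) (constraints F)). x = 0"
    using assms(2) nonneg unfolding Val_sat_at[OF assms(1)]
    by (subst (asm) sum_list_nonneg_eq_0_iff) auto
  then show ?thesis unfolding nsat_expand using copies_bounds(1)[OF nonneg] by auto
qed

text \<open>For an accepted assignment all satisfied constraints are uncapped, and there the
  multiplicity dominates the scaled weight.\<close>

lemma Val_le_nsat_expand:
  assumes "\<chi> \<in> assignments q F" "accept sat C j F \<chi>"
  shows "2 ^ j * real_of_rat (Val \<Lambda> F \<chi>) \<le> real (nsat sat (expand C j F) \<chi>)"
proof -
  have "2 ^ j * real_of_rat (Val \<Lambda> F \<chi>) =
      (\<Sum>c\<leftarrow>constraints F. 2 ^ j * (real_of_rat (weight c) * of_bool (sat_at \<Lambda> q \<chi> c)))"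
    by (simp add: Val_sat_at[OF assms(1)] sum_list_const_mult)
  also have "\<dots> \<le> (\<Sum>c\<leftarrow>constraints F. real (copies C j (weight c)) * of_bool (sat_at \<Lambda> q \<chi> c))"
  proof (rule sum_list_mono)
    fix c assume c: "c \<in> set (constraints F)"
    then have "sat_at \<Lambda> q \<chi> c \<Longrightarrow> copies C j (weight c) < C" using assms accept_iff by (meson not_le)
    then show "2 ^ j * (real_of_rat (weight c) * of_bool (sat_at \<Lambda> q \<chi> c)) \<le>
        real (copies C j (weight c)) * of_bool (sat_at \<Lambda> q \<chi> c)"
      using copies_bounds(4)[OF nonneg[OF c], of C j] by (auto simp: mult.commute)
  qed
  also have "\<dots> = real (nsat sat (expand C j F) \<chi>)"
    unfolding nsat_expand by (simp add: sum_list_of_nat[symmetric] comp_def)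
  finally show ?thesis .
qed

text \<open>A single satisfied constraint at the cap would already contribute \<open>C\<close>
  copies.\<close>

lemma acceptI:
  assumes "\<chi> \<in> assignments q F" "nsat sat (expand C j F) \<chi> < C"
  shows "accept sat C j F \<chi>"
proof -
  have "copies C j (weight c) \<le> nsat sat (expand C j F) \<chi>" if "c \<in> set (constraints F)"
      "sat_at \<Lambda> q \<chi> c" for c
  proof -
    have "copies C j (weight c) * of_bool (sat_at \<Lambda> q \<chi> c) \<le> nsat sat (expand C j F) \<chi>"
      unfolding nsat_expand using that(1) by (intro member_le_sum_list) auto
    then show ?thesis using that by simp
  qed
  with assms show ?thesis by (auto simp: accept_iff[OF assms(1)]) (meson leD order_trans)
qed

lemma Val_le_1:
  assumes "\<chi> \<in> assignments q F"
  shows "real_of_rat (Val \<Lambda> F \<chi>) \<le> 1"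
proof -
  have sum: "(\<Sum>c\<leftarrow>cs. real_of_rat (weight c)) = real_of_rat (\<Sum>c\<leftarrow>cs. weight c)" for cs
    by (induction cs) (auto simp: of_rat_add)
  have "(\<Sum>c\<leftarrow>constraints F. real_of_rat (weight c) * of_bool (sat_at \<Lambda> q \<chi> c)) \<le>
      (\<Sum>c\<leftarrow>constraints F. real_of_rat (weight c))"
    using nonneg by (intro sum_list_mono) auto
  also have "\<dots> = real_of_rat (\<Sum>c\<leftarrow>constraints F. weight c)"
    using sum[of "constraints F"] by simp
  also have "\<dots> = 1" using F by (simp add: weighted_instances_def)
  finally show ?thesis by (simp add: Val_sat_at[OF assms])
qed

lemma Val_ge:
  assumes "\<chi> \<in> assignments q F" "real_of_rat (Val \<Lambda> F \<chi>) \<noteq> 0" "c0 > 0"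
  shows "2 ^ c0 * real (length (constraints F)) \<le> 2 ^ max_exp c0 F * real_of_rat (Val \<Lambda> F \<chi>)"
proof -
  let ?V = "real_of_rat (Val \<Lambda> F \<chi>)" and ?m = "length (constraints F)"
  have "\<exists>c\<in>set (constraints F). weight c \<noteq> 0 \<and> sat_at \<Lambda> q \<chi> c"
  proof (rule ccontr)
    assume "\<not> ?thesis"
    then have "?V = (\<Sum>c\<leftarrow>constraints F. 0)"
      unfolding Val_sat_at[OF assms(1)] by (intro arg_cong[where f = sum_list] map_cong) auto
    then show False using assms(2) by simp
  qed
  then obtain c where c: "c \<in> set (constraints F)" "weight c > 0" "sat_at \<Lambda> q \<chi> c" using nonneg
      by force
  have "real_of_rat (weight c) * of_bool (sat_at \<Lambda> q \<chi> c) \<le> ?V"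
  proof -
    obtain xs ys where "constraints F = xs @ c # ys" using split_list[OF c(1)] by blast
    then show ?thesis
      unfolding Val_sat_at[OF assms(1)] using nonneg by (auto intro!: add_nonneg_nonneg
          sum_list_nonneg)
  qed
  then have V: "real_of_rat (weight c) \<le> ?V" using c by simp
  let ?l = "length (den_bits (weight c))"
  have "length (den_bits (weight c)) \<le> (\<Sum>c\<leftarrow>constraints F. length (den_bits (weight c)))"
    using c(1) by (intro member_le_sum_list) auto
  then have J: "?l + ?m * c0 \<le> max_exp c0 F"
    by (simp add: max_exp_def sum_list_addf sum_list_triv)
  have m: "?m > 0" using c(1) by (cases "constraints F") auto
  \<comment> \<open>The part \<open>?m * c0\<close> of the exponent leaves room for
    \<open>c0\<close> and for \<open>?m - 1\<close>, and \<open>2 ^ (?m - 1)\<close> absorbs the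
    number of constraints.\<close>
  have "c0 + (?m - 1) \<le> c0 + (?m - 1) * c0" using assms(3) by simp
  also have "\<dots> = ?m * c0" using m by (cases ?m) auto
  finally have e: "c0 + (?m - 1) \<le> ?m * c0" .
  have "?m \<le> 2 ^ (?m - 1)" using less_exp[of "?m - 1"] m by linarith
  then have "real ?m \<le> 2 ^ (?m - 1)" by (metis of_nat_le_iff of_nat_numeral of_nat_power)
  then have "2 ^ c0 * real ?m \<le> 2 ^ (c0 + (?m - 1)) * 1" by (simp add: power_add)
  also have "\<dots> \<le> 2 ^ (?m * c0) * (real_of_rat (weight c) * 2 ^ ?l)"
    using e inverse_le_weight[OF c(2)] by (intro mult_mono power_increasing) auto
  also have "\<dots> = 2 ^ (?l + ?m * c0) * real_of_rat (weight c)"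
    by (simp add: power_add mult_ac)
  also have "\<dots> \<le> 2 ^ max_exp c0 F * ?V"
    using J V c(2) by (intro mult_mono power_increasing) auto
  finally show ?thesis .
qed

end

section \<open>Running time of the ingredients\<close>

abbreviation enc_clause :: "clause \<Rightarrow> tree" where
  "enc_clause \<equiv> enc_pair enc_unary (enc_list_of enc_unary)"

lemma polytime_of_bool [polytime_rules]: "polytime_on D E enc_bool f \<Longrightarrow> polytime_on D E enc_unary
    (\<lambda>a. of_bool (f a))"
  by (rule polytime_cong[of D E enc_bool f]) (simp_all add: enc_bool_def)

lemma polytime_nth_list [polytime_rules]:
  "polytime_on D E (enc_list_of (enc_list_of e)) f \<Longrightarrow> polytime_on D E enc_unary n \<Longrightarrow>
     polytime_on D E (enc_list_of e) (\<lambda>a. nth_default [] (f a) (n a))"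
  by (rule polytime_nth_default) auto

lemma inj_enc_list_of: "inj e \<Longrightarrow> inj (enc_list_of e)"
  unfolding enc_list_of_def by (intro injI) (simp add: inj_map_eq_map)

lemma inj_enc_clause: "inj enc_clause"
proof -
  have "inj enc_unary" by (simp add: inj_def)
  moreover have "inj (enc_list_of enc_unary)" by (rule inj_enc_list_of) fact
  ultimately show ?thesis by (auto simp: inj_def enc_pair_def prod_eq_iff)
qed

lemma polytime_table [polytime_rules]: "polytime_on D E enc_clause f \<Longrightarrow>
    polytime_on D E enc_bool (\<lambda>a. f a \<in> table \<Lambda> q)"
  by (rule polytime_mem_finite[OF finite_table inj_enc_clause])

lemma polytime_nvars [polytime_rules]: "polytime_on D E enc_inst f \<Longrightarrow> polytime_on D E enc_unary
    (\<lambda>a. nvars (f a))"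
  by (rule polytime_left[of D E enc_inst f]) (auto simp: enc_inst_def)

lemma polytime_constraints [polytime_rules]:
  "polytime_on D E enc_inst f \<Longrightarrow> polytime_on D E (enc_list_of enc_constraint) (\<lambda>a. constraints (f
      a))"
  by (rule polytime_right[of D E enc_inst f]) (auto simp: enc_inst_def enc_list_of_def)

lemma polytime_weight [polytime_rules]: "polytime_on D E enc_constraint f \<Longrightarrow>
    polytime_on D E enc_weight (\<lambda>a. weight (f a))"
  by (rule polytime_left[of D E enc_constraint f]) (auto simp: enc_constraint_def)

lemma polytime_clause_of_constraint [polytime_rules]:
  "polytime_on D E enc_constraint f \<Longrightarrow> polytime_on D E enc_clause (\<lambda>a. (pred_idx (f a),
      scope (f a)))"
  by (rule polytime_right[of D E enc_constraint f]) (auto simp: enc_constraint_def enc_list_of_def)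

lemma polytime_pred_idx [polytime_rules]: "polytime_on D E enc_constraint f \<Longrightarrow>
    polytime_on D E enc_unary (\<lambda>a. pred_idx (f a))"
  using polytime_fst[OF polytime_clause_of_constraint[of D E f]] by simp

lemma polytime_scope [polytime_rules]: "polytime_on D E enc_constraint f \<Longrightarrow>
    polytime_on D E (enc_list_of enc_unary) (\<lambda>a. scope (f a))"
  using polytime_snd[OF polytime_clause_of_constraint[of D E f]] by simp

lemma polytime_num_bits [polytime_rules]: "polytime_on D E enc_weight f \<Longrightarrow>
    polytime_on D E (enc_list_of enc_bool) (\<lambda>a. num_bits (f a))"
  by (rule polytime_left[of D E enc_weight f])
    (auto simp: enc_weight_def num_bits_def enc_binary_bits split: prod.split)

lemma polytime_den_bits [polytime_rules]: "polytime_on D E enc_weight f \<Longrightarrow>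
    polytime_on D E (enc_list_of enc_bool) (\<lambda>a. den_bits (f a))"
  by (rule polytime_right[of D E enc_weight f])
    (auto simp: enc_weight_def den_bits_def enc_binary_bits split: prod.split)

lemma polytime_deg [polytime_rules]:
  assumes "polytime_on D E (enc_list_of enc_clause) cs" "polytime_on D E enc_unary i"
  shows "polytime_on D E enc_unary (\<lambda>a. deg (cs a) (i a))"
proof -
  have "polytime_on UNIV (enc_pair (enc_list_of enc_clause) enc_unary) enc_unary (\<lambda>p. deg (fst p)
      (snd p))"
    unfolding deg_def by (rule polytime_rules)+
  from polytime_binop[OF this assms] show ?thesis .
qed

lemma polytime_offset [polytime_rules]:
  assumes "polytime_on D E (enc_list_of enc_clause) cs" "polytime_on D E enc_unary i"
  shows "polytime_on D E enc_unary (\<lambda>a. offset (cs a) (i a))"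
proof -
  have "polytime_on UNIV (enc_pair (enc_list_of enc_clause) enc_unary) enc_unary (\<lambda>p. offset (fst
      p) (snd p))"
    unfolding offset_def by (rule polytime_rules)+
  from polytime_binop[OF this assms] show ?thesis .
qed

lemma polytime_clone [polytime_rules]:
  assumes "polytime_on D E (enc_list_of enc_clause) cs" "polytime_on D E enc_unary e"
      "polytime_on D E enc_unary i" "polytime_on D E enc_unary t"
  shows "polytime_on D E enc_unary (\<lambda>a. clone (cs a) (e a) (i a) (t a))"
  unfolding clone_def by (rule assms polytime_rules)+

lemma polytime_clone_clauses [polytime_rules]:
  assumes "polytime_on D E enc_unary B" "polytime_on D E (enc_list_of enc_clause) cs"
  shows "polytime_on D E (enc_list_of enc_clause) (\<lambda>a. clone_clauses K (B a) (cs a))"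
proof -
  have "polytime_on UNIV (enc_pair enc_unary (enc_list_of enc_clause)) (enc_list_of enc_clause)
      (\<lambda>p. clone_clauses K (fst p) (snd p))"
    unfolding clone_clauses_def case_prod_unfold by (rule polytime_rules)+
  from polytime_binop[OF this assms] show ?thesis .
qed

text \<open>\<open>1 / M\<close> is already in lowest terms, so the weight is encoded by the digits
  of 1 and of \<open>M\<close>, and \<open>M\<close> is available in unary as a length.\<close>

lemma enc_unit_fraction: "M > 0 \<Longrightarrow> enc_weight (1 / of_nat M) = Node (enc_list_of enc_bool (bits 1))
    (enc_list_of enc_bool (bits M))"
proof -
  assume "M > 0"
  then have "quotient_of (1 / of_nat M) = (1, int M)"
    using quotient_of_Fract[of 1 "int M"] by (simp add: Fract_of_int_quotient normalize_def)
  then show ?thesis by (simp add: enc_weight_def enc_binary_bits)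
qed

lemma polytime_reg_inst [polytime_rules]:
  assumes "polytime_on D E enc_unary B" "polytime_on D E enc_unary n"
      "polytime_on D E (enc_list_of enc_clause) cs"
  shows "polytime_on D E enc_inst (\<lambda>a. reg_inst K (B a) (n a) (cs a))"
proof -
  let ?E = "enc_pair enc_unary (enc_pair enc_unary (enc_list_of enc_clause))"
  let ?cc = "\<lambda>p. clone_clauses K (fst p) (snd (snd p))"
  have cs: "polytime_on UNIV ?E (enc_list_of enc_constraint)
    (\<lambda>p. map (\<lambda>c. Constraint (1 / of_nat (length (?cc p))) (fst c) (snd c)) (?cc p))"
  proof (rule polytime_map)
    show "polytime_on UNIV ?E (enc_list_of enc_clause) ?cc" by (rule polytime_rules)+
    show "polytime_on {(a, x). a \<in> UNIV \<and> x \<in> set (?cc a)} (enc_pair ?E enc_clause) enc_constraint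
       (\<lambda>p. Constraint (1 / of_nat (length (?cc (fst p)))) (fst (snd p)) (snd (snd p)))"
    proof (rule polytime_cong)
      show "polytime_on {(a, x). a \<in> UNIV \<and> x \<in> set (?cc a)} (enc_pair ?E enc_clause) (enc_pair
          (enc_pair (enc_list_of enc_bool) (enc_list_of enc_bool)) enc_clause)
         (\<lambda>p. ((bits 1, bits (length (?cc (fst p)))), snd p))"
        by (rule polytime_rules)+
      fix p assume "p \<in> {(a, x). a \<in> UNIV \<and> x \<in> set (?cc a)}"
      then have "length (?cc (fst p)) > 0" by (cases p) (auto simp: length_pos_if_in_set)
      then show "enc_pair (enc_pair (enc_list_of enc_bool) (enc_list_of enc_bool)) enc_clause
          ((bits 1, bits (length (?cc (fst p)))), snd p) =
          enc_constraint (Constraint (1 / of_nat (length (?cc (fst p)))) (fst (snd p)) (snd (snd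
              p)))"
        by (simp add: enc_constraint_def enc_unit_fraction enc_pair_def enc_list_of_def)
    qed
  qed
  have n: "polytime_on UNIV ?E enc_unary (\<lambda>p. offset (snd (snd p)) (fst (snd p)))"
    by (rule polytime_rules)+
  have "polytime_on UNIV ?E enc_inst (\<lambda>p. reg_inst K (fst p) (fst (snd p)) (snd (snd p)))"
    by (rule polytime_Node[OF n cs]) (simp add: reg_inst_def enc_inst_def enc_list_of_def)
  from polytime_comp[OF polytime_Pair[OF assms(1) polytime_Pair[OF assms(2,3)]] this] show ?thesis
      by simp
qed

lemma polytime_entry [polytime_rules]:
  assumes "polytime_on D E (enc_list_of enc_clause) cs" "polytime_on D E (enc_list_of enc_unary)
      \<psi>" "polytime_on D E (enc_list_of enc_unary) s"
    "polytime_on D E enc_unary i" "polytime_on D E enc_unary t"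
  shows "polytime_on D E enc_unary (\<lambda>a. entry (cs a) (\<psi> a) (s a) (i a) (t a))"
  unfolding entry_def by (rule assms polytime_rules)+

lemma polytime_potential [polytime_rules]:
  assumes "polytime_on D E enc_unary B" "polytime_on D E (enc_list_of enc_clause) cs"
      "polytime_on D E (enc_list_of enc_unary) \<psi>"
    "polytime_on D E (enc_list_of enc_unary) s"
  shows "polytime_on D E enc_unary (\<lambda>a. potential (\<lambda>c. c \<in> table \<Lambda> q) K (B a) (cs a) (\<psi> a) (s a))"
proof -
  have "polytime_on UNIV (enc_pair enc_unary (enc_pair (enc_list_of enc_clause) (enc_pair
      (enc_list_of enc_unary) (enc_list_of enc_unary)))) enc_unary
    (\<lambda>p. potential (\<lambda>c. c \<in> table \<Lambda> q) K (fst p) (fst (snd p)) (fst (snd (snd p))) (snd (snd (snd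
        p))))"
    unfolding potential_def case_prod_unfold by (rule polytime_rules)+
  from polytime_comp[OF polytime_Pair[OF assms(1) polytime_Pair[OF assms(2) polytime_Pair[OF
      assms(3,4)]]] this]
  show ?thesis by simp
qed

lemma polytime_best_value [polytime_rules]:
  assumes "polytime_on D E enc_unary B" "polytime_on D E (enc_list_of enc_clause) cs"
      "polytime_on D E (enc_list_of enc_unary) \<psi>"
    "polytime_on D E (enc_list_of enc_unary) s"
  shows "polytime_on D E enc_unary (\<lambda>a. best_value (\<lambda>c. c \<in> table \<Lambda> q) q K (B a) (cs a) (\<psi> a) (s
      a))"
proof -
  let ?E = "enc_pair enc_unary (enc_pair (enc_list_of enc_clause) (enc_pair
      (enc_list_of enc_unary) (enc_list_of enc_unary)))"
  let ?pot = "\<lambda>p v. potential (\<lambda>c. c \<in> table \<Lambda> q) K (fst p) (fst (snd p)) (fst (snd (snd p))) (snd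
      (snd (snd p)) @ [v])"
  have "polytime_on UNIV ?E enc_unary (\<lambda>p. foldr (\<lambda>v b. if ?pot p v < ?pot p b then v else b)
      [0..<q] 0)"
  proof (rule polytime_foldr[where D' = UNIV and f = "\<lambda>p v b. if ?pot p v < ?pot p b then v else
      b"])
    show "poly_bounded UNIV ?E (\<lambda>_. q)" by (rule poly_bounded_const)
    show "size (enc_unary (foldr (\<lambda>v b. if ?pot p v < ?pot p b then v else b) us 0)) \<le> q"
      if "[0..<q] = ps @ us" for p ps us
    proof -
      have "set us \<subseteq> set [0..<q]" unfolding that by simp
      then show ?thesis
        using foldr_choice_mem[of "\<lambda>v b. ?pot p v < ?pot p b" us 0] by auto
    qed
  qed (rule polytime_rules UNIV_I)+
  then have "polytime_on UNIV ?E enc_unary (\<lambda>p. best_value (\<lambda>c. c \<in> table \<Lambda> q) q K (fst p) (fst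
      (snd p)) (fst (snd (snd p))) (snd (snd (snd p))))"
    unfolding best_value_def .
  from polytime_comp[OF polytime_Pair[OF assms(1) polytime_Pair[OF assms(2) polytime_Pair[OF
      assms(3,4)]]] this]
  show ?thesis by simp
qed

lemma size_enc_list_of_unary_le:
  "set xs \<subseteq> {..<q} \<Longrightarrow> size (enc_list_of enc_unary xs) \<le> length xs * Suc q"
  by (rule size_enc_list_of_le) auto

lemma polytime_round_assignment [polytime_rules]:
  assumes "q > 0" "polytime_on D E enc_unary B" "polytime_on D E enc_unary n"
      "polytime_on D E (enc_list_of enc_clause) cs" "polytime_on D E (enc_list_of enc_unary) \<psi>"
  shows "polytime_on D E (enc_list_of enc_unary) (\<lambda>a. round_assignment (\<lambda>c. c \<in> table \<Lambda> q) q K (B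
      a) (n a) (cs a) (\<psi> a))"
proof -
  let ?E = "enc_pair enc_unary (enc_pair enc_unary (enc_pair (enc_list_of enc_clause)
      (enc_list_of enc_unary)))"
  let ?best = "\<lambda>p s. best_value (\<lambda>c. c \<in> table \<Lambda> q) q K (fst p) (fst (snd (snd p))) (snd (snd (snd
      p))) s"
  have "polytime_on UNIV ?E (enc_list_of enc_unary) (\<lambda>p. ((\<lambda>s. s @ [?best p s]) ^^ fst (snd p)) [])"
  proof (rule polytime_funpow[where D' = UNIV and f = "\<lambda>p s. s @ [?best p s]"])
    show "poly_bounded UNIV ?E (\<lambda>p. size (?E p) * Suc q)" by (intro poly_bounded_mult
        poly_bounded_size poly_bounded_const)
    show "size (enc_list_of enc_unary (((\<lambda>s. s @ [?best p s]) ^^ k) [])) \<le> size (?E p) * Suc q"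
      if k: "k \<le> fst (snd p)" for p k
    proof -
      have "size (enc_list_of enc_unary (((\<lambda>s. s @ [?best p s]) ^^ k) [])) \<le> k * Suc q"
        using size_enc_list_of_unary_le[OF set_round_iter[OF best_value_less[OF assms(1)]]]
        unfolding length_round_iter .
      also have "\<dots> \<le> size (?E p) * Suc q" using k by (intro mult_right_mono) (auto simp:
          enc_pair_def)
      finally show ?thesis .
    qed
  qed (rule polytime_rules UNIV_I)+
  then have "polytime_on UNIV ?E (enc_list_of enc_unary) (\<lambda>p. round_assignment (\<lambda>c. c \<in> table \<Lambda> q)
      q K (fst p) (fst (snd p)) (fst (snd (snd p))) (snd (snd (snd p))))"
    unfolding round_assignment_def .
  from polytime_comp[OF polytime_Pair[OF assms(2) polytime_Pair[OF assms(3) polytime_Pair[OF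
      assms(4,5)]]] this]
  show ?thesis by simp
qed

lemma size_enc_bool: "size (enc_bool b) \<le> 1"
  by (cases b) auto

lemma size_enc_list_of_enc_bool: "size (enc_list_of enc_bool xs) \<le> length xs * 2"
  using size_enc_list_of_le[of xs enc_bool 1] size_enc_bool by simp

lemma polytime_bsub [polytime_rules]:
  assumes "polytime_on D E (enc_list_of enc_bool) xs" "polytime_on D E (enc_list_of enc_bool) ys"
  shows "polytime_on D E (enc_pair enc_bool (enc_list_of enc_bool)) (\<lambda>a. bsub (xs a) (ys a))"
proof -
  let ?E = "enc_pair (enc_list_of enc_bool) (enc_list_of enc_bool)"
  have "polytime_on UNIV ?E (enc_pair enc_bool (enc_list_of enc_bool)) (\<lambda>p. foldr sub_step (zip
      (fst p) (snd p)) (False, []))"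
  proof (rule polytime_foldr[where D' = UNIV and f = "\<lambda>_. sub_step"])
    show "polytime_on UNIV (enc_pair ?E (enc_pair (enc_pair enc_bool enc_bool) (enc_pair enc_bool
        (enc_list_of enc_bool)))) (enc_pair enc_bool (enc_list_of enc_bool))
        (\<lambda>p. sub_step (fst (snd p)) (snd (snd p)))"
      unfolding sub_step_def by (rule polytime_rules)+
    show "poly_bounded UNIV ?E (\<lambda>p. size (?E p) * 2 + 2)" by (intro poly_bounded_add
        poly_bounded_mult poly_bounded_size poly_bounded_const)
    show "size (enc_pair enc_bool (enc_list_of enc_bool) (foldr sub_step us (False, []))) \<le>
        size (?E p) * 2 + 2"
      if "zip (fst p) (snd p) = ps @ us" for p ps us
    proof -
      have "length (snd (foldr sub_step us (False, []))) = length us"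
        by (induction us) (auto simp: sub_step_def)
      moreover have "length us \<le> length (fst p)" using arg_cong[OF that, of length] by simp
      moreover have "length (fst p) \<le> size (?E p)"
        using length_le_size_enc_list_of[of "fst p" enc_bool] by (simp add: enc_pair_def)
      ultimately show ?thesis
        using size_enc_list_of_enc_bool[of "snd (foldr sub_step us (False, []))"]
          size_enc_bool[of "fst (foldr sub_step us (False, []))"] by (simp add: enc_pair_def)
    qed
  qed (rule polytime_rules UNIV_I)+
  then have "polytime_on UNIV ?E (enc_pair enc_bool (enc_list_of enc_bool)) (\<lambda>p. bsub (fst p) (snd
      p))"
    unfolding bsub_def .
  from polytime_binop[OF this assms] show ?thesis .
qed

lemma polytime_quot [polytime_rules]:
  assumes "polytime_on D E enc_unary C" "polytime_on D E (enc_list_of enc_bool) xs"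
      "polytime_on D E (enc_list_of enc_bool) ys"
  shows "polytime_on D E enc_unary (\<lambda>a. quot (C a) (xs a) (ys a))"
proof -
  let ?E = "enc_pair enc_unary (enc_pair (enc_list_of enc_bool) (enc_list_of enc_bool))"
  have "polytime_on UNIV ?E (enc_pair (enc_list_of enc_bool) enc_unary)
      (\<lambda>p. (quot_step (snd (snd p)) ^^ fst p) (fst (snd p), 0))"
  proof (rule polytime_funpow[where D' = UNIV and f = "\<lambda>p. quot_step (snd (snd p))"])
    show "polytime_on UNIV (enc_pair ?E (enc_pair (enc_list_of enc_bool) enc_unary)) (enc_pair
        (enc_list_of enc_bool) enc_unary)
        (\<lambda>p. quot_step (snd (snd (fst p))) (snd p))"
      unfolding quot_step_def by (rule polytime_rules)+
    show "poly_bounded UNIV ?E (\<lambda>p. size (?E p) * 2 + size (?E p) + 1)" by (intro poly_bounded_add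
        poly_bounded_mult poly_bounded_size poly_bounded_const)
    show "size (enc_pair (enc_list_of enc_bool) enc_unary ((quot_step (snd (snd p)) ^^ k) (fst
        (snd p), 0))) \<le>
        size (?E p) * 2 + size (?E p) + 1" if k: "k \<le> fst p" for p k
    proof -
      have len: "length (snd (bsub us vs)) \<le> length us" for us vs
      proof -
        have "length (snd (foldr sub_step zs (False, []))) = length zs" for zs
          by (induction zs) (auto simp: sub_step_def)
        then show ?thesis by (simp add: bsub_def)
      qed
      \<comment> \<open>Subtraction never lengthens the digit list, so the digits stay within the
        size of the input; the counter is bounded by the number of rounds.\<close>
      have "length (fst ((quot_step ys ^^ k) (us, 0))) \<le> length us \<and> snd ((quot_step ys ^^ k) (us,
          0)) \<le> k" for ys us
        by (induction k) (auto simp: quot_step_def intro: order_trans[OF len])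
      from this[of "snd (snd p)" "fst (snd p)"] show ?thesis
        using k size_enc_list_of_enc_bool[of "fst ((quot_step (snd (snd p)) ^^ k) (fst (snd p),
            0))"]
          length_le_size_enc_list_of[of "fst (snd p)" enc_bool]
        by (simp add: enc_pair_def)
    qed
  qed (rule polytime_rules UNIV_I)+
  from polytime_snd[OF this] have "polytime_on UNIV ?E enc_unary (\<lambda>p. quot (fst p) (fst (snd p))
      (snd (snd p)))"
    unfolding quot_def .
  from polytime_comp[OF polytime_Pair[OF assms(1) polytime_Pair[OF assms(2,3)]] this] show ?thesis
      by simp
qed

lemma polytime_copies [polytime_rules]:
  assumes "polytime_on D E enc_unary C" "polytime_on D E enc_unary j" "polytime_on D E enc_weight w"
  shows "polytime_on D E enc_unary (\<lambda>a. copies (C a) (j a) (w a))"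
  unfolding copies_def by (rule assms polytime_rules)+

lemma polytime_expand [polytime_rules]:
  assumes "polytime_on D E enc_unary C" "polytime_on D E enc_unary j" "polytime_on D E enc_inst F"
  shows "polytime_on D E (enc_list_of enc_clause) (\<lambda>a. expand (C a) (j a) (F a))"
proof -
  have "polytime_on UNIV (enc_pair enc_unary (enc_pair enc_unary enc_inst)) (enc_list_of enc_clause)
      (\<lambda>p. expand (fst p) (fst (snd p)) (snd (snd p)))"
    unfolding expand_def by (rule polytime_rules)+
  from polytime_comp[OF polytime_Pair[OF assms(1) polytime_Pair[OF assms(2,3)]] this] show ?thesis
      by simp
qed

lemma polytime_accept [polytime_rules]:
  assumes "polytime_on D E enc_unary C" "polytime_on D E enc_unary j" "polytime_on D E enc_inst F"
      "polytime_on D E (enc_list_of enc_unary) \<chi>"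
  shows "polytime_on D E enc_bool (\<lambda>a. accept (\<lambda>c. c \<in> table \<Lambda> q) (C a) (j a) (F a) (\<chi> a))"
proof -
  have "polytime_on UNIV (enc_pair enc_unary (enc_pair enc_unary (enc_pair enc_inst
      (enc_list_of enc_unary)))) enc_bool
      (\<lambda>p. accept (\<lambda>c. c \<in> table \<Lambda> q) (fst p) (fst (snd p)) (fst (snd (snd p))) (snd (snd (snd
          p))))"
    unfolding accept_def by (rule polytime_rules)+
  from polytime_comp[OF polytime_Pair[OF assms(1) polytime_Pair[OF assms(2) polytime_Pair[OF
      assms(3,4)]]] this]
  show ?thesis by simp
qed

lemma polytime_max_exp [polytime_rules]:
  assumes "polytime_on D E enc_inst F"
  shows "polytime_on D E enc_unary (\<lambda>a. max_exp c0 (F a))"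
proof -
  have "polytime_on UNIV enc_inst enc_unary (\<lambda>F. max_exp c0 F)"
    unfolding max_exp_def by (rule polytime_rules)+
  from polytime_comp[OF assms this] show ?thesis by simp
qed

section \<open>The algorithm for weighted instances\<close>

text \<open>\<open>offset cs n\<close> is the total number of clones and so bounds every degree,
  which makes one \<open>B\<close> suffice for all variables. \<open>Suc\<close> keeps
  \<open>B\<close> positive when all scopes are empty.\<close>

definition block_count :: "nat \<Rightarrow> clause list \<Rightarrow> nat \<Rightarrow> nat" where
  "block_count R cs n = Suc (R * offset cs n)"

definition trial :: "(csp_inst \<Rightarrow> nat list) \<Rightarrow> csp \<Rightarrow> nat \<Rightarrow> nat \<Rightarrow> nat \<Rightarrow> nat \<Rightarrow> csp_inst \<Rightarrow> nat \<Rightarrow>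
    nat list" where
  "trial alg \<Lambda> q K R C F j =
     round_assignment (\<lambda>c. c \<in> table \<Lambda> q) q K (block_count R (expand C j F) (nvars F)) (nvars F)
         (expand C j F)
       (alg (reg_inst K (block_count R (expand C j F) (nvars F)) (nvars F) (expand C j F)))"

text \<open>
  The index \<open>i\<close> stands for the exponent \<open>max_exp c0 F - i\<close>, so the result is the accepted trial
  with the largest exponent.
\<close>

definition solve :: "(csp_inst \<Rightarrow> nat list) \<Rightarrow> csp \<Rightarrow> nat \<Rightarrow> nat \<Rightarrow> nat \<Rightarrow> nat \<Rightarrow> nat \<Rightarrow> csp_inst \<Rightarrow>
    nat list" where
  "solve alg \<Lambda> q K R \<gamma> c0 F = foldr (\<lambda>i s.
     if accept (\<lambda>c. c \<in> table \<Lambda> q) (\<gamma> * length (constraints F)) (max_exp c0 F - i) F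
          (trial alg \<Lambda> q K R (\<gamma> * length (constraints F)) F (max_exp c0 F - i))
     then trial alg \<Lambda> q K R (\<gamma> * length (constraints F)) F (max_exp c0 F - i) else s)
     [0..<Suc (max_exp c0 F)] []"

text \<open>\<open>foldr\<close> applies the leftmost index last, so the first index satisfying
  \<open>P\<close> overrides all later ones.\<close>

lemma foldr_first:
  assumes "i0 < N" "P i0"
  obtains i where "i \<le> i0" "P i" "foldr (\<lambda>i s. if P i then f i else s) [0..<N] z = f i"
proof -
  have "\<exists>i\<le>i0. P i \<and> foldr (\<lambda>i s. if P i then f i else s) [m..<N] z = f i" if "m \<le> i0" for m
    using that
  proof (induction "i0 - m" arbitrary: m)
    case 0
    then have "m = i0" by simp
    then show ?case using assms by (auto simp: upt_conv_Cons)
  next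
    case (Suc k)
    then have m: "m < i0" by simp
    show ?case
    proof (cases "P m")
      case True
      then show ?thesis using m assms(1) by (intro exI[of _ m]) (simp add: upt_conv_Cons)
    next
      case False
      then show ?thesis using Suc.hyps(1)[of "Suc m"] Suc.hyps(2) m assms(1)
          by (simp add: upt_conv_Cons)
    qed
  qed
  from this[of 0] show thesis using that by auto
qed

lemma size_enc_assignment_le:
  assumes "\<chi> \<in> assignments q F"
  shows "size (enc_list_of enc_unary \<chi>) \<le> size (enc_inst F) * Suc q"
proof -
  have "size (enc_list_of enc_unary \<chi>) \<le> nvars F * Suc q"
    using size_enc_list_of_unary_le[of \<chi> q] assms by (simp add: assignments_def)
  also have "\<dots> \<le> size (enc_inst F) * Suc q"
    by (intro mult_right_mono) (auto simp: enc_inst_def)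
  finally show ?thesis .
qed

text \<open>\<open>R\<close> controls the loss by cloning and \<open>\<epsilon>\<close> the loss by
  rounding weights. \<open>c0\<close> makes the range of exponents long enough to reach precision
  \<open>\<epsilon>\<close>, and \<open>\<gamma>\<close> is the cap per constraint of the instance:
  it exceeds what a trial can satisfy at the least exponent of that precision.\<close>

locale reduction =
  fixes alg :: "csp_inst \<Rightarrow> nat list" and \<Lambda> :: csp and q K R \<gamma> c0 :: nat and \<alpha> \<epsilon> :: real
  assumes alg_mem: "\<And>G. G \<in> unweighted_regular_instances \<Lambda> \<Longrightarrow> alg G \<in> assignments q G"
    and alg_approx: "\<And>G. G \<in> unweighted_regular_instances \<Lambda> \<Longrightarrow>
      real_of_rat (Val \<Lambda> G (alg G)) \<le> \<alpha> * real_of_rat (Opt \<Lambda> q G)"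
    and \<alpha>: "\<alpha> > 1" and q: "q > 0"
    and K: "\<And>P. P \<in> set \<Lambda> \<Longrightarrow> arity P \<le> K"
    and R: "R > 0" and \<epsilon>: "0 < \<epsilon>" "\<epsilon> < 1"
    and c0: "c0 > 0" "1 / \<epsilon> \<le> 2 ^ c0"
    and \<gamma>: "\<alpha> * (1 + 1 / R) ^ K * (1 + 2 / \<epsilon>) < \<gamma>"
begin

abbreviation (input) satisfied :: "clause \<Rightarrow> bool" where
  "satisfied \<equiv> \<lambda>c. c \<in> table \<Lambda> q"

definition ratio :: real where
  "ratio = \<alpha> * (1 + 1 / R) ^ K"

lemma ratio_pos: "ratio > 0"
  unfolding ratio_def using \<alpha> by (intro mult_pos_pos zero_less_power) (auto intro: add_pos_nonneg)

lemma \<gamma>_pos: "\<gamma> > 0"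
proof -
  have "0 < ratio * (1 + 2 / \<epsilon>)" using ratio_pos \<epsilon> by (intro mult_pos_pos add_pos_pos) auto
  then show ?thesis using \<gamma> unfolding ratio_def by linarith
qed

context
  fixes F
  assumes F: "F \<in> weighted_instances \<Lambda>"
begin

abbreviation (input) "m \<equiv> length (constraints F)"
abbreviation (input) "T \<equiv> trial alg \<Lambda> q K R (\<gamma> * m) F"
abbreviation (input) "V \<chi> \<equiv> real_of_rat (Val \<Lambda> F \<chi>)"
abbreviation (input) "W j \<chi> \<equiv> real (nsat satisfied (expand (\<gamma> * m) j F) \<chi>)"

lemma m_pos: "m > 0"
  using F by (auto simp: weighted_instances_def)

lemma csp_clauses_expand:
  "csp_clauses (nvars F) K (block_count R (expand (\<gamma> * m) j F) (nvars F)) (expand (\<gamma> * m) j F) \<Lambda>"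
proof
  show "expand (\<gamma> * m) j F \<noteq> []" by (rule expand_nonempty[OF F]) (use m_pos \<gamma>_pos in simp)
  fix c assume "c \<in> set (expand (\<gamma> * m) j F)"
  from wf_expand[OF F this] have w: "wf_clause \<Lambda> (nvars F) c" .
  then show "wf_clause \<Lambda> (nvars F) c" "distinct (snd c)" "set (snd c) \<subseteq> {..<nvars F}"
      "length (snd c) \<le> K"
    using K[OF nth_mem] by (auto simp: wf_clause_def)
qed (simp add: block_count_def)

lemma reg_inst_expand_mem:
  "reg_inst K (block_count R (expand (\<gamma> * m) j F) (nvars F)) (nvars F) (expand (\<gamma> * m) j F)
    \<in> unweighted_regular_instances \<Lambda>"
  by (rule csp_clauses.reg_inst_mem[OF csp_clauses_expand])

lemma trial_mem: "T j \<in> assignments q F"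
  unfolding trial_def assignments_def using round_assignment_mem[OF q] by simp

lemma trial_approx: "\<chi> \<in> assignments q F \<Longrightarrow> W j (T j) \<le> ratio * W j \<chi>"
  unfolding trial_def ratio_def
  using csp_clauses.round_assignment_approx[OF csp_clauses_expand q R _ alg_mem alg_approx,
      OF _ reg_inst_expand_mem reg_inst_expand_mem] \<alpha>
  by (simp add: assignments_def block_count_def)

lemma solve_eq_trial:
  assumes "accept satisfied (\<gamma> * m) j F (T j)" "j \<le> max_exp c0 F"
  obtains j' where "j \<le> j'" "solve alg \<Lambda> q K R \<gamma> c0 F = T j'" "accept satisfied (\<gamma> * m) j' F (T j')"
proof -
  let ?J = "max_exp c0 F"
  let ?P = "\<lambda>i. accept satisfied (\<gamma> * m) (?J - i) F (T (?J - i))"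
  have P: "?J - j < Suc ?J" "?P (?J - j)" using assms by simp_all
  obtain i where i: "i \<le> ?J - j" "?P i"
    "foldr (\<lambda>i s. if ?P i then T (?J - i) else s) [0..<Suc ?J] [] = T (?J - i)"
    by (rule foldr_first[where P = ?P and f = "\<lambda>i. T (?J - i)" and z = "[]", OF P]) (rule that)
  have "solve alg \<Lambda> q K R \<gamma> c0 F = T (?J - i)"
    unfolding solve_def by (rule i(3))
  moreover have "j \<le> ?J - i" using i(1) assms(2) by simp
  ultimately show thesis using that i(2) by blast
qed

lemma Val_trial_le:
  assumes "accept satisfied (\<gamma> * m) j F (T j)" "\<chi> \<in> assignments q F"
  shows "2 ^ j * V (T j) \<le> ratio * W j \<chi>"
  using Val_le_nsat_expand[OF F trial_mem assms(1)] trial_approx[OF assms(2)] by (rule order_trans)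

lemma solve_approx:
  assumes \<chi>: "\<chi> \<in> assignments q F"
  shows "solve alg \<Lambda> q K R \<gamma> c0 F \<in> assignments q F"
    and "V (solve alg \<Lambda> q K R \<gamma> c0 F) \<le> ratio * (1 + \<epsilon>) * V \<chi>"
proof -
  let ?J = "max_exp c0 F"
  have C: "real (\<gamma> * m) > 0" using \<gamma>_pos m_pos by simp
  have V0: "V \<chi> \<ge> 0"
    unfolding Val_sat_at[OF F \<chi>] using nonneg[OF F] by (intro sum_list_nonneg) auto
  have "solve alg \<Lambda> q K R \<gamma> c0 F \<in> assignments q F \<and> V (solve alg \<Lambda> q K R \<gamma> c0 F) \<le>
      ratio * (1 + \<epsilon>) * V \<chi>"
  proof (cases "V \<chi> = 0")
    case True
    \<comment> \<open>\<open>\<chi>\<close> satisfies no copy at any exponent, so neither does any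
      trial; already the largest exponent is accepted.\<close>
    have W0: "W j \<chi> = 0" for j using nsat_expand_eq_0[OF F \<chi> True] by simp
    have "W ?J (T ?J) \<le> 0" using trial_approx[OF \<chi>, of ?J] W0 by simp
    then have "real (nsat satisfied (expand (\<gamma> * m) ?J F) (T ?J)) < real (\<gamma> * m)" using C
        by linarith
    then have "accept satisfied (\<gamma> * m) ?J F (T ?J)"
      by (intro acceptI[OF F trial_mem]) (simp only: of_nat_less_iff)
    then obtain j where j: "solve alg \<Lambda> q K R \<gamma> c0 F = T j" "accept satisfied (\<gamma> * m) j F (T j)"
      by (rule solve_eq_trial) auto
    have "2 ^ j * V (T j) \<le> 0" using Val_trial_le[OF j(2) \<chi>] W0 by simp
    then have "V (T j) \<le> 0" by (meson mult_pos_pos not_le zero_less_numeral zero_less_power)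
    then show ?thesis using j True trial_mem by simp
  next
    case False
    then have Vp: "V \<chi> > 0" using V0 by simp
    \<comment> \<open>At such exponents the rounding error, at most one copy per constraint, is at
      most an \<epsilon> fraction of the scaled value.\<close>
    let ?P = "\<lambda>j. real m \<le> \<epsilon> * (2 ^ j * V \<chi>)"
    have "?P ?J"
    proof -
      have "real m = \<epsilon> * (1 / \<epsilon> * real m)" using \<epsilon> by simp
      also have "\<dots> \<le> \<epsilon> * (2 ^ c0 * real m)"
        using \<epsilon> c0 by (intro mult_left_mono mult_right_mono) auto
      also have "\<dots> \<le> \<epsilon> * (2 ^ ?J * V \<chi>)"
        using \<epsilon> Val_ge[OF F \<chi> False c0(1)] by (intro mult_left_mono) auto
      finally show ?thesis .
    qed
    define j where "j = (LEAST j. ?P j)"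
    have Pj: "?P j" unfolding j_def using \<open>?P ?J\<close> by (rule LeastI)
    have jJ: "j \<le> ?J" unfolding j_def using \<open>?P ?J\<close> by (rule Least_le)
    \<comment> \<open>Exponent 0 is too coarse because \<open>V \<chi> \<le> 1\<close>. So the least
      exponent has a predecessor, whose failure bounds the scaled value from above by
      \<open>2 / \<epsilon> * m\<close>.\<close>
    have "\<not> ?P 0"
    proof
      assume "?P 0"
      also have "\<epsilon> * (2 ^ 0 * V \<chi>) \<le> \<epsilon> * 1" using Val_le_1[OF F \<chi>] \<epsilon> by (intro mult_left_mono) auto
      finally show False using \<epsilon> m_pos by simp
    qed
    then obtain k where k: "j = Suc k" using Pj by (cases j) auto
    then have "\<not> ?P k" using not_less_Least[of k ?P] by (simp add: j_def[symmetric])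
    then have "2 ^ j * V \<chi> < 2 / \<epsilon> * real m"
      using \<epsilon> k by (simp add: field_simps)
    then have "real m + 2 ^ j * V \<chi> \<le> (1 + 2 / \<epsilon>) * real m" by (simp add: algebra_simps)
    with nsat_expand_le[OF F \<chi>, of "\<gamma> * m" j] have "W j \<chi> \<le> (1 + 2 / \<epsilon>) * real m"
      by (rule order_trans)
    then have "ratio * W j \<chi> \<le> ratio * ((1 + 2 / \<epsilon>) * real m)" using ratio_pos
        by (intro mult_left_mono) auto
    with trial_approx[OF \<chi>] have "W j (T j) \<le> ratio * (1 + 2 / \<epsilon>) * real m"
      by (fastforce simp: mult.assoc intro: order_trans)
    also have "\<dots> < real \<gamma> * real m" using \<gamma> m_pos by (intro mult_strict_right_mono) (auto simp:
        ratio_def)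
    finally have "real (nsat satisfied (expand (\<gamma> * m) j F) (T j)) < real (\<gamma> * m)" by simp
    then have "accept satisfied (\<gamma> * m) j F (T j)"
      by (intro acceptI[OF F trial_mem]) (simp only: of_nat_less_iff)
    then obtain j' where j': "j \<le> j'" "solve alg \<Lambda> q K R \<gamma> c0 F = T j'" "accept satisfied (\<gamma> * m)
        j' F (T j')"
      using jJ by (rule solve_eq_trial)
    \<comment> \<open>The relative rounding error only shrinks for larger exponents, so any accepted
      exponent above \<open>j\<close> is as good as \<open>j\<close>.\<close>
    have "real m \<le> \<epsilon> * (2 ^ j' * V \<chi>)"
      using Pj j'(1) \<epsilon> Vp by (elim order_trans) (intro mult_left_mono mult_right_mono
          power_increasing; simp)
    then have "real m + 2 ^ j' * V \<chi> \<le> (1 + \<epsilon>) * (2 ^ j' * V \<chi>)" by (simp add: algebra_simps)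
    with nsat_expand_le[OF F \<chi>, of "\<gamma> * m" j'] have "W j' \<chi> \<le> (1 + \<epsilon>) * (2 ^ j' * V \<chi>)"
      by (rule order_trans)
    then have "ratio * W j' \<chi> \<le> ratio * ((1 + \<epsilon>) * (2 ^ j' * V \<chi>))" using ratio_pos
        by (intro mult_left_mono) auto
    with Val_trial_le[OF j'(3) \<chi>] have "2 ^ j' * V (T j') \<le> ratio * ((1 + \<epsilon>) * (2 ^ j' * V \<chi>))"
      by (rule order_trans)
    also have "\<dots> = 2 ^ j' * (ratio * (1 + \<epsilon>) * V \<chi>)" by (simp add: mult_ac)
    finally have "V (T j') \<le> ratio * (1 + \<epsilon>) * V \<chi>" by simp
    then show ?thesis using j' trial_mem by simp
  qed
  then show "solve alg \<Lambda> q K R \<gamma> c0 F \<in> assignments q F" "V (solve alg \<Lambda> q K R \<gamma> c0 F) \<le>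
      ratio * (1 + \<epsilon>) * V \<chi>"
    by auto
qed

lemma Opt_attained: obtains \<chi> where "\<chi> \<in> assignments q F" "Val \<Lambda> F \<chi> = Opt \<Lambda> q F"
proof -
  have "replicate (nvars F) 0 \<in> assignments q F" using q by (auto simp: assignments_def)
  then have "Opt \<Lambda> q F \<in> Val \<Lambda> F ` assignments q F"
    unfolding Opt_def by (intro Min_in finite_imageI finite_assignments) auto
  then show thesis using that by auto
qed

end

lemma polytime_trial:
  assumes "polytime_on (unweighted_regular_instances \<Lambda>) enc_inst (enc_list_of enc_unary) alg"
    "\<And>a. a \<in> D \<Longrightarrow> F a \<in> weighted_instances \<Lambda>" "polytime_on D E enc_inst F"
        "polytime_on D E enc_unary j"
  shows "polytime_on D E (enc_list_of enc_unary) (\<lambda>a. trial alg \<Lambda> q K R (\<gamma> * length (constraints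
      (F a))) (F a) (j a))"
proof -
  let ?cs = "\<lambda>a. expand (\<gamma> * length (constraints (F a))) (j a) (F a)"
  have B: "polytime_on D E enc_unary (\<lambda>a. block_count R (?cs a) (nvars (F a)))"
    unfolding block_count_def by (rule assms polytime_rules)+
  have "polytime_on D E enc_inst (\<lambda>a. reg_inst K (block_count R (?cs a) (nvars (F a))) (nvars (F
      a)) (?cs a))"
    by (rule assms B polytime_rules)+
  \<comment> \<open>\<open>alg\<close> is known to be polynomial only on unweighted regular
    instances, so this promise has to be discharged for the constructed instance.\<close>
  from polytime_comp[OF this assms(1) reg_inst_expand_mem[OF assms(2)]]
  have "polytime_on D E (enc_list_of enc_unary) (\<lambda>a. alg (reg_inst K (block_count R (?cs a) (nvars
      (F a))) (nvars (F a)) (?cs a)))" .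
  then show ?thesis
    unfolding trial_def by (rule polytime_round_assignment[OF q B,
        rotated 2]) (rule assms polytime_rules)+
qed

lemma polytime_solve:
  assumes "polytime_on (unweighted_regular_instances \<Lambda>) enc_inst (enc_list_of enc_unary) alg"
  shows "polytime_on (weighted_instances \<Lambda>) enc_inst (enc_list_of enc_unary) (solve alg \<Lambda> q K R \<gamma>
      c0)"
proof -
  let ?W = "weighted_instances \<Lambda>"
  let ?D = "{(F, i :: nat, s :: nat list). F \<in> weighted_instances \<Lambda>}"
  let ?E = "enc_pair enc_inst (enc_pair enc_unary (enc_list_of enc_unary))"
  let ?j = "\<lambda>F i. max_exp c0 F - i"
  let ?C = "\<lambda>F. \<gamma> * length (constraints F)"
  let ?t = "\<lambda>F i. trial alg \<Lambda> q K R (?C F) F (?j F i)"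
  let ?f = "\<lambda>F i s. if accept satisfied (?C F) (?j F i) F (?t F i) then ?t F i else s"
  have "polytime_on ?W enc_inst (enc_list_of enc_unary) (\<lambda>F. foldr (?f F) [0..<Suc (max_exp c0 F)]
      [])"
  proof (rule polytime_foldr[where D' = ?D and f = ?f])
    have t: "polytime_on ?D ?E (enc_list_of enc_unary) (\<lambda>p. ?t (fst p) (fst (snd p)))"
      by (rule polytime_trial[OF assms]) (auto, (rule polytime_rules)+)
    show "polytime_on ?D ?E (enc_list_of enc_unary) (\<lambda>p. ?f (fst p) (fst (snd p)) (snd (snd p)))"
      by (rule t polytime_rules)+
    show "poly_bounded ?W enc_inst (\<lambda>F. size (enc_inst F) * Suc q)"
      by (intro poly_bounded_mult poly_bounded_size poly_bounded_const)
    show "size (enc_list_of enc_unary (foldr (?f F) us [])) \<le> size (enc_inst F) * Suc q"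
      if F: "F \<in> ?W" for F us
    proof -
      \<comment> \<open>The state never grows: it is the initial \<open>[]\<close> or the outcome of
        a single trial.\<close>
      have "foldr (?f F) us [] \<in> insert [] (assignments q F)"
        using trial_mem[OF F] by (induction us) auto
      then show ?thesis using size_enc_assignment_le by auto
    qed
  qed (auto intro!: polytime_upt polytime_Suc polytime_max_exp polytime_id polytime_const simp
      del: upt_Suc)
  then show ?thesis unfolding solve_def .
qed

end

text \<open>Over an empty alphabet an instance with a variable has no assignment, so the algorithm
  could not answer on the regular instance \<open>G\<close>.\<close>

lemma q_pos_if_alg:
  assumes "F \<in> weighted_instances \<Lambda>"
    and "\<And>G. G \<in> unweighted_regular_instances \<Lambda> \<Longrightarrow> alg G \<in> assignments q G"
  shows "q > 0"
proof -
  have "constraints F \<noteq> []" using assms(1) by (auto simp: weighted_instances_def)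
  then obtain c where "c \<in> set (constraints F)" by (cases "constraints F") auto
  then have \<Lambda>: "0 < length \<Lambda>" using assms(1) by (auto simp: weighted_instances_def
      wf_constraint_def)
  let ?k = "arity (\<Lambda> ! 0)"
  \<comment> \<open>\<open>max 1\<close> provides a variable even for arity 0, where all degrees are
    0; otherwise each variable has degree 1.\<close>
  define G where "G = Inst (max 1 ?k) [Constraint 1 0 [0..<?k]]"
  have "\<forall>i<nvars G. degree_of G i = of_bool (?k > 0)"
    by (auto simp: G_def degree_of_def)
  then have "G \<in> unweighted_regular_instances \<Lambda>"
    using \<Lambda> by (auto simp: unweighted_regular_instances_def weighted_instances_def wf_constraint_def
        unweighted_def regular_def G_def)
  from assms(2)[OF this] have "length (alg G) > 0" "set (alg G) \<subseteq> {..<q}"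
    by (auto simp: assignments_def G_def)
  then show ?thesis by (cases "alg G") auto
qed

text \<open>Choosing one output per instance turns the program into a function. The size of the
  output is bounded because it is an assignment; the running time alone would not bound it.\<close>

lemma approx_algorithm_polytime:
  assumes "approx_algorithm \<Lambda> q K \<alpha> p"
  obtains alg where "polytime_on K enc_inst (enc_list_of enc_unary) alg"
    "\<And>F. F \<in> K \<Longrightarrow> alg F \<in> assignments q F"
    "\<And>F. F \<in> K \<Longrightarrow> real_of_rat (Val \<Lambda> F (alg F)) \<le> \<alpha> * real_of_rat (Opt \<Lambda> q F)"
proof -
  obtain b where "\<forall>F\<in>K. \<exists>\<chi> t. runs p (enc_inst F) (enc_assignment \<chi>) t \<and> t \<le>
      poly b (size (enc_inst F)) \<and>
      \<chi> \<in> assignments q F \<and> real_of_rat (Val \<Lambda> F \<chi>) \<le> \<alpha> * real_of_rat (Opt \<Lambda> q F)"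
    using assms unfolding approx_algorithm_def by blast
  then obtain alg where alg: "\<And>F. F \<in> K \<Longrightarrow> \<exists>t. runs p (enc_inst F) (enc_assignment (alg F)) t \<and>
      t \<le> poly b (size (enc_inst F)) \<and> alg F \<in> assignments q F \<and>
      real_of_rat (Val \<Lambda> F (alg F)) \<le> \<alpha> * real_of_rat (Opt \<Lambda> q F)"
    by metis
  have "polytime_on K enc_inst (enc_list_of enc_unary) alg"
  proof (rule polytimeI)
    show "poly_bounded K enc_inst (\<lambda>F. poly b (size (enc_inst F)))"
      by (intro poly_bounded_poly poly_bounded_size)
    show "poly_bounded K enc_inst (\<lambda>F. size (enc_list_of enc_unary (alg F)))"
      by (rule poly_bounded_mono[OF poly_bounded_mult[OF poly_bounded_size poly_bounded_const[of _
          _ "Suc q"]]])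
        (use alg size_enc_assignment_le in blast)
    show "\<exists>t\<le>poly b (size (enc_inst F)). eval (fundefs p) [enc_inst F] (main p)
        (enc_list_of enc_unary (alg F)) t"
      if "F \<in> K" for F
      using alg[OF that] by (auto simp: runs_def enc_assignment_def enc_list_of_def)
  qed
  then show thesis using that alg by blast
qed

lemma approx_algorithmI:
  assumes "polytime_on K enc_inst (enc_list_of enc_unary) alg"
    "\<And>F. F \<in> K \<Longrightarrow> alg F \<in> assignments q F"
    "\<And>F. F \<in> K \<Longrightarrow> real_of_rat (Val \<Lambda> F (alg F)) \<le> \<alpha> * real_of_rat (Opt \<Lambda> q F)"
  shows "\<exists>p. approx_algorithm \<Lambda> q K \<alpha> p"
  using assms(1)
proof (rule polytimeE)
  fix fs ex h
  assume h: "poly_bounded K enc_inst h"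
    and ev: "\<And>F. F \<in> K \<Longrightarrow> \<exists>t\<le>h F. eval fs [enc_inst F] ex (enc_list_of enc_unary (alg F)) t"
  obtain b where b: "\<And>F. F \<in> K \<Longrightarrow> h F \<le> poly b (size (enc_inst F))"
    using h unfolding poly_bounded_def by blast
  have "approx_algorithm \<Lambda> q K \<alpha> (Program fs ex)"
    unfolding approx_algorithm_def
  proof (intro exI[of _ b] ballI)
    fix F assume F: "F \<in> K"
    obtain t where "t \<le> h F" "eval fs [enc_inst F] ex (enc_list_of enc_unary (alg F)) t"
      using ev[OF F] by blast
    then show "\<exists>\<chi> t. runs (Program fs ex) (enc_inst F) (enc_assignment \<chi>) t \<and> t \<le>
        poly b (size (enc_inst F)) \<and>
        \<chi> \<in> assignments q F \<and> real_of_rat (Val \<Lambda> F \<chi>) \<le> \<alpha> * real_of_rat (Opt \<Lambda> q F)"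
      using b[OF F] assms(2,3)[OF F]
      by (intro exI[of _ "alg F"] exI[of _ t]) (auto simp: runs_def enc_assignment_def
          enc_list_of_def)
  qed
  then show ?thesis by blast
qed

lemma exists_parameters:
  fixes \<alpha> \<delta> :: real and K :: nat
  assumes "\<alpha> > 1" "\<delta> > 0"
  obtains \<epsilon> :: real and R c0 \<gamma> :: nat where "0 < \<epsilon>" "\<epsilon> < 1" "R > 0" "c0 > 0" "1 / \<epsilon> \<le> 2 ^ c0"
    "\<alpha> * (1 + 1 / R) ^ K * (1 + 2 / \<epsilon>) < \<gamma>" "\<alpha> * (1 + 1 / R) ^ K * (1 + \<epsilon>) \<le> \<alpha> + \<delta>"
proof -
  \<comment> \<open>As \<open>\<epsilon> < 1\<close>,
    \<open>(1 + \<epsilon>) * (1 + \<epsilon>) \<le> 1 + 3 * \<epsilon>\<close>; one factor is for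
    the weights, the other absorbs the \<open>K\<close> factors lost by cloning. Hence the 3 in the
    denominator.\<close>
  define \<epsilon> where "\<epsilon> = min (1 / 2) (\<delta> / (3 * \<alpha>))"
  have \<epsilon>: "0 < \<epsilon>" "\<epsilon> < 1" using assms by (auto simp: \<epsilon>_def)
  have "(\<lambda>n. (1 + inverse (real (Suc n))) ^ K) \<longlonglongrightarrow> (1 + 0) ^ K"
    by (intro tendsto_intros LIMSEQ_inverse_real_of_nat)
  then have "eventually (\<lambda>n. (1 + inverse (real (Suc n))) ^ K < 1 + \<epsilon>) sequentially"
    using \<epsilon> by (intro order_tendstoD) auto
  then obtain n where n: "(1 + inverse (real (Suc n))) ^ K < 1 + \<epsilon>"
    by (auto simp: eventually_sequentially)
  obtain c where c: "1 / \<epsilon> < 2 ^ c" using real_arch_pow[of 2 "1 / \<epsilon>"] by auto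
  also have "(2 :: real) ^ c \<le> 2 ^ Suc c" by simp
  finally have c': "1 / \<epsilon> \<le> 2 ^ Suc c" by simp
  obtain \<gamma> :: nat where \<gamma>: "\<alpha> * (1 + 1 / real (Suc n)) ^ K * (1 + 2 / \<epsilon>) < \<gamma>"
    using reals_Archimedean2 by blast
  have "\<alpha> * (1 + 1 / real (Suc n)) ^ K * (1 + \<epsilon>) \<le> \<alpha> * (1 + \<epsilon>) * (1 + \<epsilon>)"
    using n assms \<epsilon> by (intro mult_right_mono mult_left_mono) (auto simp: inverse_eq_divide)
  also have "\<dots> = \<alpha> + \<alpha> * \<epsilon> * (2 + \<epsilon>)" by (simp add: algebra_simps)
  also have "\<dots> \<le> \<alpha> + \<alpha> * \<epsilon> * 3" using assms \<epsilon> by (intro add_left_mono mult_left_mono) auto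
  also have "\<alpha> * \<epsilon> * 3 \<le> \<alpha> * (\<delta> / (3 * \<alpha>)) * 3"
    using assms by (intro mult_right_mono mult_left_mono) (auto simp: \<epsilon>_def)
  also have "\<dots> = \<delta>" using assms by simp
  finally show thesis using that[of \<epsilon> "Suc n" "Suc c" \<gamma>] \<epsilon> c' \<gamma> by simp
qed

theorem theorem2:
  fixes \<Lambda> :: csp and q :: nat and \<alpha> :: real
  assumes "\<alpha> > 1"
    and "\<exists>p. approx_algorithm \<Lambda> q (unweighted_regular_instances \<Lambda>) \<alpha> p"
  shows "\<forall>\<delta>>0. \<exists>p. approx_algorithm \<Lambda> q (weighted_instances \<Lambda>) (\<alpha> + \<delta>) p"
proof (intro allI impI)
  fix \<delta> :: real assume \<delta>: "\<delta> > 0"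
  obtain alg where alg: "polytime_on (unweighted_regular_instances \<Lambda>) enc_inst
      (enc_list_of enc_unary) alg"
    "\<And>F. F \<in> unweighted_regular_instances \<Lambda> \<Longrightarrow> alg F \<in> assignments q F"
    "\<And>F. F \<in> unweighted_regular_instances \<Lambda> \<Longrightarrow>
       real_of_rat (Val \<Lambda> F (alg F)) \<le> \<alpha> * real_of_rat (Opt \<Lambda> q F)"
    using assms(2) approx_algorithm_polytime by blast
  show "\<exists>p. approx_algorithm \<Lambda> q (weighted_instances \<Lambda>) (\<alpha> + \<delta>) p"
  \<comment> \<open>Without weighted instances the claim is void; otherwise some constraint exists,
    and with it the positivity of \<open>q\<close>.\<close>
  proof (cases "weighted_instances \<Lambda> = {}")
    case True
    then show ?thesis by (simp add: approx_algorithm_def)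
  next
    case False
    then have q: "q > 0" using q_pos_if_alg[OF _ alg(2)] by blast
    define K where "K = Max (insert 0 (arity ` set \<Lambda>))"
    obtain \<epsilon> R c0 \<gamma> where par: "0 < \<epsilon>" "\<epsilon> < 1" "R > 0" "c0 > 0" "1 / \<epsilon> \<le> 2 ^ c0"
      "\<alpha> * (1 + 1 / real R) ^ K * (1 + 2 / \<epsilon>) < real \<gamma>" "\<alpha> * (1 + 1 / real R) ^ K * (1 + \<epsilon>) \<le> \<alpha> + \<delta>"
      using exists_parameters[OF assms(1) \<delta>, of K] .
    interpret reduction alg \<Lambda> q K R \<gamma> c0 \<alpha> \<epsilon>
      using alg(2,3) q par assms(1) by unfold_locales (auto simp: K_def)
    show ?thesis
    proof (rule approx_algorithmI[OF polytime_solve[OF alg(1)]])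
      fix F assume F: "F \<in> weighted_instances \<Lambda>"
      obtain \<chi> where \<chi>: "\<chi> \<in> assignments q F" "Val \<Lambda> F \<chi> = Opt \<Lambda> q F"
        using Opt_attained[OF F] .
      show "solve alg \<Lambda> q K R \<gamma> c0 F \<in> assignments q F" by (rule solve_approx(1)[OF F \<chi>(1)])
      have "0 \<le> real_of_rat (Val \<Lambda> F \<chi>)"
        unfolding Val_sat_at[OF F \<chi>(1)] using nonneg[OF F] by (intro sum_list_nonneg) auto
      then have "ratio * (1 + \<epsilon>) * real_of_rat (Val \<Lambda> F \<chi>) \<le> (\<alpha> + \<delta>) * real_of_rat (Val \<Lambda> F \<chi>)"
        using par(7) by (intro mult_right_mono) (simp_all add: ratio_def)
      with solve_approx(2)[OF F \<chi>(1)]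
      show "real_of_rat (Val \<Lambda> F (solve alg \<Lambda> q K R \<gamma> c0 F)) \<le> (\<alpha> + \<delta>) * real_of_rat (Opt \<Lambda> q F)"
        unfolding \<chi>(2)[symmetric] by (rule order_trans)
    qed
  qed
qed

end
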